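(* If $U_0\in\mathcal{M}^N_{\geqslant}$, then the problem $$\frac{\mathrm{d}U}{\mathrm{d}t}=\mathcal{G}U-U\langle\mathcal{G}U,U\rangle,\qquad U(0)=U_0$$ admits a unique global solution $U\in C^1\big([0,\infty);(H_0^1(\Omega))^N\big)$.
   Context: $\Omega\subset\mathbb{R}^d$ is a bounded domain, and $(\cdot,\cdot)$ denotes the $L^2(\Omega)$ inner product. $\mathcal{V}:\Omega\to\mathbb{R}$ is a potential such that $a(u,v)=\int_\Omega(\nabla u\cdot\nabla v+\mathcal{V}uv)\,dx$ on $H_0^1(\Omega)$ is symmetric, bounded and coercive, with $c_1\|\nabla u\|^2\leqslant a(u,u)\leqslant c_2\|\nabla u\|^2$ for constants $c_1,c_2>0$. The space $H_0^1(\Omega)$ carries the norm $\sqrt{a(u,u)}$. $\mathcal{G}=(-\Delta+\mathcal{V})^{-1}$: for $f\in H^{-1}(\Omega)$, $\mathcal{G}f\in H_0^1(\Omega)$ is the unique element with $a(\mathcal{G}f,v)=\langle f,v\rangle$ for all $v\in H_0^1(\Omega)$. For $N$-tuples $U=(u_1,\dots,u_N)$: - $\mathcal{G}U=(\mathcal{G}u_1,\dots,\mathcal{G}u_N)$; - $UA$ has $j$-th entry $\sum_iu_iA_{ij}$; - $\langle U,V\rangle=((u_i,v_j))_{i,j}$. For symmetric matrices, $A\leqslant B$ means $B-A$ is positive semidefinite. The quasi-Stiefel set is $\mathcal{M}^N_{\geqslant}=\{U\in(H_0^1(\Omega))^N:\langle U,U\rangle\geqslant I_N\}$. *)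

theory Defs
  imports "HOL-Analysis.Analysis"
begin

text \<open>Functions on the domain are represented by functions 'd => real on the ambient
Euclidean space; elements of H_0^1 are identified when they agree in the H-norm.\<close>

definition bdomain :: "'d::euclidean_space set \<Rightarrow> bool" where
  "bdomain \<Omega> \<longleftrightarrow> open \<Omega> \<and> connected \<Omega> \<and> bounded \<Omega> \<and> \<Omega> \<noteq> {}"

definition testfun :: "'d::euclidean_space set \<Rightarrow> ('d \<Rightarrow> real) \<Rightarrow> ('d \<Rightarrow> 'd) \<Rightarrow> bool" where
  "testfun \<Omega> \<phi> g \<longleftrightarrow>
     (\<forall>x. (\<phi> has_derivative (\<lambda>h. g x \<bullet> h)) (at x)) \<and> continuous_on UNIV g \<and>
     compact (closure {x. \<phi> x \<noteq> 0}) \<and> closure {x. \<phi> x \<noteq> 0} \<subseteq> \<Omega>"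

definition H01_pair :: "'d::euclidean_space set \<Rightarrow> ('d \<Rightarrow> real) \<Rightarrow> ('d \<Rightarrow> 'd) \<Rightarrow> bool" where
  "H01_pair \<Omega> u g \<longleftrightarrow>
     u \<in> borel_measurable (lebesgue_on \<Omega>) \<and> g \<in> borel_measurable (lebesgue_on \<Omega>) \<and>
     integrable (lebesgue_on \<Omega>) (\<lambda>x. (u x)^2) \<and>
     integrable (lebesgue_on \<Omega>) (\<lambda>x. (norm (g x))^2) \<and>
     (\<exists>\<phi> \<psi>. (\<forall>k. testfun \<Omega> (\<phi> k) (\<psi> k)) \<and>
        (\<lambda>k. LINT x|lebesgue_on \<Omega>. (\<phi> k x - u x)^2) \<longlonglongrightarrow> 0 \<and>
        (\<lambda>k. LINT x|lebesgue_on \<Omega>. (norm (\<psi> k x - g x))^2) \<longlonglongrightarrow> 0)"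

definition H01 :: "'d::euclidean_space set \<Rightarrow> ('d \<Rightarrow> real) set" where
  "H01 \<Omega> = {u. \<exists>g. H01_pair \<Omega> u g}"

definition wgrad :: "'d::euclidean_space set \<Rightarrow> ('d \<Rightarrow> real) \<Rightarrow> ('d \<Rightarrow> 'd)" where
  "wgrad \<Omega> u = (SOME g. H01_pair \<Omega> u g)"

definition L2inner :: "'d::euclidean_space set \<Rightarrow> ('d \<Rightarrow> real) \<Rightarrow> ('d \<Rightarrow> real) \<Rightarrow> real" where
  "L2inner \<Omega> u v = (LINT x|lebesgue_on \<Omega>. u x * v x)"

definition aform :: "'d::euclidean_space set \<Rightarrow> ('d \<Rightarrow> real) \<Rightarrow> ('d \<Rightarrow> real) \<Rightarrow> ('d \<Rightarrow> real) \<Rightarrow> real" where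
  "aform \<Omega> V u v = (LINT x|lebesgue_on \<Omega>. wgrad \<Omega> u x \<bullet> wgrad \<Omega> v x + V x * u x * v x)"

definition Hnorm :: "'d::euclidean_space set \<Rightarrow> ('d \<Rightarrow> real) \<Rightarrow> ('d \<Rightarrow> real) \<Rightarrow> real" where
  "Hnorm \<Omega> V u = sqrt (aform \<Omega> V u u)"

definition admissible_potential :: "'d::euclidean_space set \<Rightarrow> ('d \<Rightarrow> real) \<Rightarrow> bool" where
  "admissible_potential \<Omega> V \<longleftrightarrow>
     V \<in> borel_measurable (lebesgue_on \<Omega>) \<and>
     (\<forall>u\<in>H01 \<Omega>. \<forall>v\<in>H01 \<Omega>. integrable (lebesgue_on \<Omega>) (\<lambda>x. V x * u x * v x)) \<and>
     (\<exists>c1 c2. c1 > 0 \<and> c2 > 0 \<and> (\<forall>u\<in>H01 \<Omega>.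
        c1 * (LINT x|lebesgue_on \<Omega>. (norm (wgrad \<Omega> u x))^2) \<le> aform \<Omega> V u u \<and>
        aform \<Omega> V u u \<le> c2 * (LINT x|lebesgue_on \<Omega>. (norm (wgrad \<Omega> u x))^2)))"

text \<open>The Green operator G = (-Delta + V)^{-1}: a(G f, v) = (f, v) for all v in H_0^1.\<close>
definition Gop :: "'d::euclidean_space set \<Rightarrow> ('d \<Rightarrow> real) \<Rightarrow> ('d \<Rightarrow> real) \<Rightarrow> ('d \<Rightarrow> real)" where
  "Gop \<Omega> V f = (SOME w. w \<in> H01 \<Omega> \<and> (\<forall>v\<in>H01 \<Omega>. aform \<Omega> V w v = L2inner \<Omega> f v))"

text \<open>N-tuples are indexed by a finite type 'n (N = CARD('n)).\<close>
definition gram :: "'d::euclidean_space set \<Rightarrow> ('n \<Rightarrow> 'd \<Rightarrow> real) \<Rightarrow> ('n \<Rightarrow> 'd \<Rightarrow> real) \<Rightarrow> 'n \<Rightarrow> 'n \<Rightarrow> real" where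
  "gram \<Omega> U W i j = L2inner \<Omega> (U i) (W j)"

definition tmul :: "('n::finite \<Rightarrow> 'd \<Rightarrow> real) \<Rightarrow> ('n \<Rightarrow> 'n \<Rightarrow> real) \<Rightarrow> 'n \<Rightarrow> 'd \<Rightarrow> real" where
  "tmul U A j = (\<lambda>x. \<Sum>i\<in>UNIV. U i x * A i j)"

definition psd :: "('n::finite \<Rightarrow> 'n \<Rightarrow> real) \<Rightarrow> bool" where
  "psd M \<longleftrightarrow> (\<forall>\<xi>. 0 \<le> (\<Sum>i\<in>UNIV. \<Sum>j\<in>UNIV. \<xi> i * M i j * \<xi> j))"

definition quasi_stiefel :: "'d::euclidean_space set \<Rightarrow> ('n::finite \<Rightarrow> 'd \<Rightarrow> real) set" where
  "quasi_stiefel \<Omega> = {U. (\<forall>i. U i \<in> H01 \<Omega>) \<and>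
      psd (\<lambda>i j. gram \<Omega> U U i j - (if i = j then 1 else 0))}"

definition GT :: "'d::euclidean_space set \<Rightarrow> ('d \<Rightarrow> real) \<Rightarrow> ('n \<Rightarrow> 'd \<Rightarrow> real) \<Rightarrow> 'n \<Rightarrow> 'd \<Rightarrow> real" where
  "GT \<Omega> V U = (\<lambda>i. Gop \<Omega> V (U i))"

text \<open>U in C^1([0,inf); (H_0^1)^N) solving dU/dt = G U - U <G U, U>, U(0) = U0,
  all identities in H_0^1 (i.e. up to vanishing H-norm).\<close>
definition is_solution :: "'d::euclidean_space set \<Rightarrow> ('d \<Rightarrow> real) \<Rightarrow> ('n::finite \<Rightarrow> 'd \<Rightarrow> real)
    \<Rightarrow> (real \<Rightarrow> 'n \<Rightarrow> 'd \<Rightarrow> real) \<Rightarrow> bool" where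
  "is_solution \<Omega> V U0 U \<longleftrightarrow>
     (\<forall>t\<ge>0. \<forall>i. U t i \<in> H01 \<Omega>) \<and>
     (\<exists>U'. (\<forall>t\<ge>0. \<forall>i. U' t i \<in> H01 \<Omega>) \<and>
        (\<forall>t\<ge>0. \<forall>i. ((\<lambda>h. Hnorm \<Omega> V (\<lambda>x. (U (t + h) i x - U t i x) / h - U' t i x))
              \<longlongrightarrow> 0) (at 0 within {-t..})) \<and>
        (\<forall>t\<ge>0. \<forall>i. ((\<lambda>s. Hnorm \<Omega> V (\<lambda>x. U' s i x - U' t i x)) \<longlongrightarrow> 0) (at t within {0..})) \<and>
        (\<forall>t\<ge>0. \<forall>i. Hnorm \<Omega> V (\<lambda>x. U' t i x -
              (GT \<Omega> V (U t) i x - tmul (U t) (gram \<Omega> (GT \<Omega> V (U t)) (U t)) i x)) = 0)) \<and>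
     (\<forall>i. Hnorm \<Omega> V (\<lambda>x. U 0 i x - U0 i x) = 0)"

end

theory Submission
  imports Defs
begin

text \<open>
  Realise \<open>H\<^sub>0\<^sup>1(\<Omega>)\<close> as the closure \<open>S\<close> of the pairs \<open>(\<phi>, \<nabla>\<phi>)\<close>, \<open>\<phi>\<close> a test function, in the Hilbert space
  \<open>L\<^sup>2(\<real>\<^sup>d) \<times> L\<^sup>2(\<real>\<^sup>d)\<^sup>d\<close>. The gradient is closable, so a pair in \<open>S\<close> is determined by its first
  component, and by the Poincare inequality the energy norm is equivalent to the norm of \<open>S\<close>. The
  Green operator thus becomes a bounded operator \<open>G\<close>, and the flow becomes the equation
  \<open>u\<^sub>i' = G u\<^sub>i - \<Sum>\<^sub>j (G u\<^sub>j, u\<^sub>i) u\<^sub>j\<close>, whose right-hand side is Lipschitz on balls. Solutions do not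
  blow up: the derivative of \<open>\<Sum>\<^sub>i \<parallel>u\<^sub>i\<parallel>\<^sup>2\<close> is \<open>2 \<Sum>\<^sub>i (G u\<^sub>i, u\<^sub>i)\<^sub>S\<close> minus twice the trace of the product
  of two positive semidefinite matrices, the Gram matrix of \<open>u\<close> and \<open>((G u\<^sub>i, u\<^sub>j))\<^sub>i\<^sub>j\<close>. That trace is
  nonnegative, so \<open>\<parallel>u\<parallel>\<close> grows at most exponentially by Gronwall's inequality.
\<close>

section \<open>The Hilbert space of square-integrable functions\<close>

definition square_integrable :: "('d::euclidean_space \<Rightarrow> 'b::euclidean_space) \<Rightarrow> bool" where
  "square_integrable f \<longleftrightarrow>
     f \<in> borel_measurable lebesgue \<and> integrable lebesgue (\<lambda>x. (norm (f x))\<^sup>2)"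

lemma square_integrable_measurable:
  "square_integrable f \<Longrightarrow> f \<in> borel_measurable lebesgue"
  by (simp add: square_integrable_def)

lemma square_integrable_zero: "square_integrable (\<lambda>x. 0)"
  by (simp add: square_integrable_def)

lemma square_integrable_inner:
  assumes f: "square_integrable f" and g: "square_integrable g"
  shows "integrable lebesgue (\<lambda>x. f x \<bullet> g x)"
proof (rule Bochner_Integration.integrable_bound)
  show "integrable lebesgue (\<lambda>x. (norm (f x))\<^sup>2 + (norm (g x))\<^sup>2)"
    using f g by (auto simp: square_integrable_def)
  show "(\<lambda>x. f x \<bullet> g x) \<in> borel_measurable lebesgue"
    using f g by (auto simp: square_integrable_def)
  have "\<bar>f x \<bullet> g x\<bar> \<le> (norm (f x))\<^sup>2 + (norm (g x))\<^sup>2" for x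
    using Cauchy_Schwarz_ineq2[of "f x" "g x"] sum_squares_bound[of "norm (f x)" "norm (g x)"]
      mult_nonneg_nonneg[OF norm_ge_zero[of "f x"] norm_ge_zero[of "g x"]]
    by linarith
  then show "AE x in lebesgue. norm (f x \<bullet> g x) \<le> norm ((norm (f x))\<^sup>2 + (norm (g x))\<^sup>2)"
    by simp
qed

lemma square_integrable_scaleR:
  "square_integrable f \<Longrightarrow> square_integrable (\<lambda>x. c *\<^sub>R f x)"
  unfolding square_integrable_def by (elim conjE) (simp add: power_mult_distrib, measurable)

lemma square_integrable_add:
  assumes f: "square_integrable f" and g: "square_integrable g"
  shows "square_integrable (\<lambda>x. f x + g x)"
proof -
  have *: "(norm (f x + g x))\<^sup>2 = f x \<bullet> f x + 2 * (f x \<bullet> g x) + g x \<bullet> g x" for x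
    by (simp add: power2_norm_eq_inner inner_simps inner_commute)
  have [measurable]: "f \<in> borel_measurable lebesgue" "g \<in> borel_measurable lebesgue"
    using f g by (auto simp: square_integrable_def)
  have "(\<lambda>x. f x + g x) \<in> borel_measurable lebesgue" by measurable
  then show ?thesis
    using square_integrable_inner[OF f f] square_integrable_inner[OF f g]
      square_integrable_inner[OF g g]
    unfolding square_integrable_def * by simp
qed

lemma square_integrable_minus:
  "square_integrable f \<Longrightarrow> square_integrable (\<lambda>x. - f x)"
  using square_integrable_scaleR[of f "-1"] by simp

lemma square_integrable_diff:
  "square_integrable f \<Longrightarrow> square_integrable g \<Longrightarrow> square_integrable (\<lambda>x. f x - g x)"
  using square_integrable_add[of f "\<lambda>x. - g x"] square_integrable_minus[of g] by simp

definition L2_eq :: "('d::euclidean_space \<Rightarrow> 'b::euclidean_space) \<Rightarrow> ('d \<Rightarrow> 'b) \<Rightarrow> bool" where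
  "L2_eq f g \<longleftrightarrow> square_integrable f \<and> square_integrable g \<and> (AE x in lebesgue. f x = g x)"

quotient_type (overloaded) ('d, 'b) L2 =
  "'d::euclidean_space \<Rightarrow> 'b::euclidean_space" / partial: L2_eq
proof (rule part_equivpI)
  show "\<exists>f::'d \<Rightarrow> 'b. L2_eq f f"
    using square_integrable_zero by (auto simp: L2_eq_def)
  show "symp (L2_eq :: ('d \<Rightarrow> 'b) \<Rightarrow> _)"
    by (auto simp: symp_def L2_eq_def)
  show "transp (L2_eq :: ('d \<Rightarrow> 'b) \<Rightarrow> _)"
    by (auto simp: transp_def L2_eq_def)
qed

instantiation L2 :: (euclidean_space, euclidean_space) real_vector
begin

lift_definition zero_L2 :: "('a, 'b) L2" is "\<lambda>x. 0"
  by (simp add: L2_eq_def square_integrable_zero)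

lift_definition plus_L2 :: "('a, 'b) L2 \<Rightarrow> ('a, 'b) L2 \<Rightarrow> ('a, 'b) L2" is "\<lambda>f g x. f x + g x"
  by (auto simp: L2_eq_def intro: square_integrable_add)

lift_definition minus_L2 :: "('a, 'b) L2 \<Rightarrow> ('a, 'b) L2 \<Rightarrow> ('a, 'b) L2" is "\<lambda>f g x. f x - g x"
  by (auto simp: L2_eq_def intro: square_integrable_diff)

lift_definition uminus_L2 :: "('a, 'b) L2 \<Rightarrow> ('a, 'b) L2" is "\<lambda>f x. - f x"
  by (auto simp: L2_eq_def intro: square_integrable_minus)

lift_definition scaleR_L2 :: "real \<Rightarrow> ('a, 'b) L2 \<Rightarrow> ('a, 'b) L2" is "\<lambda>c f x. c *\<^sub>R f x"
  by (auto simp: L2_eq_def intro: square_integrable_scaleR)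

instance
proof
  fix f g h :: "('a, 'b) L2" and r s :: real
  note L2_simps = L2_eq_def square_integrable_add square_integrable_diff square_integrable_minus
    square_integrable_scaleR square_integrable_zero
  show "f + g + h = f + (g + h)" by transfer (simp add: L2_simps add.assoc)
  show "f + g = g + f" by transfer (simp add: L2_simps add.commute)
  show "0 + f = f" by transfer (simp add: L2_eq_def)
  show "- f + f = 0" by transfer (simp add: L2_simps)
  show "f - g = f + - g" by transfer (simp add: L2_simps)
  show "r *\<^sub>R (f + g) = r *\<^sub>R f + r *\<^sub>R g" by transfer (simp add: L2_simps scaleR_add_right)
  show "(r + s) *\<^sub>R f = r *\<^sub>R f + s *\<^sub>R f" by transfer (simp add: L2_simps scaleR_add_left)
  show "r *\<^sub>R s *\<^sub>R f = (r * s) *\<^sub>R f" by transfer (simp add: L2_simps)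
  show "1 *\<^sub>R f = f" by transfer (simp add: L2_eq_def)
qed

end

instantiation L2 :: (euclidean_space, euclidean_space) real_inner
begin

lift_definition inner_L2 :: "('a, 'b) L2 \<Rightarrow> ('a, 'b) L2 \<Rightarrow> real"
  is "\<lambda>f g. LINT x|lebesgue. f x \<bullet> g x"
  by (rule integral_cong_AE) (auto simp: L2_eq_def square_integrable_def)

definition norm_L2 :: "('a, 'b) L2 \<Rightarrow> real" where "norm_L2 f = sqrt (f \<bullet> f)"
definition dist_L2 :: "('a, 'b) L2 \<Rightarrow> ('a, 'b) L2 \<Rightarrow> real" where "dist_L2 f g = norm (f - g)"
definition sgn_L2 :: "('a, 'b) L2 \<Rightarrow> ('a, 'b) L2" where "sgn_L2 f = f /\<^sub>R norm f"
definition uniformity_L2 :: "(('a, 'b) L2 \<times> ('a, 'b) L2) filter" where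
  "uniformity_L2 = (INF e\<in>{0 <..}. principal {(x, y). dist x y < e})"
definition open_L2 :: "('a, 'b) L2 set \<Rightarrow> bool" where
  "open_L2 U = (\<forall>x\<in>U. \<forall>\<^sub>F (x', y) in uniformity. x' = x \<longrightarrow> y \<in> U)"

instance
proof
  fix f g h :: "('a, 'b) L2" and r s :: real
  show "dist f g = norm (f - g)" by (rule dist_L2_def)
  show "sgn f = f /\<^sub>R norm f" by (rule sgn_L2_def)
  show "uniformity = (INF e\<in>{0 <..}. principal {(x::('a, 'b) L2, y). dist x y < e})"
    by (rule uniformity_L2_def)
  show "open U = (\<forall>x\<in>U. \<forall>\<^sub>F (x', y) in uniformity. x' = x \<longrightarrow> y \<in> U)" for U :: "('a, 'b) L2 set"
    by (rule open_L2_def)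
  show "f \<bullet> g = g \<bullet> f"
    by transfer (simp add: inner_commute)
  show "(f + g) \<bullet> h = f \<bullet> h + g \<bullet> h"
    by transfer (simp add: L2_eq_def inner_add_left square_integrable_inner)
  show "(r *\<^sub>R f) \<bullet> g = r * (f \<bullet> g)"
    by transfer simp
  show "0 \<le> f \<bullet> f"
    by transfer simp
  show "f \<bullet> f = 0 \<longleftrightarrow> f = 0"
  proof transfer
    fix f :: "'a \<Rightarrow> 'b" assume "L2_eq f f"
    then have "square_integrable f" by (simp add: L2_eq_def)
    then have "(LINT x|lebesgue. f x \<bullet> f x) = 0 \<longleftrightarrow> (AE x in lebesgue. f x \<bullet> f x = 0)"
      by (intro integral_nonneg_eq_0_iff_AE square_integrable_inner) auto
    with \<open>square_integrable f\<close> show "(LINT x|lebesgue. f x \<bullet> f x) = 0 \<longleftrightarrow> L2_eq f (\<lambda>x. 0)"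
      by (simp add: L2_eq_def square_integrable_zero)
  qed
  show "norm f = sqrt (f \<bullet> f)" by (rule norm_L2_def)
qed

end

lift_definition toL2 :: "('d::euclidean_space \<Rightarrow> 'b::euclidean_space) \<Rightarrow> ('d, 'b) L2"
  is "\<lambda>f. if square_integrable f then f else (\<lambda>x. 0)"
  by (simp add: L2_eq_def square_integrable_zero)

lemma toL2_eq_iff:
  "square_integrable f \<Longrightarrow> square_integrable g \<Longrightarrow> toL2 f = toL2 g \<longleftrightarrow> (AE x in lebesgue. f x = g x)"
  by transfer (simp add: L2_eq_def)

lemma toL2_cases:
  obtains f where "square_integrable f" "y = toL2 f"
proof -
  have "\<exists>f. square_integrable f \<and> y = toL2 f"
    by transfer (auto simp: L2_eq_def)
  then show ?thesis using that by blast
qed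

lemma toL2_zero: "toL2 (\<lambda>x. 0) = 0"
  by transfer (simp add: L2_eq_def square_integrable_zero)

lemma toL2_add:
  "square_integrable f \<Longrightarrow> square_integrable g \<Longrightarrow> toL2 (\<lambda>x. f x + g x) = toL2 f + toL2 g"
  by transfer (simp add: L2_eq_def square_integrable_add)

lemma toL2_diff:
  "square_integrable f \<Longrightarrow> square_integrable g \<Longrightarrow> toL2 (\<lambda>x. f x - g x) = toL2 f - toL2 g"
  by transfer (simp add: L2_eq_def square_integrable_diff)

lemma toL2_scaleR: "square_integrable f \<Longrightarrow> toL2 (\<lambda>x. c *\<^sub>R f x) = c *\<^sub>R toL2 f"
  by transfer (simp add: L2_eq_def square_integrable_scaleR)

lemma inner_toL2:
  "square_integrable f \<Longrightarrow> square_integrable g \<Longrightarrow> toL2 f \<bullet> toL2 g = (LINT x|lebesgue. f x \<bullet> g x)"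
  by transfer simp

lemma norm_toL2_square:
  "square_integrable f \<Longrightarrow> (norm (toL2 f))\<^sup>2 = (LINT x|lebesgue. (norm (f x))\<^sup>2)"
  by (simp add: power2_norm_eq_inner inner_toL2)

lemma nn_integral_norm_square:
  assumes "square_integrable f"
  shows "(\<integral>\<^sup>+x. ennreal ((norm (f x))\<^sup>2) \<partial>lebesgue) = ennreal ((norm (toL2 f))\<^sup>2)"
  using assms by (simp add: norm_toL2_square nn_integral_eq_integral square_integrable_def)

lemma
  fixes f :: "'d::euclidean_space \<Rightarrow> 'b::euclidean_space" and g :: "'d \<Rightarrow> 'c::euclidean_space"
  assumes f: "f \<in> borel_measurable lebesgue" and g: "square_integrable g"
    and bound: "\<And>x. norm (f x) \<le> c * norm (g x)"
  shows square_integrable_dominated: "square_integrable f"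
    and norm_toL2_dominated: "0 \<le> c \<Longrightarrow> norm (toL2 f) \<le> c * norm (toL2 g)"
proof -
  have square_le: "(norm (f x))\<^sup>2 \<le> c\<^sup>2 * (norm (g x))\<^sup>2" for x
    using power_mono[OF bound[of x], of 2] by (simp add: power_mult_distrib)
  have integrable: "integrable lebesgue (\<lambda>x. c\<^sup>2 * (norm (g x))\<^sup>2)"
    using g by (simp add: square_integrable_def)
  show sq: "square_integrable f"
    unfolding square_integrable_def
  proof (intro conjI f Bochner_Integration.integrable_bound[OF integrable])
    show "AE x in lebesgue. norm ((norm (f x))\<^sup>2) \<le> norm (c\<^sup>2 * (norm (g x))\<^sup>2)"
      using square_le by (intro AE_I2) simp
  qed (use f in measurable)
  assume "0 \<le> c"
  have "(norm (toL2 f))\<^sup>2 \<le> (LINT x|lebesgue. c\<^sup>2 * (norm (g x))\<^sup>2)"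
    unfolding norm_toL2_square[OF sq] using sq integrable square_le
    by (intro integral_mono) (auto simp: square_integrable_def)
  also have "\<dots> = (c * norm (toL2 g))\<^sup>2"
    by (simp add: norm_toL2_square[OF g] power_mult_distrib)
  finally show "norm (toL2 f) \<le> c * norm (toL2 g)"
    by (rule power2_le_imp_le) (simp add: \<open>0 \<le> c\<close>)
qed

section \<open>Completeness of the space of square-integrable functions\<close>

lemma convergent_of_geometric_increments:
  fixes a :: "nat \<Rightarrow> 'a::banach"
  assumes "0 \<le> r" "r < 1" and small: "\<forall>\<^sub>F k in sequentially. norm (a (Suc k) - a k) \<le> r ^ k"
  shows "convergent a"
proof -
  have "summable (\<lambda>k. a (Suc k) - a k)"
    by (rule summable_comparison_test_ev[OF small]) (simp add: assms summable_geometric)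
  then have "convergent (\<lambda>n. a n - a 0)"
    using sum_lessThan_telescope[of a] by (simp add: summable_iff_convergent)
  from convergent_add[OF this convergent_const[of "a 0"]] show ?thesis by simp
qed

lemma Cauchy_fast_subseq:
  fixes Y :: "nat \<Rightarrow> 'a::metric_space"
  assumes "Cauchy Y" and e: "\<And>k. 0 < e k"
  obtains s :: "nat \<Rightarrow> nat" where "strict_mono s" "\<And>k. dist (Y (s (Suc k))) (Y (s k)) < e k"
proof -
  have "\<forall>k. \<exists>M. \<forall>m\<ge>M. \<forall>n\<ge>M. dist (Y m) (Y n) < e k"
    using \<open>Cauchy Y\<close> e unfolding Cauchy_def by blast
  then obtain M where M: "\<And>k m n. m \<ge> M k \<Longrightarrow> n \<ge> M k \<Longrightarrow> dist (Y m) (Y n) < e k"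
    by metis
  define s where "s k = (\<Sum>i\<le>k. M i) + k" for k
  have "s k \<ge> M k" "s (Suc k) \<ge> M k" for k
    unfolding s_def using member_le_sum[of k "{..k}" M] by auto
  then have "dist (Y (s (Suc k))) (Y (s k)) < e k" for k
    by (rule M[rotated])
  moreover have "strict_mono s"
    by (rule strict_monoI_Suc) (simp add: s_def)
  ultimately show ?thesis using that by blast
qed

lemma AE_tendsto_zero_of_summable_nn_integral:
  fixes h :: "nat \<Rightarrow> 'a \<Rightarrow> real"
  assumes [measurable]: "\<And>k. h k \<in> borel_measurable M" and nonneg: "\<And>k x. 0 \<le> h k x"
    and finite: "(\<Sum>k. \<integral>\<^sup>+x. ennreal (h k x) \<partial>M) \<noteq> \<infinity>"
  shows "AE x in M. (\<lambda>k. h k x) \<longlonglongrightarrow> 0"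
proof -
  have "(\<integral>\<^sup>+x. (\<Sum>k. ennreal (h k x)) \<partial>M) \<noteq> \<infinity>"
    using finite by (subst nn_integral_suminf) auto
  then have "AE x in M. (\<Sum>k. ennreal (h k x)) \<noteq> \<infinity>"
    by (intro nn_integral_PInf_AE) auto
  then show ?thesis
    by eventually_elim (auto intro!: summable_LIMSEQ_zero summable_suminf_not_top nonneg)
qed

lemma AE_small_increments_of_fast_Cauchy:
  fixes f :: "nat \<Rightarrow> 'd::euclidean_space \<Rightarrow> 'b::euclidean_space"
  assumes f: "\<And>k. square_integrable (f k)"
    and fast: "\<And>k. (norm (toL2 (f (Suc k)) - toL2 (f k)))\<^sup>2 \<le> (1/8)^k"
  shows "AE x in lebesgue. \<forall>\<^sub>F k in sequentially. norm (f (Suc k) x - f k x) \<le> (1/2)^k"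
proof -
  note [measurable] = square_integrable_measurable[OF f]
  define h where "h k x = (2 ^ k * norm (f (Suc k) x - f k x))\<^sup>2" for k x
  have h_eq: "h k x = 4^k * (norm (f (Suc k) x - f k x))\<^sup>2" for k x
    by (simp add: h_def power2_eq_square flip: power_mult_distrib)
  have "(\<integral>\<^sup>+x. ennreal (h k x) \<partial>lebesgue) \<le> ennreal ((1/2)^k)" for k
  proof -
    have "(\<integral>\<^sup>+x. ennreal (h k x) \<partial>lebesgue)
        = ennreal (4^k) * (\<integral>\<^sup>+x. ennreal ((norm (f (Suc k) x - f k x))\<^sup>2) \<partial>lebesgue)"
      unfolding h_eq by (subst nn_integral_cmult[symmetric]) (auto simp: ennreal_mult)
    also have "\<dots> = ennreal (4^k * (norm (toL2 (f (Suc k)) - toL2 (f k)))\<^sup>2)"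
      using nn_integral_norm_square[OF square_integrable_diff[OF f f]]
      by (simp add: toL2_diff f ennreal_mult)
    also have "\<dots> \<le> ennreal (4^k * (1/8)^k)"
      using fast by (intro ennreal_leI mult_left_mono) auto
    also have "4^k * (1/8)^k = (1/2::real)^k"
      by (simp flip: power_mult_distrib)
    finally show ?thesis .
  qed
  then have "(\<Sum>k. \<integral>\<^sup>+x. ennreal (h k x) \<partial>lebesgue) \<le> (\<Sum>k. ennreal ((1/2)^k))"
    by (intro suminf_le) auto
  also have "\<dots> < \<infinity>"
    by (simp add: suminf_ennreal2 ennreal_less_top)
  finally have "AE x in lebesgue. (\<lambda>k. h k x) \<longlonglongrightarrow> 0"
    by (intro AE_tendsto_zero_of_summable_nn_integral) (auto simp: h_def)
  then show ?thesis
  proof eventually_elim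
    case (elim x)
    then have "\<forall>\<^sub>F k in sequentially. h k x < 1"
      by (rule order_tendstoD) simp
    then show ?case
    proof eventually_elim
      case (elim k)
      then have "2 ^ k * norm (f (Suc k) x - f k x) < 1"
        by (simp add: h_def abs_square_less_1)
      then show ?case by (simp add: power_divide field_simps)
    qed
  qed
qed

lemma AE_convergent_of_fast_Cauchy:
  fixes f :: "nat \<Rightarrow> 'd::euclidean_space \<Rightarrow> 'b::euclidean_space"
  assumes "\<And>k. square_integrable (f k)"
    and "\<And>k. (norm (toL2 (f (Suc k)) - toL2 (f k)))\<^sup>2 \<le> (1/8)^k"
  shows "AE x in lebesgue. convergent (\<lambda>k. f k x)"
  using AE_small_increments_of_fast_Cauchy[OF assms]
  by eventually_elim (rule convergent_of_geometric_increments[of "1/2"]; simp)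

lemma
  fixes f :: "nat \<Rightarrow> 'd::euclidean_space \<Rightarrow> 'b::euclidean_space"
  assumes f: "\<And>n. square_integrable (f n)" and F[measurable]: "F \<in> borel_measurable lebesgue"
    and lim: "AE x in lebesgue. (\<lambda>n. f n x) \<longlonglongrightarrow> F x"
    and bound: "\<forall>\<^sub>F n in sequentially. norm (toL2 (f n)) \<le> B"
  shows square_integrable_Fatou: "square_integrable F"
    and norm_toL2_Fatou: "norm (toL2 F) \<le> B"
proof -
  note [measurable] = square_integrable_measurable[OF f]
  have "0 \<le> B"
    using eventually_happens[OF bound] order_trans[OF norm_ge_zero] by auto
  have "(\<integral>\<^sup>+x. ennreal ((norm (F x))\<^sup>2) \<partial>lebesgue)
      = (\<integral>\<^sup>+x. liminf (\<lambda>n. ennreal ((norm (f n x))\<^sup>2)) \<partial>lebesgue)"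
    using lim
    by (intro nn_integral_cong_AE, eventually_elim)
       (intro lim_imp_Liminf[symmetric] tendsto_intros; simp)
  also have "\<dots> \<le> liminf (\<lambda>n. \<integral>\<^sup>+x. ennreal ((norm (f n x))\<^sup>2) \<partial>lebesgue)"
    by (rule nn_integral_liminf) measurable
  also have "\<dots> = liminf (\<lambda>n. ennreal ((norm (toL2 (f n)))\<^sup>2))"
    by (simp add: nn_integral_norm_square f)
  also have "\<dots> \<le> liminf (\<lambda>n. ennreal (B\<^sup>2))"
    by (intro Liminf_mono, use bound in eventually_elim) (intro ennreal_leI power_mono; simp)
  finally have Fatou: "(\<integral>\<^sup>+x. ennreal ((norm (F x))\<^sup>2) \<partial>lebesgue) \<le> ennreal (B\<^sup>2)"
    by (simp add: Liminf_const)
  also have "\<dots> < \<infinity>" by simp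
  finally show sq: "square_integrable F"
    unfolding square_integrable_def by (intro conjI F integrableI_bounded) auto
  have "(norm (toL2 F))\<^sup>2 \<le> B\<^sup>2"
    using Fatou by (simp add: nn_integral_norm_square[OF sq])
  then show "norm (toL2 F) \<le> B"
    by (rule power2_le_imp_le) (rule \<open>0 \<le> B\<close>)
qed

lemma LIMSEQ_toL2_of_AE_tendsto:
  fixes f :: "nat \<Rightarrow> 'd::euclidean_space \<Rightarrow> 'b::euclidean_space"
  assumes f: "\<And>n. square_integrable (f n)" and Cauchy: "Cauchy (\<lambda>n. toL2 (f n))"
    and F[measurable]: "F \<in> borel_measurable lebesgue"
    and lim: "AE x in lebesgue. (\<lambda>n. f n x) \<longlonglongrightarrow> F x"
  shows "(\<lambda>n. toL2 (f n)) \<longlonglongrightarrow> toL2 F"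
proof -
  have "Bseq (\<lambda>n. toL2 (f n))" by (rule Cauchy_Bseq[OF Cauchy])
  then obtain B where "\<And>n. norm (toL2 (f n)) \<le> B" by (auto simp: Bseq_def)
  then have sqF: "square_integrable F"
    by (intro square_integrable_Fatou[OF f F lim] always_eventually allI)
  show ?thesis
  proof (rule LIMSEQ_I)
    fix e :: real assume "0 < e"
    then obtain M where M: "\<And>m n. m \<ge> M \<Longrightarrow> n \<ge> M \<Longrightarrow> norm (toL2 (f m) - toL2 (f n)) < e/2"
      using CauchyD[OF Cauchy, of "e/2"] by auto
    have "norm (toL2 (f m) - toL2 F) < e" if "m \<ge> M" for m
    proof -
      have "norm (toL2 (\<lambda>x. f m x - F x)) \<le> e/2"
      proof (rule norm_toL2_Fatou)
        show "square_integrable (\<lambda>x. f m x - f n x)" for n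
          by (intro square_integrable_diff f)
        show "(\<lambda>x. f m x - F x) \<in> borel_measurable lebesgue"
          using square_integrable_measurable[OF f] by measurable
        show "AE x in lebesgue. (\<lambda>n. f m x - f n x) \<longlonglongrightarrow> f m x - F x"
          using lim by eventually_elim (intro tendsto_intros)
        show "\<forall>\<^sub>F n in sequentially. norm (toL2 (\<lambda>x. f m x - f n x)) \<le> e/2"
          using M[OF that] by (intro eventually_sequentiallyI[of M]) (simp add: toL2_diff f less_imp_le)
      qed
      then show ?thesis
        using \<open>0 < e\<close> by (simp add: toL2_diff f sqF)
    qed
    then show "\<exists>M. \<forall>m\<ge>M. norm (toL2 (f m) - toL2 F) < e" by blast
  qed
qed

instance L2 :: (euclidean_space, euclidean_space) complete_space
proof
  fix Y :: "nat \<Rightarrow> ('a, 'b) L2"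
  assume Y: "Cauchy Y"
  obtain s where s: "strict_mono s" "\<And>k. dist (Y (s (Suc k))) (Y (s k)) < sqrt ((1/8)^k)"
    by (rule Cauchy_fast_subseq[OF Y, of "\<lambda>k. sqrt ((1/8)^k)"]) auto
  have "\<forall>k. \<exists>f. square_integrable f \<and> Y (s k) = toL2 f"
    using toL2_cases by metis
  then obtain f where f: "\<And>k. square_integrable (f k)" and Ys: "\<And>k. Y (s k) = toL2 (f k)"
    by metis
  have "(norm (toL2 (f (Suc k)) - toL2 (f k)))\<^sup>2 \<le> (1/8)^k" for k
    using power_mono[OF less_imp_le[OF s(2)[of k]], of 2] by (simp add: Ys dist_norm)
  then have "AE x in lebesgue. convergent (\<lambda>k. f k x)"
    by (rule AE_convergent_of_fast_Cauchy[OF f])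
  then have "AE x in lebesgue. (\<lambda>k. f k x) \<longlonglongrightarrow> lim (\<lambda>k. f k x)"
    by eventually_elim (simp add: convergent_LIMSEQ_iff)
  moreover have "Cauchy (\<lambda>k. toL2 (f k))"
    using Cauchy_subseq_Cauchy[OF Y s(1)] by (simp add: o_def Ys)
  moreover have "(\<lambda>x. lim (\<lambda>k. f k x)) \<in> borel_measurable lebesgue"
    using square_integrable_measurable[OF f] by (rule borel_measurable_lim_metric)
  ultimately have "(\<lambda>k. toL2 (f k)) \<longlonglongrightarrow> toL2 (\<lambda>x. lim (\<lambda>k. f k x))"
    by (intro LIMSEQ_toL2_of_AE_tendsto f)
  then show "convergent Y"
    using Cauchy_converges_subseq[OF Y s(1)] by (auto simp: convergent_def o_def Ys)
qed

instance L2 :: (euclidean_space, euclidean_space) banach ..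

section \<open>Ordinary differential equations in Banach spaces\<close>

definition integral_curve :: "('a::real_normed_vector \<Rightarrow> 'a) \<Rightarrow> real set \<Rightarrow> (real \<Rightarrow> 'a) \<Rightarrow> bool" where
  "integral_curve F I x \<longleftrightarrow> (\<forall>t\<in>I. (x has_vector_derivative F (x t)) (at t within I))"

lemma integral_curve_subset:
  "integral_curve F I x \<Longrightarrow> J \<subseteq> I \<Longrightarrow> integral_curve F J x"
  unfolding integral_curve_def by (meson has_vector_derivative_within_subset subsetD)

lemma integral_curve_continuous_on: "integral_curve F I x \<Longrightarrow> continuous_on I x"
  unfolding integral_curve_def by (rule continuous_on_vector_derivative) blast

lemma integral_curve_cong:
  assumes "\<And>t. t \<in> I \<Longrightarrow> x t = y t" "\<And>t. t \<in> I \<Longrightarrow> F (x t) = F' (x t)"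
  shows "integral_curve F I x \<longleftrightarrow> integral_curve F' I y"
  unfolding integral_curve_def
  using assms
  by (auto intro: has_vector_derivative_transform[of _ I y x] has_vector_derivative_transform[of _ I x y])

lemma has_vector_derivative_atLeast_iff:
  fixes f :: "real \<Rightarrow> 'a::real_normed_vector"
  shows "(f has_vector_derivative D) (at t within {a..}) \<longleftrightarrow>
    ((\<lambda>h. (f (t + h) - f t) /\<^sub>R h) \<longlongrightarrow> D) (at 0 within {a - t..})"
proof -
  have "filtermap ((+) t) (at 0 within {a - t..}) = at (t + 0) within (+) t ` {a - t..}"
    by (rule filtermap_linear_at_within) (auto simp: bij_def intro: open_translation continuous_intros)
  then have shift: "at t within {a..} = filtermap ((+) t) (at 0 within {a - t..})"
    by simp
  have "(f has_vector_derivative D) (at t within {a..}) \<longleftrightarrow>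
      ((\<lambda>s. (1 / norm (s - t)) *\<^sub>R (f s - (f t + (s - t) *\<^sub>R D))) \<longlongrightarrow> 0) (at t within {a..})"
    by (simp add: has_vector_derivative_def has_derivative_within bounded_linear_scaleR_left)
  also have "\<dots> \<longleftrightarrow> ((\<lambda>h. (1 / norm h) *\<^sub>R (f (t + h) - (f t + h *\<^sub>R D))) \<longlongrightarrow> 0) (at 0 within {a - t..})"
    unfolding shift filterlim_filtermap by simp
  also have "\<dots> \<longleftrightarrow> ((\<lambda>h. norm ((f (t + h) - f t) /\<^sub>R h - D)) \<longlongrightarrow> 0) (at 0 within {a - t..})"
  proof (subst tendsto_norm_zero_iff[symmetric], rule tendsto_cong)
    have "norm ((1 / norm h) *\<^sub>R (f (t + h) - (f t + h *\<^sub>R D))) = norm ((f (t + h) - f t) /\<^sub>R h - D)"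
      if "h \<noteq> 0" for h
    proof -
      have "f (t + h) - (f t + h *\<^sub>R D) = h *\<^sub>R ((f (t + h) - f t) /\<^sub>R h - D)"
        using that by (simp add: scaleR_diff_right)
      then show ?thesis using that by simp
    qed
    then show "\<forall>\<^sub>F h in at 0 within {a - t..}. norm ((1 / norm h) *\<^sub>R (f (t + h) - (f t + h *\<^sub>R D)))
        = norm ((f (t + h) - f t) /\<^sub>R h - D)"
      by (auto simp: eventually_at_filter)
  qed
  finally show ?thesis by (simp add: tendsto_norm_zero_iff LIM_zero_iff)
qed

lemma integral_in_closed_subspace:
  fixes f :: "real \<Rightarrow> 'a::banach"
  assumes S: "closed S" "subspace S" and f: "f integrable_on {a..b}"
    and fS: "\<And>t. t \<in> {a..b} \<Longrightarrow> f t \<in> S"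
  shows "integral {a..b} f \<in> S"
proof -
  have "\<exists>y\<in>S. dist y (integral {a..b} f) < e" if "e > 0" for e
  proof -
    obtain d where "gauge d" and d: "\<And>D. D tagged_division_of {a..b} \<Longrightarrow> d fine D \<Longrightarrow>
        norm ((\<Sum>(x,k) \<in> D. measure lborel k *\<^sub>R f x) - integral {a..b} f) < e"
      using integrable_integral[OF f, unfolded has_integral_real] \<open>e > 0\<close> by metis
    then obtain D where D: "D tagged_division_of {a..b}" "d fine D"
      using fine_division_exists_real by metis
    have "(\<Sum>(x,k) \<in> D. measure lborel k *\<^sub>R f x) \<in> S"
    proof (rule subspace_sum[OF \<open>subspace S\<close>], clarify)
      fix x k assume "(x, k) \<in> D"
      then have "x \<in> {a..b}"
        using tagged_division_ofD(2,3)[OF D(1)] by blast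
      then show "measure lborel k *\<^sub>R f x \<in> S"
        by (intro subspace_scale \<open>subspace S\<close> fS)
    qed
    with d[OF D] show ?thesis by (auto simp: dist_norm)
  qed
  then show ?thesis using closed_approachable[OF \<open>closed S\<close>] by blast
qed

lemma integral_has_vector_derivative_atLeast:
  fixes g :: "real \<Rightarrow> 'a::banach"
  assumes "continuous_on {a..} g" "a \<le> t"
  shows "((\<lambda>t. integral {a..t} g) has_vector_derivative g t) (at t within {a..})"
proof -
  have "((\<lambda>t. integral {a..t} g) has_vector_derivative g t) (at t within {a..t+1})"
    using assms by (intro integral_has_vector_derivative) (auto intro: continuous_on_subset)
  moreover have "at t within {a..t+1} = at t within {a..}"
    by (rule at_within_nhd[of _ "{..<t+1}"]) auto
  ultimately show ?thesis by simp
qed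

lemma norm_exp_weighted_integral_le:
  fixes g :: "real \<Rightarrow> 'a::banach"
  assumes "0 < M" "0 \<le> c" "0 \<le> t" and g: "continuous_on {0..t} g"
    and bound: "\<And>s. s \<in> {0..t} \<Longrightarrow> norm (g s) \<le> c * exp (M * s)"
  shows "norm (exp (- M * t) *\<^sub>R integral {0..t} g) \<le> c / M"
proof -
  have exp_integral:
    "((\<lambda>s. c * exp (M * s)) has_integral c / M * exp (M * t) - c / M * exp (M * 0)) {0..t}"
    using \<open>0 < M\<close> \<open>0 \<le> t\<close>
    by (intro fundamental_theorem_of_calculus)
       (auto intro!: derivative_eq_intros simp flip: has_real_derivative_iff_has_vector_derivative)
  have "norm (integral {0..t} g) \<le> integral {0..t} (\<lambda>s. c * exp (M * s))"
    by (intro integral_norm_bound_integral bound integrable_continuous_real[OF g]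
        has_integral_integrable[OF exp_integral])
  also have "\<dots> \<le> c / M * exp (M * t)"
    using integral_unique[OF exp_integral] \<open>0 < M\<close> \<open>0 \<le> c\<close> by simp
  finally show ?thesis
    by (simp add: exp_minus field_simps)
qed

text \<open>For a Lipschitz field the Picard operator is contracting in the norm
  \<open>sup\<^sub>t e\<^sup>-\<^sup>M\<^sup>t \<parallel>x(t) - x\<^sub>0\<parallel>\<close> as soon as \<open>M > L\<close>. It acts here on \<open>y(t) = e\<^sup>-\<^sup>M\<^sup>t (x(t) - x\<^sub>0)\<close>, extended
  evenly to the negative half-line.\<close>

locale Lipschitz_field =
  fixes F :: "'a::banach \<Rightarrow> 'a" and L :: real and x0 :: 'a
  assumes Lipschitz: "L-lipschitz_on UNIV F"
begin

definition rate :: real where "rate = 2 * L + 1"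

definition unweight :: "(real \<Rightarrow>\<^sub>C 'a) \<Rightarrow> real \<Rightarrow> 'a" where
  "unweight y t = x0 + exp (rate * t) *\<^sub>R y t"

definition Picard :: "(real \<Rightarrow>\<^sub>C 'a) \<Rightarrow> real \<Rightarrow> 'a" where
  "Picard y t = exp (- rate * \<bar>t\<bar>) *\<^sub>R integral {0..\<bar>t\<bar>} (\<lambda>s. F (unweight y s))"

lemma L_nonneg: "0 \<le> L"
  by (rule lipschitz_on_nonneg[OF Lipschitz])

lemma rate_pos: "0 < rate"
  using L_nonneg by (simp add: rate_def)

lemma continuous_on_unweight: "continuous_on A (\<lambda>t. F (unweight y t))"
  unfolding unweight_def
  by (intro continuous_on_compose2[OF lipschitz_on_continuous_on[OF Lipschitz]] continuous_intros) auto

lemma Picard_bcontfun: "Picard y \<in> bcontfun"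
proof (rule bcontfun_normI)
  have "continuous_on {0..} (\<lambda>t. integral {0..t} (\<lambda>s. F (unweight y s)))"
    using integral_has_vector_derivative_atLeast[OF continuous_on_unweight]
    by (intro continuous_on_vector_derivative) auto
  then show "continuous_on UNIV (Picard y)"
    unfolding Picard_def
    by (intro continuous_intros)
       (rule continuous_on_compose2[of "{0..}"], auto intro!: continuous_intros)
next
  fix t
  have "norm (F (unweight y s)) \<le> (norm (F x0) + L * norm y) * exp (rate * s)" if "0 \<le> s" for s
  proof -
    have "norm (F (unweight y s)) \<le> norm (F x0) + norm (F (unweight y s) - F x0)"
      by (rule norm_triangle_sub)
    also have "norm (F (unweight y s) - F x0) \<le> L * norm (exp (rate * s) *\<^sub>R y s)"
      using lipschitz_on_normD[OF Lipschitz, of "unweight y s" x0] by (simp add: unweight_def)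
    also have "\<dots> \<le> L * norm y * exp (rate * s)"
      using norm_bounded[of y s] L_nonneg by (simp add: mult_left_mono mult_ac)
    also have "norm (F x0) \<le> norm (F x0) * exp (rate * s)"
      using that rate_pos by (simp add: mult_le_cancel_left1)
    finally show ?thesis by (simp add: distrib_right)
  qed
  then show "norm (Picard y t) \<le> (norm (F x0) + L * norm y) / rate"
    unfolding Picard_def
    by (intro norm_exp_weighted_integral_le rate_pos continuous_on_unweight)
       (auto intro!: add_nonneg_nonneg mult_nonneg_nonneg L_nonneg)
qed

lemma apply_Bcontfun_Picard: "apply_bcontfun (Bcontfun (Picard y)) = Picard y"
  by (rule Bcontfun_inverse[OF Picard_bcontfun])

lemma dist_Picard_le: "dist (Bcontfun (Picard y)) (Bcontfun (Picard z)) \<le> 1/2 * dist y z"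
proof -
  have "norm (Picard y t - Picard z t) \<le> 1/2 * dist y z" for t
  proof -
    have "Picard y t - Picard z t
        = exp (- rate * \<bar>t\<bar>) *\<^sub>R integral {0..\<bar>t\<bar>} (\<lambda>s. F (unweight y s) - F (unweight z s))"
      unfolding Picard_def scaleR_diff_right[symmetric]
      by (subst integral_diff) (auto intro!: integrable_continuous_real continuous_on_unweight)
    also have "norm \<dots> \<le> (L * dist y z) / rate"
    proof (rule norm_exp_weighted_integral_le[OF rate_pos])
      show "norm (F (unweight y s) - F (unweight z s)) \<le> L * dist y z * exp (rate * s)" for s
      proof -
        have "norm (F (unweight y s) - F (unweight z s)) \<le> L * norm (exp (rate * s) *\<^sub>R (y s - z s))"
          using lipschitz_on_normD[OF Lipschitz, of "unweight y s" "unweight z s"]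
          by (simp add: unweight_def scaleR_diff_right)
        also have "\<dots> \<le> L * dist y z * exp (rate * s)"
          using dist_bounded[of y s z] L_nonneg by (simp add: dist_norm mult_left_mono mult_ac)
        finally show ?thesis .
      qed
    qed (auto intro!: continuous_intros continuous_on_unweight mult_nonneg_nonneg L_nonneg)
    also have "\<dots> \<le> 1/2 * dist y z"
      using L_nonneg by (simp add: rate_def field_simps)
    finally show ?thesis .
  qed
  then show ?thesis
    by (intro dist_bound) (simp add: apply_Bcontfun_Picard dist_norm)
qed

lemma integral_curve_unweight:
  assumes fixpoint: "Bcontfun (Picard y) = y"
  shows "integral_curve F {0..} (unweight y)"
proof -
  have unweight_eq: "unweight y t = x0 + integral {0..t} (\<lambda>s. F (unweight y s))" if "0 \<le> t" for t
  proof -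
    have "y t = exp (- rate * t) *\<^sub>R integral {0..t} (\<lambda>s. F (unweight y s))"
      using arg_cong[OF fixpoint, of "\<lambda>y. apply_bcontfun y t"] that
      by (simp add: apply_Bcontfun_Picard Picard_def)
    then have "exp (rate * t) *\<^sub>R y t = integral {0..t} (\<lambda>s. F (unweight y s))"
      by (simp add: exp_minus)
    then show ?thesis by (simp add: unweight_def)
  qed
  have "(unweight y has_vector_derivative F (unweight y t)) (at t within {0..})" if "0 \<le> t" for t
  proof -
    have "((\<lambda>t. x0 + integral {0..t} (\<lambda>s. F (unweight y s))) has_vector_derivative F (unweight y t))
        (at t within {0..})"
      using integral_has_vector_derivative_atLeast[OF continuous_on_unweight that]
      by (auto intro!: derivative_eq_intros)
    then show ?thesis
      using that unweight_eq by (intro has_vector_derivative_transform[where g = "unweight y"]) auto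
  qed
  then show ?thesis by (simp add: integral_curve_def)
qed

lemma global_integral_curve_exists:
  assumes S: "closed S" "subspace S" "x0 \<in> S" and inv: "\<And>x. x \<in> S \<Longrightarrow> F x \<in> S"
  obtains x where "x 0 = x0" "\<And>t. 0 \<le> t \<Longrightarrow> x t \<in> S" "integral_curve F {0..} x"
proof -
  have "\<exists>!y\<in>PiC UNIV (\<lambda>_. S). Bcontfun (Picard y) = y"
  proof (rule Banach_fix[where c = "1/2"])
    show "complete (PiC UNIV (\<lambda>_::real. S))"
      unfolding complete_eq_closed by (rule closed_PiC) (rule S)
    have "0 \<in> PiC UNIV (\<lambda>_::real. S)"
      using subspace_0[OF S(2)] by (simp add: mem_PiC_iff)
    then show "PiC UNIV (\<lambda>_::real. S) \<noteq> {}" by blast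
    have "Picard y t \<in> S" if "\<And>s. y s \<in> S" for y :: "real \<Rightarrow>\<^sub>C 'a" and t
    proof -
      have "F (unweight y s) \<in> S" for s
        unfolding unweight_def by (intro inv subspace_add[OF S(2)] subspace_scale[OF S(2)] S(3) that)
      then show ?thesis
        unfolding Picard_def
        by (intro subspace_scale[OF S(2)] integral_in_closed_subspace S integrable_continuous_real
            continuous_on_unweight)
    qed
    then show "(\<lambda>y. Bcontfun (Picard y)) ` PiC UNIV (\<lambda>_. S) \<subseteq> PiC UNIV (\<lambda>_. S)"
      by (auto simp: mem_PiC_iff apply_Bcontfun_Picard Pi_iff)
  qed (use dist_Picard_le in auto)
  then obtain y where "y \<in> PiC UNIV (\<lambda>_. S)" and fixpoint: "Bcontfun (Picard y) = y"
    by blast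
  then have yS: "y t \<in> S" for t
    by (auto simp: mem_PiC_iff)
  show ?thesis
  proof (rule that[of "unweight y"])
    have "Picard y 0 = 0" by (simp add: Picard_def)
    then show "unweight y 0 = x0"
      using arg_cong[OF fixpoint, of "\<lambda>y. apply_bcontfun y 0"]
      by (simp add: unweight_def apply_Bcontfun_Picard)
    show "unweight y t \<in> S" for t
      unfolding unweight_def by (intro subspace_add[OF S(2)] subspace_scale[OF S(2)] S(3) yS)
  qed (rule integral_curve_unweight[OF fixpoint])
qed

end

lemma Gronwall:
  fixes \<phi> \<phi>' :: "real \<Rightarrow> real"
  assumes "0 \<le> T"
    and deriv: "\<And>t. t \<in> {0..T} \<Longrightarrow> (\<phi> has_real_derivative \<phi>' t) (at t within {0..T})"
    and growth: "\<And>t. t \<in> {0..T} \<Longrightarrow> \<phi>' t \<le> K * \<phi> t"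
  shows "\<phi> T \<le> \<phi> 0 * exp (K * T)"
proof -
  define \<psi> where "\<psi> t = \<phi> t * exp (- K * t)" for t
  have deriv_\<psi>: "(\<psi> has_real_derivative (\<phi>' t - K * \<phi> t) * exp (- K * t)) (at t within {0..T})"
    if "t \<in> {0..T}" for t
    unfolding \<psi>_def
    by (rule derivative_eq_intros deriv[OF that] refl)+ (simp add: algebra_simps)
  have "\<psi> T \<le> \<psi> 0"
  proof (rule DERIV_nonpos_imp_decreasing_open[OF \<open>0 \<le> T\<close>])
    fix t assume t: "0 < t" "t < T"
    have "(\<phi>' t - K * \<phi> t) * exp (- K * t) \<le> 0"
      using growth[of t] t by (intro mult_nonpos_nonneg) auto
    moreover have "at t within {0..T} = at t"
      using t by (rule at_within_Icc_at)
    ultimately show "\<exists>y. (\<psi> has_real_derivative y) (at t) \<and> y \<le> 0"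
      using deriv_\<psi>[of t] t by auto
  next
    show "continuous_on {0..T} \<psi>"
      using deriv_\<psi> by (rule DERIV_continuous_on)
  qed
  then show ?thesis by (simp add: \<psi>_def exp_minus field_simps)
qed

lemma has_real_derivative_norm_square:
  fixes x :: "real \<Rightarrow> 'a::real_inner"
  assumes "(x has_vector_derivative x') (at t within A)"
  shows "((\<lambda>t. (norm (x t))\<^sup>2) has_real_derivative 2 * (x t \<bullet> x')) (at t within A)"
proof -
  have "((\<lambda>t. x t \<bullet> x t) has_derivative (\<lambda>h. x t \<bullet> (h *\<^sub>R x') + (h *\<^sub>R x') \<bullet> x t)) (at t within A)"
    using assms unfolding has_vector_derivative_def by (intro has_derivative_inner)
  then show ?thesis
    unfolding has_field_derivative_def power2_norm_eq_inner
    by (rule has_derivative_eq_rhs) (auto simp: inner_commute)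
qed

lemma norm_le_exp_of_inner_derivative_le:
  fixes x :: "real \<Rightarrow> 'a::real_inner"
  assumes "0 \<le> T"
    and deriv: "\<And>t. t \<in> {0..T} \<Longrightarrow> (x has_vector_derivative x' t) (at t within {0..T})"
    and growth: "\<And>t. t \<in> {0..T} \<Longrightarrow> x t \<bullet> x' t \<le> K * (norm (x t))\<^sup>2"
  shows "norm (x T) \<le> norm (x 0) * exp (K * T)"
proof -
  have "(norm (x T))\<^sup>2 \<le> (norm (x 0))\<^sup>2 * exp (2 * K * T)"
    using growth by (intro Gronwall[OF \<open>0 \<le> T\<close> has_real_derivative_norm_square[OF deriv]]) auto
  also have "\<dots> = (norm (x 0) * exp (K * T))\<^sup>2"
    using exp_double[of "K * T"] by (simp add: power_mult_distrib mult.assoc)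
  finally show ?thesis
    by (rule power2_le_imp_le) simp
qed

definition lipschitz_on_balls :: "('a::real_normed_vector \<Rightarrow> 'b::real_normed_vector) \<Rightarrow> bool" where
  "lipschitz_on_balls f \<longleftrightarrow> (\<forall>R. \<exists>L. L-lipschitz_on (cball 0 R) f)"

lemma lipschitz_on_ballsE:
  assumes "lipschitz_on_balls f"
  obtains L where "L-lipschitz_on (cball 0 R) f"
  using assms by (auto simp: lipschitz_on_balls_def)

lemma lipschitz_on_balls_continuous_on:
  assumes "lipschitz_on_balls f"
  shows "continuous_on A f"
proof -
  have "isCont f x" for x
  proof -
    obtain L where "L-lipschitz_on (cball 0 (norm x + 1)) f"
      by (rule lipschitz_on_ballsE[OF assms])
    then have "continuous_on (ball 0 (norm x + 1)) f"
      by (rule continuous_on_subset[OF lipschitz_on_continuous_on]) auto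
    then show ?thesis by (simp add: continuous_on_eq_continuous_at)
  qed
  then show ?thesis by (simp add: continuous_at_imp_continuous_on)
qed

lemma lipschitz_on_balls_linear: "bounded_linear f \<Longrightarrow> lipschitz_on_balls f"
  unfolding lipschitz_on_balls_def by (metis bounded_linear.lipschitz_boundE)

lemma lipschitz_on_balls_diff:
  "lipschitz_on_balls f \<Longrightarrow> lipschitz_on_balls g \<Longrightarrow> lipschitz_on_balls (\<lambda>x. f x - g x)"
  unfolding lipschitz_on_balls_def by (metis lipschitz_on_diff)

lemma lipschitz_on_balls_sum:
  assumes "finite I" "\<And>i. i \<in> I \<Longrightarrow> lipschitz_on_balls (f i)"
  shows "lipschitz_on_balls (\<lambda>x. \<Sum>i\<in>I. f i x)"
  using assms
proof (induction I rule: finite_induct)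
  case empty
  show ?case unfolding lipschitz_on_balls_def using lipschitz_on_constant by auto
next
  case (insert i I)
  then have "lipschitz_on_balls (f i)" "lipschitz_on_balls (\<lambda>x. \<Sum>i\<in>I. f i x)" by auto
  then show ?case
    using insert.hyps unfolding lipschitz_on_balls_def by (simp, metis lipschitz_on_add)
qed

lemma lipschitz_on_balls_bounded:
  fixes f :: "'a::real_normed_vector \<Rightarrow> 'b::real_normed_vector"
  assumes "lipschitz_on_balls f"
  obtains L B where "L-lipschitz_on (cball 0 R) f" "\<And>x. x \<in> cball 0 R \<Longrightarrow> norm (f x) \<le> B" "0 \<le> B"
proof -
  obtain L where L: "L-lipschitz_on (cball 0 R) f" by (rule lipschitz_on_ballsE[OF assms])
  note L_nonneg = lipschitz_on_nonneg[OF L]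
  show ?thesis
  proof (rule that[OF L, of "norm (f 0) + L * \<bar>R\<bar>"])
    fix x :: 'a assume x: "x \<in> cball 0 R"
    then have "norm x \<le> R" by simp
    then have "0 \<le> R" "norm x \<le> \<bar>R\<bar>" using norm_ge_zero[of x] by linarith+
    then have "norm (f x - f 0) \<le> L * norm x"
      using lipschitz_on_normD[OF L x, of 0] by simp
    also have "\<dots> \<le> L * \<bar>R\<bar>"
      using \<open>norm x \<le> \<bar>R\<bar>\<close> L_nonneg by (rule mult_left_mono)
    finally show "norm (f x) \<le> norm (f 0) + L * \<bar>R\<bar>"
      using norm_triangle_sub[of "f x" "f 0"] by linarith
  qed (intro add_nonneg_nonneg mult_nonneg_nonneg L_nonneg norm_ge_zero abs_ge_zero)
qed

lemma lipschitz_on_balls_bilinear: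
  fixes f :: "'d::real_normed_vector \<Rightarrow> 'a::real_normed_vector"
    and g :: "'d \<Rightarrow> 'b::real_normed_vector"
  assumes b: "bounded_bilinear b" and f: "lipschitz_on_balls f" and g: "lipschitz_on_balls g"
  shows "lipschitz_on_balls (\<lambda>x. b (f x) (g x))"
  unfolding lipschitz_on_balls_def
proof
  fix R :: real
  interpret bounded_bilinear b by (rule b)
  obtain K where K: "0 \<le> K" "\<And>x y. norm (b x y) \<le> norm x * norm y * K"
    using nonneg_bounded by blast
  obtain Lf Bf where Lf: "Lf-lipschitz_on (cball 0 R) f"
    and Bf: "\<And>x. x \<in> cball 0 R \<Longrightarrow> norm (f x) \<le> Bf" "0 \<le> Bf"
    using lipschitz_on_balls_bounded[OF f] by blast
  obtain Lg Bg where Lg: "Lg-lipschitz_on (cball 0 R) g"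
    and Bg: "\<And>x. x \<in> cball 0 R \<Longrightarrow> norm (g x) \<le> Bg" "0 \<le> Bg"
    using lipschitz_on_balls_bounded[OF g] by blast
  note nonneg = lipschitz_on_nonneg[OF Lf] lipschitz_on_nonneg[OF Lg] Bf(2) Bg(2) K(1)
  have "((Lf * Bg + Bf * Lg) * K)-lipschitz_on (cball 0 R) (\<lambda>x. b (f x) (g x))"
  proof (rule lipschitz_onI)
    fix x y :: 'd assume x: "x \<in> cball 0 R" and y: "y \<in> cball 0 R"
    have "b (f x) (g x) - b (f y) (g y) = b (f x - f y) (g x) + b (f y) (g x - g y)"
      by (simp add: diff_left diff_right)
    also have "norm \<dots> \<le> norm (f x - f y) * norm (g x) * K + norm (f y) * norm (g x - g y) * K"
      by (intro norm_triangle_le add_mono K(2))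
    also have "\<dots> \<le> (Lf * norm (x - y)) * Bg * K + Bf * (Lg * norm (x - y)) * K"
      by (intro add_mono mult_mono lipschitz_on_normD[OF Lf x y] lipschitz_on_normD[OF Lg x y] Bf Bg x y
          mult_nonneg_nonneg nonneg norm_ge_zero order_refl)
    finally show "dist (b (f x) (g x)) (b (f y) (g y)) \<le> (Lf * Bg + Bf * Lg) * K * dist x y"
      by (simp add: dist_norm algebra_simps)
  qed (intro mult_nonneg_nonneg add_nonneg_nonneg nonneg)
  then show "\<exists>L. L-lipschitz_on (cball 0 R) (\<lambda>x. b (f x) (g x))" by blast
qed

lemma lipschitz_on_balls_vec_lambda:
  fixes f :: "'i::finite \<Rightarrow> 'a::real_normed_vector \<Rightarrow> 'b::real_normed_vector"
  assumes "\<And>i. lipschitz_on_balls (f i)"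
  shows "lipschitz_on_balls (\<lambda>x. \<chi> i. f i x)"
  unfolding lipschitz_on_balls_def
proof
  fix R :: real
  have "\<forall>i. \<exists>L. L-lipschitz_on (cball 0 R) (f i)"
    using assms by (simp add: lipschitz_on_balls_def)
  then obtain L where L: "\<And>i. (L i)-lipschitz_on (cball 0 R) (f i)"
    by metis
  have "(\<Sum>i\<in>UNIV. L i)-lipschitz_on (cball 0 R) (\<lambda>x. \<chi> i. f i x)"
  proof (rule lipschitz_onI)
    fix x y :: 'a assume xy: "x \<in> cball 0 R" "y \<in> cball 0 R"
    have "dist (\<chi> i. f i x) (\<chi> i. f i y) \<le> (\<Sum>i\<in>UNIV. dist (f i x) (f i y))"
      unfolding dist_vec_def by (rule order_trans[OF L2_set_le_sum]) auto
    also have "\<dots> \<le> (\<Sum>i\<in>UNIV. L i * dist x y)"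
      by (intro sum_mono lipschitz_onD[OF L xy])
    finally show "dist (\<chi> i. f i x) (\<chi> i. f i y) \<le> (\<Sum>i\<in>UNIV. L i) * dist x y"
      by (simp add: sum_distrib_right)
  qed (intro sum_nonneg lipschitz_on_nonneg[OF L])
  then show "\<exists>L. L-lipschitz_on (cball 0 R) (\<lambda>x. \<chi> i. f i x)" by blast
qed

lemma integral_curve_unique:
  fixes x y :: "real \<Rightarrow> 'a::real_inner"
  assumes F: "lipschitz_on_balls F"
    and x: "integral_curve F {0..T} x" and y: "integral_curve F {0..T} y"
    and "x 0 = y 0" "0 \<le> T"
  shows "x T = y T"
proof -
  have "bounded (x ` {0..T} \<union> y ` {0..T})"
    using x y by (auto intro!: compact_imp_bounded compact_continuous_image integral_curve_continuous_on)
  then obtain R where R: "\<And>t. t \<in> {0..T} \<Longrightarrow> x t \<in> cball 0 R \<and> y t \<in> cball 0 R"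
    unfolding bounded_iff by (metis UnI1 UnI2 imageI mem_cball_0)
  obtain L where L: "L-lipschitz_on (cball 0 R) F"
    by (rule lipschitz_on_ballsE[OF F])
  have "norm (x T - y T) \<le> norm (x 0 - y 0) * exp (L * T)"
  proof (rule norm_le_exp_of_inner_derivative_le[OF \<open>0 \<le> T\<close>])
    fix t assume t: "t \<in> {0..T}"
    show "((\<lambda>t. x t - y t) has_vector_derivative F (x t) - F (y t)) (at t within {0..T})"
      using x y t by (auto simp: integral_curve_def intro: has_vector_derivative_diff)
    have "(x t - y t) \<bullet> (F (x t) - F (y t)) \<le> norm (x t - y t) * norm (F (x t) - F (y t))"
      by (rule norm_cauchy_schwarz)
    also have "\<dots> \<le> norm (x t - y t) * (L * norm (x t - y t))"
      using R[OF t] by (intro mult_left_mono lipschitz_on_normD[OF L]) auto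
    finally show "(x t - y t) \<bullet> (F (x t) - F (y t)) \<le> L * (norm (x t - y t))\<^sup>2"
      by (simp add: power2_eq_square mult_ac)
  qed
  with \<open>x 0 = y 0\<close> show ?thesis by simp
qed

definition ball_retraction :: "real \<Rightarrow> 'a::real_normed_vector \<Rightarrow> 'a" where
  "ball_retraction r x = (r / max r (norm x)) *\<^sub>R x"

lemma norm_ball_retraction_le: "0 < r \<Longrightarrow> norm (ball_retraction r x) \<le> r"
  by (simp add: ball_retraction_def field_simps)

lemma ball_retraction_id: "0 < r \<Longrightarrow> norm x \<le> r \<Longrightarrow> ball_retraction r x = x"
  by (simp add: ball_retraction_def max_def)

lemma ball_retraction_lipschitz:
  fixes U :: "'a::real_normed_vector set"
  assumes "0 < r"
  shows "2-lipschitz_on U (ball_retraction r)"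
proof (rule lipschitz_onI)
  fix x y :: 'a
  define m where "m x = max r (norm x)" for x :: 'a
  have m: "0 < m x" "r \<le> m x" "norm x \<le> m x" for x
    using \<open>0 < r\<close> by (auto simp: m_def)
  have m_diff: "\<bar>m y - m x\<bar> \<le> norm (x - y)"
    using norm_triangle_ineq3[of x y] by (auto simp: m_def)
  have scale_x: "r / m x * norm (x - y) \<le> norm (x - y)"
    using m[of x] \<open>0 < r\<close> by (intro mult_left_le_one_le) auto
  have "\<bar>r / m x - r / m y\<bar> * norm y = (r / m x) * (\<bar>m y - m x\<bar> * (norm y / m y))"
  proof -
    have "r / m x - r / m y = (r / m x) * ((m y - m x) / m y)"
      using m[of x] m[of y] by (simp add: field_simps)
    then show ?thesis
      using m(1)[of x] m(1)[of y] \<open>0 < r\<close> by (simp add: abs_mult)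
  qed
  also have "\<dots> \<le> 1 * (norm (x - y) * 1)"
    using m[of x] m[of y] \<open>0 < r\<close> m_diff by (intro mult_mono) auto
  finally have scale_diff: "\<bar>r / m x - r / m y\<bar> * norm y \<le> norm (x - y)" by simp
  have "ball_retraction r x - ball_retraction r y = (r / m x) *\<^sub>R (x - y) + (r / m x - r / m y) *\<^sub>R y"
    by (simp add: ball_retraction_def m_def algebra_simps)
  also have "norm \<dots> \<le> \<bar>r / m x\<bar> * norm (x - y) + \<bar>r / m x - r / m y\<bar> * norm y"
    by (rule norm_triangle_le) simp
  finally show "dist (ball_retraction r x) (ball_retraction r y) \<le> 2 * dist x y"
    using scale_x scale_diff m[of x] \<open>0 < r\<close> by (simp add: dist_norm)
qed simp

lemma lipschitz_on_balls_cutoff: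
  assumes "lipschitz_on_balls F" "0 < r"
  obtains L where "L-lipschitz_on UNIV (\<lambda>x. F (ball_retraction r x))"
proof -
  obtain L where "L-lipschitz_on (cball 0 r) F"
    by (rule lipschitz_on_ballsE[OF assms(1)])
  then have "L-lipschitz_on (range (ball_retraction r)) F"
    by (rule lipschitz_on_subset) (use norm_ball_retraction_le[OF \<open>0 < r\<close>] in auto)
  from lipschitz_on_compose2[OF ball_retraction_lipschitz[OF \<open>0 < r\<close>] this]
  show ?thesis by (rule that)
qed

lemma inner_cutoff_le:
  fixes F :: "'a::real_inner \<Rightarrow> 'a"
  assumes growth: "\<And>x. x \<bullet> F x \<le> C * (norm x)\<^sup>2" and "0 \<le> C" "0 < r"
  shows "x \<bullet> F (ball_retraction r x) \<le> C * (norm x)\<^sup>2"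
proof -
  define s where "s = r / max r (norm x)"
  have s: "0 < s" "s \<le> 1" using \<open>0 < r\<close> by (auto simp: s_def)
  have "s * (x \<bullet> F (s *\<^sub>R x)) \<le> s * (s * (C * (norm x)\<^sup>2))"
    using growth[of "s *\<^sub>R x"] s by (simp add: power2_eq_square mult_ac)
  then have "x \<bullet> F (s *\<^sub>R x) \<le> s * (C * (norm x)\<^sup>2)"
    using s(1) by simp
  also have "\<dots> \<le> C * (norm x)\<^sup>2"
    using s \<open>0 \<le> C\<close> by (intro mult_left_le_one_le) auto
  finally show ?thesis by (simp add: ball_retraction_def s_def)
qed

lemma integral_curve_exists_on_interval:
  fixes F :: "'a::{real_inner,banach} \<Rightarrow> 'a"
  assumes F: "lipschitz_on_balls F"
    and growth: "\<And>x. x \<bullet> F x \<le> C * (norm x)\<^sup>2" and "0 \<le> C" "0 \<le> T"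
    and S: "closed S" "subspace S" "x0 \<in> S" and inv: "\<And>x. x \<in> S \<Longrightarrow> F x \<in> S"
  shows "\<exists>x. x 0 = x0 \<and> (\<forall>t\<in>{0..T}. x t \<in> S) \<and> integral_curve F {0..T} x"
proof -
  \<comment> \<open>Cut off outside a ball which the solution cannot leave before time \<open>T\<close>.\<close>
  define r where "r = (norm x0 + 1) * exp (C * T)"
  have "0 < r" by (simp add: r_def add_nonneg_pos)
  let ?F = "\<lambda>x. F (ball_retraction r x)"
  obtain L where "L-lipschitz_on UNIV ?F"
    by (rule lipschitz_on_balls_cutoff[OF F \<open>0 < r\<close>])
  then interpret cutoff: Lipschitz_field ?F L x0 by unfold_locales
  have "?F x \<in> S" if "x \<in> S" for x
    unfolding ball_retraction_def by (intro inv subspace_scale[OF S(2)] that)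
  then obtain x where x: "x 0 = x0" "\<And>t. 0 \<le> t \<Longrightarrow> x t \<in> S" "integral_curve ?F {0..} x"
    using cutoff.global_integral_curve_exists[OF S] by blast
  have "norm (x t) \<le> r" if t: "t \<in> {0..T}" for t
  proof -
    have "norm (x t) \<le> norm (x 0) * exp (C * t)"
    proof (rule norm_le_exp_of_inner_derivative_le)
      show "(x has_vector_derivative ?F (x s)) (at s within {0..t})" if "s \<in> {0..t}" for s
        using integral_curve_subset[OF x(3), of "{0..t}"] that by (auto simp: integral_curve_def)
    qed (use t in \<open>auto intro!: inner_cutoff_le growth \<open>0 \<le> C\<close> \<open>0 < r\<close>\<close>)
    also have "\<dots> \<le> r"
      using t \<open>0 \<le> C\<close> by (auto simp: r_def x(1) intro!: mult_mono mult_left_mono)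
    finally show ?thesis .
  qed
  then have "?F (x t) = F (x t)" if "t \<in> {0..T}" for t
    using that \<open>0 < r\<close> by (simp add: ball_retraction_id)
  then have "integral_curve F {0..T} x"
    using integral_curve_subset[OF x(3), of "{0..T}"] integral_curve_cong[of "{0..T}" x x ?F F] by auto
  with x show ?thesis by auto
qed

lemma integral_curve_glue:
  fixes X :: "nat \<Rightarrow> real \<Rightarrow> 'a::real_inner"
  assumes F: "lipschitz_on_balls F"
    and X: "\<And>n. integral_curve F {0..real n} (X n)" "\<And>n. X n 0 = x0"
  shows "integral_curve F {0..} (\<lambda>t. X (nat \<lceil>t\<rceil>) t)"
proof -
  have agree: "X m t = X n t" if "0 \<le> t" "t \<le> real m" "t \<le> real n" for m n t
  proof (rule integral_curve_unique[OF F, where x = "X m" and y = "X n"])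
    show "integral_curve F {0..t} (X m)" "integral_curve F {0..t} (X n)"
      using that by (auto intro: integral_curve_subset[OF X(1)])
  qed (use that X(2) in auto)
  have "((\<lambda>t. X (nat \<lceil>t\<rceil>) t) has_vector_derivative F (X (nat \<lceil>t\<rceil>) t)) (at t within {0..})"
    if "0 \<le> t" for t
  proof -
    define n where "n = Suc (nat \<lceil>t\<rceil>)"
    have "t < real n" using that unfolding n_def by linarith
    have X_n: "X (nat \<lceil>s\<rceil>) s = X n s" if "s \<in> {0..real n}" for s
      using that real_nat_ceiling_ge[of s] by (intro agree) auto
    have "(X n has_vector_derivative F (X n t)) (at t within {0..real n})"
      using X(1)[of n] that \<open>t < real n\<close> by (auto simp: integral_curve_def)
    then have "((\<lambda>t. X (nat \<lceil>t\<rceil>) t) has_vector_derivative F (X n t)) (at t within {0..real n})"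
    proof (rule has_vector_derivative_transform[rotated 2])
      show "X (nat \<lceil>s\<rceil>) s = X n s" if "s \<in> {0..real n}" for s
        using that by (rule X_n)
    qed (use that \<open>t < real n\<close> in simp)
    moreover have "at t within {0..real n} = at t within {0..}"
      using \<open>t < real n\<close> by (intro at_within_nhd[of _ "{..<real n}"]) auto
    ultimately show ?thesis
      using X_n[of t] that \<open>t < real n\<close> by simp
  qed
  then show ?thesis by (simp add: integral_curve_def)
qed

lemma integral_curve_exists:
  fixes F :: "'a::{real_inner,banach} \<Rightarrow> 'a"
  assumes F: "lipschitz_on_balls F"
    and growth: "\<And>x. x \<bullet> F x \<le> C * (norm x)\<^sup>2" and "0 \<le> C"
    and S: "closed S" "subspace S" "x0 \<in> S" and inv: "\<And>x. x \<in> S \<Longrightarrow> F x \<in> S"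
  obtains x where "x 0 = x0" "\<And>t. 0 \<le> t \<Longrightarrow> x t \<in> S" "integral_curve F {0..} x"
proof -
  have "\<forall>n. \<exists>x. x 0 = x0 \<and> (\<forall>t\<in>{0..real n}. x t \<in> S) \<and> integral_curve F {0..real n} x"
    using integral_curve_exists_on_interval[OF F growth \<open>0 \<le> C\<close> _ S inv] by simp
  then obtain X where X: "\<And>n. X n 0 = x0" "\<And>n t. t \<in> {0..real n} \<Longrightarrow> X n t \<in> S"
    "\<And>n. integral_curve F {0..real n} (X n)"
    by metis
  show ?thesis
  proof (rule that)
    show "X (nat \<lceil>0\<rceil>) 0 = x0" by (rule X)
    show "X (nat \<lceil>t\<rceil>) t \<in> S" if "0 \<le> t" for t
      using that by (intro X(2)) auto
    show "integral_curve F {0..} (\<lambda>t. X (nat \<lceil>t\<rceil>) t)"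
      by (rule integral_curve_glue[OF F X(3,1)])
  qed
qed

section \<open>Oja's flow in a Hilbert space\<close>

lemma inner_eq_inner_projections_along_sgn:
  fixes u v z :: "'a::real_inner"
  defines "P \<equiv> \<lambda>u. u - (u \<bullet> sgn z) *\<^sub>R sgn z"
  shows "u \<bullet> v = P u \<bullet> P v + (u \<bullet> sgn z) * (v \<bullet> sgn z)"
proof (cases "z = 0")
  case False
  then have "sgn z \<bullet> sgn z = 1"
    by (simp add: norm_sgn flip: power2_norm_eq_inner)
  then show ?thesis
    by (simp add: P_def inner_simps inner_commute algebra_simps)
qed (simp add: P_def)

lemma minus_projection_along_own_sgn:
  fixes z :: "'a::real_inner"
  shows "z - (z \<bullet> sgn z) *\<^sub>R sgn z = 0"
proof (cases "z = 0")
  case False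
  then have "z \<bullet> sgn z = norm z"
    by (simp add: sgn_div_norm dot_square_norm power2_eq_square)
  with False show ?thesis by (simp add: sgn_div_norm)
qed simp

text \<open>Gram matrices are sums of rank-one matrices: split off the components along one of the vectors
  at a time.\<close>

lemma psd_Gram_trace_nonneg:
  fixes q :: "'n::finite \<Rightarrow> 'n \<Rightarrow> real" and u :: "'n \<Rightarrow> 'a::real_inner"
  assumes "psd q"
  shows "0 \<le> (\<Sum>i\<in>UNIV. \<Sum>j\<in>UNIV. q i j * (u i \<bullet> u j))"
proof -
  have "0 \<le> (\<Sum>i\<in>UNIV. \<Sum>j\<in>UNIV. q i j * (u i \<bullet> u j))"
    if "finite I" "\<And>i. i \<notin> I \<Longrightarrow> u i = 0" for I and u :: "'n \<Rightarrow> 'a"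
    using that
  proof (induction I arbitrary: u rule: finite_induct)
    case empty
    then show ?case by simp
  next
    case (insert k I)
    define c where "c i = u i \<bullet> sgn (u k)" for i
    define v where "v i = u i - c i *\<^sub>R sgn (u k)" for i
    have "v k = 0"
      unfolding v_def c_def by (rule minus_projection_along_own_sgn)
    then have "v i = 0" if "i \<notin> I" for i
      using insert.prems[of i] that by (cases "i = k") (auto simp: v_def c_def)
    then have "0 \<le> (\<Sum>i\<in>UNIV. \<Sum>j\<in>UNIV. q i j * (v i \<bullet> v j))"
      by (rule insert.IH)
    moreover have "0 \<le> (\<Sum>i\<in>UNIV. \<Sum>j\<in>UNIV. c i * q i j * c j)"
      using \<open>psd q\<close> by (simp add: psd_def)
    moreover have "u i \<bullet> u j = v i \<bullet> v j + c i * c j" for i j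
      unfolding v_def c_def by (rule inner_eq_inner_projections_along_sgn)
    ultimately show ?case
      by (simp add: distrib_left sum.distrib mult_ac)
  qed
  from this[of UNIV u] show ?thesis by simp
qed

locale Oja_flow =
  fixes G :: "'a::{real_inner,banach} \<Rightarrow> 'a" and q :: "'a \<Rightarrow> 'a \<Rightarrow> real"
  assumes bounded_linear_G: "bounded_linear G"
    and bounded_bilinear_q: "bounded_bilinear q"
    and q_nonneg: "\<And>x. 0 \<le> q x x"
begin

definition oja_field :: "'a ^ 'n \<Rightarrow> 'a ^ 'n" where
  "oja_field U = (\<chi> i. G (U $ i) - (\<Sum>j\<in>UNIV. q (U $ j) (U $ i) *\<^sub>R U $ j))"

lemma lipschitz_on_balls_oja_field: "lipschitz_on_balls (oja_field :: 'a ^ 'n \<Rightarrow> 'a ^ 'n)"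
proof -
  have nth: "lipschitz_on_balls (\<lambda>U :: 'a ^ 'n. U $ i)" for i
    by (rule lipschitz_on_balls_linear) (rule bounded_linear_vec_nth)
  show ?thesis
    unfolding oja_field_def
    by (intro lipschitz_on_balls_vec_lambda lipschitz_on_balls_diff lipschitz_on_balls_sum finite
        lipschitz_on_balls_bilinear[OF bounded_bilinear_scaleR]
        lipschitz_on_balls_bilinear[OF bounded_bilinear_q]
        lipschitz_on_balls_linear[OF bounded_linear_compose[OF bounded_linear_G bounded_linear_vec_nth]]
        nth)
qed

lemma psd_q: "psd (\<lambda>i j. q (u j) (u i))"
  unfolding psd_def
proof
  fix \<xi> :: "'n::finite \<Rightarrow> real" and u :: "'n \<Rightarrow> 'a"
  interpret bounded_bilinear q by (rule bounded_bilinear_q)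
  have "q (\<Sum>j\<in>UNIV. \<xi> j *\<^sub>R u j) (\<Sum>i\<in>UNIV. \<xi> i *\<^sub>R u i) = (\<Sum>i\<in>UNIV. \<Sum>j\<in>UNIV. \<xi> i * q (u j) (u i) * \<xi> j)"
    by (simp add: sum_left sum_right scaleR_left scaleR_right sum_distrib_left mult_ac)
  then show "0 \<le> (\<Sum>i\<in>UNIV. \<Sum>j\<in>UNIV. \<xi> i * q (u j) (u i) * \<xi> j)"
    using q_nonneg by metis
qed

lemma inner_oja_field_le:
  obtains C where "0 \<le> C" "\<And>U :: 'a ^ 'n. U \<bullet> oja_field U \<le> C * (norm U)\<^sup>2"
proof -
  obtain C where C: "0 \<le> C" "\<And>x. norm (G x) \<le> norm x * C"
    using bounded_linear.nonneg_bounded[OF bounded_linear_G] by blast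
  have "U \<bullet> oja_field U \<le> C * (norm U)\<^sup>2" for U :: "'a ^ 'n"
  proof -
    have "U $ i \<bullet> G (U $ i) \<le> C * (U $ i \<bullet> U $ i)" for i
    proof -
      have "U $ i \<bullet> G (U $ i) \<le> norm (U $ i) * (norm (U $ i) * C)"
        by (intro order_trans[OF norm_cauchy_schwarz] mult_left_mono C) auto
      then show ?thesis by (simp add: dot_square_norm power2_eq_square mult_ac)
    qed
    then have "(\<Sum>i\<in>UNIV. U $ i \<bullet> G (U $ i)) \<le> C * (U \<bullet> U)"
      unfolding inner_vec_def sum_distrib_left by (rule sum_mono)
    moreover have "0 \<le> (\<Sum>i\<in>UNIV. \<Sum>j\<in>UNIV. q (U $ j) (U $ i) * (U $ i \<bullet> U $ j))"
      by (rule psd_Gram_trace_nonneg[OF psd_q])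
    moreover have "U \<bullet> oja_field U = (\<Sum>i\<in>UNIV. U $ i \<bullet> G (U $ i))
        - (\<Sum>i\<in>UNIV. \<Sum>j\<in>UNIV. q (U $ j) (U $ i) * (U $ i \<bullet> U $ j))"
      by (simp add: inner_vec_def oja_field_def inner_diff_right inner_sum_right sum_subtractf)
    ultimately show ?thesis
      by (simp add: power2_norm_eq_inner)
  qed
  with C(1) show ?thesis by (rule that)
qed

lemma oja_flow_exists:
  fixes U0 :: "'a ^ 'n"
  assumes S: "closed S" "subspace S" "\<And>x. x \<in> S \<Longrightarrow> G x \<in> S" and U0: "\<And>i. U0 $ i \<in> S"
  obtains U where "U 0 = U0" "\<And>t i. 0 \<le> t \<Longrightarrow> U t $ i \<in> S" "integral_curve oja_field {0..} U"
proof -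
  define SN where "SN = {U :: 'a ^ 'n. \<forall>i. U $ i \<in> S}"
  obtain C where C: "0 \<le> C" "\<And>U :: 'a ^ 'n. U \<bullet> oja_field U \<le> C * (norm U)\<^sup>2"
    using inner_oja_field_le by blast
  have "SN = (\<Inter>i. (\<lambda>U. U $ i) -` S)" by (auto simp: SN_def)
  then have "closed SN"
    using S(1) by (auto intro!: closed_INT closed_vimage continuous_intros)
  moreover have "subspace SN"
    using S(2) by (auto simp: SN_def subspace_def)
  moreover have "oja_field U \<in> SN" if "U \<in> SN" for U
    using that S(2,3)
    by (auto simp: SN_def oja_field_def intro!: subspace_diff subspace_sum subspace_scale)
  moreover have "U0 \<in> SN" using U0 by (simp add: SN_def)
  ultimately obtain U where "U 0 = U0" "\<And>t. 0 \<le> t \<Longrightarrow> U t \<in> SN" "integral_curve oja_field {0..} U"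
    using integral_curve_exists[OF lipschitz_on_balls_oja_field C(2,1)] by metis
  then show ?thesis using that by (auto simp: SN_def)
qed

end

section \<open>Coercive symmetric forms\<close>

locale coercive_form =
  fixes S :: "'a::banach set" and \<alpha> :: "'a \<Rightarrow> 'a \<Rightarrow> real"
  assumes closed: "closed S" and subspace: "subspace S"
    and add_left: "\<And>x y z. x \<in> S \<Longrightarrow> y \<in> S \<Longrightarrow> z \<in> S \<Longrightarrow> \<alpha> (x + y) z = \<alpha> x z + \<alpha> y z"
    and scaleR_left: "\<And>r x y. x \<in> S \<Longrightarrow> y \<in> S \<Longrightarrow> \<alpha> (r *\<^sub>R x) y = r * \<alpha> x y"
    and symmetric: "\<And>x y. x \<in> S \<Longrightarrow> y \<in> S \<Longrightarrow> \<alpha> x y = \<alpha> y x"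
    and coercive: "\<exists>c>0. \<forall>x\<in>S. c * (norm x)\<^sup>2 \<le> \<alpha> x x"
    and bounded: "\<exists>C. \<forall>x\<in>S. \<alpha> x x \<le> C * (norm x)\<^sup>2"
begin

lemmas mem_S = subspace_0[OF subspace] subspace_add[OF subspace] subspace_diff[OF subspace]
  subspace_scale[OF subspace]

lemma coercivityE:
  obtains c where "0 < c" "\<And>x. x \<in> S \<Longrightarrow> c * (norm x)\<^sup>2 \<le> \<alpha> x x"
  using coercive by metis

lemma nonneg:
  assumes "x \<in> S"
  shows "0 \<le> \<alpha> x x"
proof -
  obtain c where "0 < c" "c * (norm x)\<^sup>2 \<le> \<alpha> x x"
    using coercivityE assms by metis
  moreover have "0 \<le> c * (norm x)\<^sup>2" using \<open>0 < c\<close> by simp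
  ultimately show ?thesis by linarith
qed

lemma eq_zero:
  assumes "x \<in> S" "\<alpha> x x = 0"
  shows "x = 0"
proof -
  obtain c where "0 < c" "c * (norm x)\<^sup>2 \<le> 0"
    using coercivityE assms by metis
  then show ?thesis by (simp add: mult_le_0_iff)
qed

lemma add_right: "x \<in> S \<Longrightarrow> y \<in> S \<Longrightarrow> z \<in> S \<Longrightarrow> \<alpha> z (x + y) = \<alpha> z x + \<alpha> z y"
  using add_left symmetric by (simp add: mem_S)

lemma scaleR_right: "x \<in> S \<Longrightarrow> y \<in> S \<Longrightarrow> \<alpha> y (r *\<^sub>R x) = r * \<alpha> y x"
  using scaleR_left symmetric by (simp add: mem_S)

lemma diff_left: "x \<in> S \<Longrightarrow> y \<in> S \<Longrightarrow> z \<in> S \<Longrightarrow> \<alpha> (x - y) z = \<alpha> x z - \<alpha> y z"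
  using add_left[of "x - y" y z] by (simp add: mem_S)

lemma square_add_scaleR:
  assumes "x \<in> S" "y \<in> S"
  shows "\<alpha> (x + r *\<^sub>R y) (x + r *\<^sub>R y) = \<alpha> x x + 2 * r * \<alpha> x y + r\<^sup>2 * \<alpha> y y"
  using assms
  by (simp add: add_left add_right scaleR_left scaleR_right symmetric[of y x] mem_S
      power2_eq_square algebra_simps)

lemma eqI:
  assumes x: "x \<in> S" and y: "y \<in> S" and eq: "\<And>v. v \<in> S \<Longrightarrow> \<alpha> x v = \<alpha> y v"
  shows "x = y"
  using eq_zero[of "x - y"] diff_left[OF x y, of "x - y"] eq[of "x - y"] x y by (simp add: mem_S)

lemma energy_norm_equivalence:
  obtains k K where "0 < k" "\<And>x. x \<in> S \<Longrightarrow> k * norm x \<le> sqrt (\<alpha> x x)"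
    "\<And>x. x \<in> S \<Longrightarrow> sqrt (\<alpha> x x) \<le> K * norm x"
proof -
  obtain c where c: "0 < c" "\<And>x. x \<in> S \<Longrightarrow> c * (norm x)\<^sup>2 \<le> \<alpha> x x"
    by (rule coercivityE) blast
  obtain C where C: "\<And>x. x \<in> S \<Longrightarrow> \<alpha> x x \<le> C * (norm x)\<^sup>2"
    using bounded by blast
  have sqrt_mult_norm: "sqrt r * norm x = sqrt (r * (norm x)\<^sup>2)" for r and x :: 'a
    by (simp add: real_sqrt_mult)
  show ?thesis
  proof (rule that[of "sqrt c" "sqrt C"])
    show "sqrt c * norm x \<le> sqrt (\<alpha> x x)" "sqrt (\<alpha> x x) \<le> sqrt C * norm x" if "x \<in> S" for x
      unfolding sqrt_mult_norm using c(2) C that by (auto intro: real_sqrt_le_mono)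
  qed (use c(1) in simp)
qed

lemma energy_norm_tendsto_0_iff:
  assumes f: "\<forall>\<^sub>F x in F. f x \<in> S"
  shows "((\<lambda>x. sqrt (\<alpha> (f x) (f x))) \<longlongrightarrow> 0) F \<longleftrightarrow> (f \<longlongrightarrow> 0) F"
proof -
  obtain k K where k: "0 < k" "\<And>x. x \<in> S \<Longrightarrow> k * norm x \<le> sqrt (\<alpha> x x)"
    "\<And>x. x \<in> S \<Longrightarrow> sqrt (\<alpha> x x) \<le> K * norm x"
    by (rule energy_norm_equivalence) blast
  show ?thesis
  proof
    assume "((\<lambda>x. sqrt (\<alpha> (f x) (f x))) \<longlongrightarrow> 0) F"
    then have "((\<lambda>x. sqrt (\<alpha> (f x) (f x)) / k) \<longlongrightarrow> 0) F"
      by (rule tendsto_divide_zero)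
    moreover have "\<forall>\<^sub>F x in F. norm (f x) \<le> sqrt (\<alpha> (f x) (f x)) / k"
      using f by eventually_elim (use k in \<open>simp add: field_simps\<close>)
    ultimately show "(f \<longlongrightarrow> 0) F" by (rule Lim_null_comparison[rotated])
  next
    assume "(f \<longlongrightarrow> 0) F"
    then have "((\<lambda>x. K * norm (f x)) \<longlongrightarrow> 0) F"
      by (intro tendsto_mult_right_zero tendsto_norm_zero)
    moreover have "\<forall>\<^sub>F x in F. norm (sqrt (\<alpha> (f x) (f x))) \<le> K * norm (f x)"
      using f by eventually_elim (use k nonneg in simp)
    ultimately show "((\<lambda>x. sqrt (\<alpha> (f x) (f x))) \<longlongrightarrow> 0) F" by (rule Lim_null_comparison[rotated])
  qed
qed

lemma Cauchy_Schwarz: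
  assumes x: "x \<in> S" and y: "y \<in> S"
  shows "\<bar>\<alpha> x y\<bar> \<le> sqrt (\<alpha> x x) * sqrt (\<alpha> y y)"
proof (cases "y = 0")
  case True
  have "\<alpha> 0 x = 0" using scaleR_left[OF x x, of 0] by simp
  with True show ?thesis using symmetric[OF x y] by (simp add: nonneg[OF x] nonneg[OF y, unfolded True])
next
  case False
  then have "0 < \<alpha> y y" using nonneg[OF y] eq_zero[OF y] by fastforce
  have "0 \<le> \<alpha> (x + (- \<alpha> x y / \<alpha> y y) *\<^sub>R y) (x + (- \<alpha> x y / \<alpha> y y) *\<^sub>R y)"
    using x y by (intro nonneg mem_S)
  also have "\<dots> = \<alpha> x x - (\<alpha> x y)\<^sup>2 / \<alpha> y y"
    unfolding square_add_scaleR[OF x y] using \<open>0 < \<alpha> y y\<close> by (simp add: power2_eq_square field_simps)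
  finally have "(\<alpha> x y)\<^sup>2 \<le> \<alpha> x x * \<alpha> y y"
    using \<open>0 < \<alpha> y y\<close> by (simp add: field_simps)
  from real_sqrt_le_mono[OF this] show ?thesis by (simp add: real_sqrt_mult)
qed

lemma continuous_on_left:
  assumes v: "v \<in> S"
  shows "continuous_on S (\<lambda>x. \<alpha> x v)"
  unfolding continuous_on_def
proof
  fix x assume x: "x \<in> S"
  have diff_in: "\<forall>\<^sub>F y in at x within S. y - x \<in> S"
    using x by (auto simp: eventually_at_filter intro!: always_eventually mem_S)
  have "((\<lambda>y. y - x) \<longlongrightarrow> 0) (at x within S)"
    by (intro LIM_zero tendsto_ident_at)
  then have "((\<lambda>y. sqrt (\<alpha> (y - x) (y - x)) * sqrt (\<alpha> v v)) \<longlongrightarrow> 0) (at x within S)"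
    by (intro tendsto_mult_left_zero) (simp add: energy_norm_tendsto_0_iff[OF diff_in])
  moreover have "\<forall>\<^sub>F y in at x within S. norm (\<alpha> y v - \<alpha> x v) \<le> sqrt (\<alpha> (y - x) (y - x)) * sqrt (\<alpha> v v)"
    using x v
    by (auto simp: eventually_at_filter mem_S Cauchy_Schwarz simp flip: diff_left
        intro!: always_eventually)
  ultimately show "((\<lambda>y. \<alpha> y v) \<longlongrightarrow> \<alpha> x v) (at x within S)"
    by (intro LIM_zero_cancel[where l = "\<alpha> x v"]) (rule Lim_null_comparison[rotated])
qed

definition energy :: "('a \<Rightarrow> real) \<Rightarrow> 'a \<Rightarrow> real" where
  "energy l w = \<alpha> w w - 2 * l w"

context
  fixes l :: "'a \<Rightarrow> real"
  assumes bounded_linear_l: "bounded_linear l"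
begin

interpretation l: bounded_linear l by (rule bounded_linear_l)

lemma energy_add_scaleR:
  "w \<in> S \<Longrightarrow> v \<in> S \<Longrightarrow> energy l (w + r *\<^sub>R v) = energy l w + 2 * r * (\<alpha> w v - l v) + r\<^sup>2 * \<alpha> v v"
  by (simp add: energy_def square_add_scaleR l.add l.scaleR algebra_simps)

lemma energy_bdd_below: "bdd_below (energy l ` S)"
proof -
  obtain c where c: "0 < c" "\<And>x. x \<in> S \<Longrightarrow> c * (norm x)\<^sup>2 \<le> \<alpha> x x"
    by (rule coercivityE) blast
  obtain K where K: "\<And>x. norm (l x) \<le> norm x * K"
    using l.bounded by blast
  have "- (K\<^sup>2 / c) \<le> energy l w" if "w \<in> S" for w
  proof -
    have "c * (c * (norm w)\<^sup>2 - 2 * (norm w * K) + K\<^sup>2 / c) = (c * norm w - K)\<^sup>2"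
      using c(1) by (simp add: power2_diff power2_eq_square right_diff_distrib distrib_left mult_ac)
    then have "0 \<le> c * (norm w)\<^sup>2 - 2 * (norm w * K) + K\<^sup>2 / c"
      using c(1) by (metis zero_le_power2 zero_le_mult_iff not_le)
    moreover have "l w \<le> norm w * K" using K[of w] by simp
    ultimately show ?thesis using c(2)[OF that] by (simp add: energy_def)
  qed
  then show ?thesis by (auto intro!: bdd_belowI)
qed

lemma energy_parallelogram:
  assumes x: "x \<in> S" and y: "y \<in> S"
  shows "\<alpha> (y - x) (y - x)
    \<le> 2 * (energy l x - Inf (energy l ` S)) + 2 * (energy l y - Inf (energy l ` S))"
proof -
  have diff_in: "y - x \<in> S" using x y by (simp add: mem_S)
  have "Inf (energy l ` S) \<le> energy l (x + (1/2) *\<^sub>R (y - x))"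
    using subspace_add[OF subspace x, of "(1/2) *\<^sub>R (y - x)"] diff_in
    by (intro cInf_lower energy_bdd_below imageI) (simp add: mem_S)
  moreover have "energy l y = energy l (x + 1 *\<^sub>R (y - x))" by simp
  ultimately show ?thesis
    unfolding energy_add_scaleR[OF x diff_in] by (simp add: power2_eq_square)
qed

lemma Cauchy_minimising_sequence:
  assumes w: "\<And>n. w n \<in> S" and lim: "(\<lambda>n. energy l (w n)) \<longlonglongrightarrow> Inf (energy l ` S)"
  shows "Cauchy w"
proof (rule CauchyI)
  fix e :: real assume "0 < e"
  obtain k where k: "0 < k" "\<And>x. x \<in> S \<Longrightarrow> k * norm x \<le> sqrt (\<alpha> x x)"
    using energy_norm_equivalence by metis
  have "\<forall>\<^sub>F n in sequentially. energy l (w n) < Inf (energy l ` S) + (k * e)\<^sup>2 / 4"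
    using \<open>0 < e\<close> k(1) by (intro order_tendstoD(2)[OF lim]) simp
  then obtain M where M: "\<And>n. M \<le> n \<Longrightarrow> energy l (w n) < Inf (energy l ` S) + (k * e)\<^sup>2 / 4"
    by (auto simp: eventually_sequentially)
  have "norm (w m - w n) < e" if "M \<le> m" "M \<le> n" for m n
  proof -
    have "\<alpha> (w m - w n) (w m - w n) < (k * e)\<^sup>2"
      using energy_parallelogram[OF w w, of m n] M[OF that(1)] M[OF that(2)] by argo
    then have "sqrt (\<alpha> (w m - w n) (w m - w n)) < k * e"
      using \<open>0 < e\<close> k(1) by (simp add: real_less_lsqrt)
    then have "k * norm (w m - w n) < k * e"
      using k(2)[of "w m - w n"] w by (simp add: mem_S)
    then show ?thesis using k(1) by simp
  qed
  then show "\<exists>M. \<forall>m\<ge>M. \<forall>n\<ge>M. norm (w m - w n) < e" by blast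
qed

lemma energy_minimiser_exists: "\<exists>w\<in>S. \<forall>v\<in>S. energy l w \<le> energy l v"
proof -
  have "S \<noteq> {}" using mem_S by blast
  have "Inf (energy l ` S) \<in> closure (energy l ` S)"
    using \<open>S \<noteq> {}\<close> by (intro closure_contains_Inf energy_bdd_below) simp
  then obtain E where E: "\<forall>n. E n \<in> energy l ` S" "E \<longlonglongrightarrow> Inf (energy l ` S)"
    unfolding closure_sequential by blast
  then have "\<forall>n. \<exists>w. w \<in> S \<and> E n = energy l w" by blast
  then obtain w where w: "\<And>n. w n \<in> S" and "E = (\<lambda>n. energy l (w n))"
    by (metis ext)
  with E(2) have lim: "(\<lambda>n. energy l (w n)) \<longlonglongrightarrow> Inf (energy l ` S)"
    by simp
  obtain z where z: "w \<longlonglongrightarrow> z"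
    using Cauchy_minimising_sequence[OF w lim] Cauchy_convergent convergent_def by blast
  have "z \<in> S" by (rule closed_sequentially[OF closed w z])
  have "\<alpha> z (w n - z) - l (w n - z) = \<alpha> (w n) z - \<alpha> z z - l (w n) + l z" for n
    using diff_left[OF w \<open>z \<in> S\<close> \<open>z \<in> S\<close>] symmetric[OF \<open>z \<in> S\<close>, of "w n - z"] w \<open>z \<in> S\<close>
    by (simp add: mem_S l.diff)
  moreover have "(\<lambda>n. \<alpha> (w n) z) \<longlonglongrightarrow> \<alpha> z z"
    using continuous_on_tendsto_compose[OF continuous_on_left[OF \<open>z \<in> S\<close>] z \<open>z \<in> S\<close>] w by simp
  ultimately have "(\<lambda>n. \<alpha> z (w n - z) - l (w n - z)) \<longlonglongrightarrow> \<alpha> z z - \<alpha> z z - l z + l z"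
    using l.tendsto[OF z] by (simp only:) (intro tendsto_intros)
  then have "(\<lambda>n. energy l (w n) - 2 * (\<alpha> z (w n - z) - l (w n - z))) \<longlonglongrightarrow> Inf (energy l ` S) - 2 * 0"
    by (intro tendsto_diff tendsto_mult tendsto_const lim) simp
  moreover have "energy l z \<le> energy l (w n) - 2 * (\<alpha> z (w n - z) - l (w n - z))" for n
    using energy_add_scaleR[of z "w n - z" 1] nonneg[of "w n - z"] w \<open>z \<in> S\<close> by (simp add: mem_S)
  ultimately have "energy l z \<le> Inf (energy l ` S) - 2 * 0"
    by (intro LIMSEQ_le_const) blast+
  then have "energy l z \<le> energy l v" if "v \<in> S" for v
    using cInf_lower[OF imageI[OF that] energy_bdd_below] by simp
  with \<open>z \<in> S\<close> show ?thesis by blast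
qed

lemma Riesz_representation: "\<exists>w\<in>S. \<forall>v\<in>S. \<alpha> w v = l v"
proof -
  obtain w where w: "w \<in> S" and minimal: "\<And>v. v \<in> S \<Longrightarrow> energy l w \<le> energy l v"
    using energy_minimiser_exists by blast
  have "\<alpha> w v = l v" if v: "v \<in> S" for v
  proof -
    define b where "b = \<alpha> w v - l v"
    define A where "A = \<alpha> v v + 1"
    have "0 < A" using nonneg[OF v] by (simp add: A_def)
    have "energy l w \<le> energy l (w + (- b / A) *\<^sub>R v)"
      by (intro minimal mem_S w v)
    then have "0 \<le> 2 * (- b / A) * b + (- b / A)\<^sup>2 * \<alpha> v v"
      unfolding energy_add_scaleR[OF w v] by (simp add: b_def)
    also have "\<dots> \<le> 2 * (- b / A) * b + (- b / A)\<^sup>2 * A"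
      by (intro add_left_mono mult_left_mono) (auto simp: A_def)
    also have "\<dots> = - (b\<^sup>2 / A)" using \<open>0 < A\<close> by (simp add: power2_eq_square field_simps)
    finally have "b = 0" using \<open>0 < A\<close> by (simp add: divide_le_0_iff)
    then show ?thesis by (simp add: b_def)
  qed
  with w show ?thesis by blast
qed

end

definition solution_operator :: "('b \<Rightarrow> 'a \<Rightarrow> real) \<Rightarrow> 'b \<Rightarrow> 'a" where
  "solution_operator b f = (THE w. w \<in> S \<and> (\<forall>v\<in>S. \<alpha> w v = b f v))"

lemma
  fixes b :: "'b::real_normed_vector \<Rightarrow> 'a \<Rightarrow> real"
  assumes b: "bounded_bilinear b"
  shows solution_operator_in: "solution_operator b f \<in> S"
    and solution_operator_eq: "v \<in> S \<Longrightarrow> \<alpha> (solution_operator b f) v = b f v"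
proof -
  obtain w where w: "w \<in> S \<and> (\<forall>v\<in>S. \<alpha> w v = b f v)"
    using Riesz_representation[OF bounded_bilinear.bounded_linear_right[OF b]] by blast
  have "w' = w" if "w' \<in> S \<and> (\<forall>v\<in>S. \<alpha> w' v = b f v)" for w'
    using w that by (intro eqI) simp_all
  with w have "solution_operator b f \<in> S \<and> (\<forall>v\<in>S. \<alpha> (solution_operator b f) v = b f v)"
    unfolding solution_operator_def by (rule theI)
  then show "solution_operator b f \<in> S" "v \<in> S \<Longrightarrow> \<alpha> (solution_operator b f) v = b f v"
    by auto
qed

lemma bounded_linear_solution_operator:
  fixes b :: "'b::real_normed_vector \<Rightarrow> 'a \<Rightarrow> real"
  assumes b: "bounded_bilinear b"
  shows "bounded_linear (solution_operator b)"
proof -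
  interpret b: bounded_bilinear b by (rule b)
  note G = solution_operator_in[OF b] solution_operator_eq[OF b]
  obtain c where c: "0 < c" "\<And>x. x \<in> S \<Longrightarrow> c * (norm x)\<^sup>2 \<le> \<alpha> x x"
    by (rule coercivityE) blast
  obtain K where K: "K \<ge> 0" "\<And>x y. norm (b x y) \<le> norm x * norm y * K"
    using b.nonneg_bounded by blast
  show ?thesis
  proof (rule bounded_linear_intro)
    show "solution_operator b (x + y) = solution_operator b x + solution_operator b y" for x y
      by (rule eqI) (auto simp: G add_left mem_S b.add_left)
    show "solution_operator b (r *\<^sub>R x) = r *\<^sub>R solution_operator b x" for r x
      by (rule eqI) (auto simp: G scaleR_left mem_S b.scaleR_left)
    show "norm (solution_operator b x) \<le> norm x * (K / c)" for x
    proof (cases "solution_operator b x = 0")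
      case False
      let ?w = "solution_operator b x"
      have "c * (norm ?w)\<^sup>2 \<le> b x ?w"
        using c(2)[OF G(1)] G(2)[OF G(1)] by metis
      also have "\<dots> \<le> norm x * norm ?w * K" using K(2)[of x ?w] by simp
      finally show ?thesis
        using False c(1) by (simp add: power2_eq_square field_simps)
    qed (use K c in simp)
  qed
qed

end

section \<open>Test functions\<close>

definition C1_grad :: "('d::euclidean_space \<Rightarrow> real) \<Rightarrow> ('d \<Rightarrow> 'd) \<Rightarrow> bool" where
  "C1_grad \<eta> g \<longleftrightarrow> (\<forall>x. (\<eta> has_derivative (\<lambda>h. g x \<bullet> h)) (at x)) \<and> continuous_on UNIV g"

lemma testfun_iff:
  "testfun \<Omega> \<phi> \<psi> \<longleftrightarrow>
    C1_grad \<phi> \<psi> \<and> compact (closure {x. \<phi> x \<noteq> 0}) \<and> closure {x. \<phi> x \<noteq> 0} \<subseteq> \<Omega>"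
  by (auto simp: testfun_def C1_grad_def)

lemma C1_grad_continuous: "C1_grad \<eta> g \<Longrightarrow> continuous_on A \<eta>" "C1_grad \<eta> g \<Longrightarrow> continuous_on A g"
  by (auto simp: C1_grad_def intro: has_derivative_continuous continuous_at_imp_continuous_on
      continuous_on_subset)

lemma C1_grad_derivative_along_line:
  assumes "C1_grad \<eta> g"
  shows "((\<lambda>h. \<eta> (x + h *\<^sub>R e)) has_real_derivative g (x + h *\<^sub>R e) \<bullet> e) (at h within S)"
proof -
  have "((\<lambda>h. \<eta> (x + h *\<^sub>R e)) has_derivative (\<lambda>k. g (x + h *\<^sub>R e) \<bullet> (k *\<^sub>R e))) (at h within S)"
  proof (rule has_derivative_compose[of "\<lambda>h. x + h *\<^sub>R e" "\<lambda>k. k *\<^sub>R e"])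
    show "((\<lambda>h. x + h *\<^sub>R e) has_derivative (\<lambda>k. k *\<^sub>R e)) (at h within S)"
      by (auto intro!: derivative_eq_intros)
  qed (use assms in \<open>simp add: C1_grad_def\<close>)
  then show ?thesis
    unfolding has_field_derivative_def by (rule has_derivative_eq_rhs) (simp add: fun_eq_iff)
qed

lemma C1_grad_mult:
  assumes "C1_grad \<eta> g" "C1_grad \<theta> k"
  shows "C1_grad (\<lambda>x. \<eta> x * \<theta> x) (\<lambda>x. \<eta> x *\<^sub>R k x + \<theta> x *\<^sub>R g x)"
  unfolding C1_grad_def
proof (intro conjI allI)
  show "((\<lambda>x. \<eta> x * \<theta> x) has_derivative (\<lambda>h. (\<eta> x *\<^sub>R k x + \<theta> x *\<^sub>R g x) \<bullet> h)) (at x)" for x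
    using assms unfolding C1_grad_def
    by (auto intro!: derivative_eq_intros simp: inner_simps algebra_simps)
  show "continuous_on UNIV (\<lambda>x. \<eta> x *\<^sub>R k x + \<theta> x *\<^sub>R g x)"
    by (intro continuous_intros C1_grad_continuous[OF assms(1)] C1_grad_continuous[OF assms(2)])
qed

lemma C1_grad_add:
  assumes "C1_grad \<eta> g" "C1_grad \<theta> k"
  shows "C1_grad (\<lambda>x. \<eta> x + \<theta> x) (\<lambda>x. g x + k x)"
  using assms unfolding C1_grad_def
  by (auto intro!: derivative_eq_intros continuous_intros simp: inner_simps)

lemma C1_grad_const: "C1_grad (\<lambda>x. c) (\<lambda>x. 0)"
  by (simp add: C1_grad_def)

lemma C1_grad_inner: "C1_grad (\<lambda>x. x \<bullet> e) (\<lambda>x. e)"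
  by (auto simp: C1_grad_def inner_commute intro!: derivative_eq_intros)

lemma C1_grad_real_polynomial:
  "real_polynomial_function p \<Longrightarrow> \<exists>g. C1_grad p g"
proof (induction rule: real_polynomial_function.induct)
  case (linear f)
  have "f = (\<lambda>x. x \<bullet> (\<Sum>b\<in>Basis. f b *\<^sub>R b))"
  proof
    fix x
    have "f x = f (\<Sum>b\<in>Basis. (x \<bullet> b) *\<^sub>R b)" by (simp add: euclidean_representation)
    also have "\<dots> = (\<Sum>b\<in>Basis. (x \<bullet> b) * f b)"
      using bounded_linear.linear[OF linear] by (simp add: linear_sum linear_scale)
    finally show "f x = x \<bullet> (\<Sum>b\<in>Basis. f b *\<^sub>R b)"
      by (simp add: inner_sum_right mult.commute)
  qed
  then show ?case using C1_grad_inner by metis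
qed (use C1_grad_const C1_grad_add C1_grad_mult in blast)+

lemma testfun_mult:
  assumes "testfun \<Omega> \<phi> \<psi>" "C1_grad \<eta> g"
  shows "testfun \<Omega> (\<lambda>x. \<phi> x * \<eta> x) (\<lambda>x. \<phi> x *\<^sub>R g x + \<eta> x *\<^sub>R \<psi> x)"
proof -
  have "closure {x. \<phi> x * \<eta> x \<noteq> 0} \<subseteq> closure {x. \<phi> x \<noteq> 0}"
    by (intro closure_mono) auto
  moreover have "bounded {x. \<phi> x * \<eta> x \<noteq> 0}"
    using assms(1) unfolding testfun_iff compact_closure
    by (auto intro: bounded_subset[of "{x. \<phi> x \<noteq> 0}"])
  ultimately show ?thesis
    using assms C1_grad_mult[of \<phi> \<psi> \<eta> g] unfolding testfun_iff compact_closure by auto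
qed

lemma testfun_zero: "testfun \<Omega> (\<lambda>x. 0) (\<lambda>x. 0)"
  by (simp add: testfun_iff C1_grad_const)

lemma testfun_add:
  assumes "testfun \<Omega> \<phi> \<psi>" "testfun \<Omega> \<phi>' \<psi>'"
  shows "testfun \<Omega> (\<lambda>x. \<phi> x + \<phi>' x) (\<lambda>x. \<psi> x + \<psi>' x)"
proof -
  let ?K = "closure {x. \<phi> x \<noteq> 0} \<union> closure {x. \<phi>' x \<noteq> 0}"
  have "closure {x. \<phi> x + \<phi>' x \<noteq> 0} \<subseteq> ?K"
    unfolding closure_Un[symmetric] by (intro closure_mono) auto
  moreover have "bounded {x. \<phi> x + \<phi>' x \<noteq> 0}"
    using assms unfolding testfun_iff compact_closure
    by (auto intro: bounded_subset[of "{x. \<phi> x \<noteq> 0} \<union> {x. \<phi>' x \<noteq> 0}"])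
  ultimately show ?thesis
    using assms C1_grad_add[of \<phi> \<psi> \<phi>' \<psi>'] unfolding testfun_iff compact_closure by auto
qed

lemma testfun_scale:
  assumes "testfun \<Omega> \<phi> \<psi>"
  shows "testfun \<Omega> (\<lambda>x. c * \<phi> x) (\<lambda>x. c *\<^sub>R \<psi> x)"
  using testfun_mult[OF assms C1_grad_const[of c]] by (simp add: mult.commute)

lemma testfun_eq_0:
  assumes "testfun \<Omega> \<phi> \<psi>" "x \<notin> closure {x. \<phi> x \<noteq> 0}"
  shows "\<phi> x = 0" "\<psi> x = 0"
proof -
  show "\<phi> x = 0" using assms(2) closure_subset[of "{x. \<phi> x \<noteq> 0}"] by auto
  have "(\<phi> has_derivative (\<lambda>h. 0)) (at x)"
  proof (rule has_derivative_transform_within_open)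
    show "((\<lambda>x. 0) has_derivative (\<lambda>h. 0)) (at x)" by simp
    show "open (- closure {x. \<phi> x \<noteq> 0})" by auto
    show "x \<in> - closure {x. \<phi> x \<noteq> 0}" using assms by simp
    show "0 = \<phi> y" if "y \<in> - closure {x. \<phi> x \<noteq> 0}" for y
      using that closure_subset[of "{x. \<phi> x \<noteq> 0}"] by auto
  qed
  moreover have "(\<phi> has_derivative (\<lambda>h. \<psi> x \<bullet> h)) (at x)"
    using assms by (simp add: testfun_def)
  ultimately have "(\<lambda>h. \<psi> x \<bullet> h) = (\<lambda>h. 0)"
    by (rule has_derivative_unique[rotated])
  then show "\<psi> x = 0" by (metis inner_eq_zero_iff)
qed

lemma integrable_continuous_compact_support:
  fixes f :: "'d::euclidean_space \<Rightarrow> 'b::euclidean_space"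
  assumes "continuous_on UNIV f" "compact K" "\<And>x. x \<notin> K \<Longrightarrow> f x = 0"
  shows "integrable lborel f"
proof -
  have "integrable lborel (\<lambda>x. indicator K x *\<^sub>R f x)"
    using assms by (intro borel_integrable_compact) (auto intro: continuous_on_subset)
  moreover have "(\<lambda>x. indicator K x *\<^sub>R f x) = f"
    using assms(3) by (force simp: indicator_def)
  ultimately show ?thesis by simp
qed

lemma integrable_testfun:
  assumes "testfun \<Omega> \<phi> \<psi>"
  shows "integrable lborel \<phi>" "integrable lborel \<psi>"
proof -
  have C1: "C1_grad \<phi> \<psi>" and K: "compact (closure {x. \<phi> x \<noteq> 0})"
    using assms by (simp_all add: testfun_iff)
  show "integrable lborel \<phi>" "integrable lborel \<psi>"
    by (rule integrable_continuous_compact_support[OF _ K], rule C1_grad_continuous[OF C1],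
        erule testfun_eq_0[OF assms])+
qed

lemma integral_cbox_compact_support:
  fixes f :: "'d::euclidean_space \<Rightarrow> 'b::euclidean_space"
  assumes "continuous_on UNIV f" "compact K" and zero: "\<And>x. x \<notin> K \<Longrightarrow> f x = 0" and "K \<subseteq> cbox a b"
  shows "integral (cbox a b) f = (LINT x|lborel. f x)"
proof -
  have "(f has_integral (LINT x|lborel. f x)) UNIV"
    by (intro has_integral_integral_lborel integrable_continuous_compact_support[OF assms(1-3)])
  moreover have "(\<lambda>x. if x \<in> cbox a b then f x else 0) = f"
    using zero \<open>K \<subseteq> cbox a b\<close> by (auto simp: fun_eq_iff)
  ultimately show ?thesis
    using has_integral_restrict_UNIV[of "cbox a b" f] by (simp add: integral_unique)
qed

lemma integral_cbox_translate_compact_support: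
  fixes f :: "'d::euclidean_space \<Rightarrow> 'b::euclidean_space"
  assumes "continuous_on UNIV f" "compact K" "\<And>x. x \<notin> K \<Longrightarrow> f x = 0" "K \<subseteq> cbox (a + v) (b + v)"
  shows "integral (cbox a b) (\<lambda>x. f (x + v)) = (LINT x|lborel. f x)"
  using integral_cbox_compact_support[OF assms] integral_shift_cbox_plus[of a b f v]
  by (simp add: o_def add.commute)

text \<open>By translation invariance \<open>\<integral>\<phi>(x + h e) dx\<close> does not depend on \<open>h\<close>; differentiate under
  the integral sign at \<open>h = 0\<close>.\<close>

lemma integral_grad_testfun:
  fixes \<phi> :: "'d::euclidean_space \<Rightarrow> real"
  assumes "testfun \<Omega> \<phi> \<psi>"
  shows "(LINT x|lborel. \<psi> x \<bullet> e) = 0"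
proof -
  define K where "K = closure {x. \<phi> x \<noteq> 0}"
  have "compact K" and C1: "C1_grad \<phi> \<psi>" using assms by (simp_all add: testfun_iff K_def)
  note cont = C1_grad_continuous[OF C1]
  have zero: "\<phi> x = 0" "\<psi> x = 0" if "x \<notin> K" for x
    by (rule testfun_eq_0[OF assms that[unfolded K_def]])+
  have "compact ((\<lambda>(x, h). x - h *\<^sub>R e) ` (K \<times> {-1..1}))"
    by (intro compact_continuous_image compact_Times \<open>compact K\<close> compact_Icc)
       (auto simp: case_prod_beta intro!: continuous_intros)
  then obtain c where "(\<lambda>(x, h). x - h *\<^sub>R e) ` (K \<times> {-1..1}) \<subseteq> cbox (- c) c"
    using bounded_subset_cbox_symmetric compact_imp_bounded by metis
  then have in_box: "x - h *\<^sub>R e \<in> cbox (- c) c" if "x \<in> K" "h \<in> {-1..1}" for x h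
    using that by force
  have translated: "integral (cbox (- c) c) (\<lambda>x. \<phi> (x + h *\<^sub>R e)) = (LINT x|lborel. \<phi> x)"
    if "h \<in> {-1..1}" for h
    using in_box[OF _ that]
    by (intro integral_cbox_translate_compact_support[OF cont(1) \<open>compact K\<close> zero(1)])
       (auto simp: mem_box inner_simps algebra_simps)
  have "((\<lambda>h. integral (cbox (- c) c) (\<lambda>x. \<phi> (x + h *\<^sub>R e))) has_real_derivative
      integral (cbox (- c) c) (\<lambda>x. \<psi> (x + 0 *\<^sub>R e) \<bullet> e)) (at 0 within {-1..1})"
  proof (rule leibniz_rule_field_derivative)
    show "((\<lambda>h. \<phi> (x + h *\<^sub>R e)) has_real_derivative \<psi> (x + h *\<^sub>R e) \<bullet> e) (at h within {-1..1})"
      for h x by (rule C1_grad_derivative_along_line[OF C1])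
    show "(\<lambda>x. \<phi> (x + h *\<^sub>R e)) integrable_on cbox (- c) c" for h
      by (intro integrable_continuous continuous_on_compose2[OF cont(1)[of UNIV]] continuous_intros) auto
    show "continuous_on ({-1..1} \<times> cbox (- c) c) (\<lambda>(h, x). \<psi> (x + h *\<^sub>R e) \<bullet> e)"
      unfolding case_prod_beta
      by (intro continuous_on_inner continuous_on_compose2[OF cont(2)[of UNIV]] continuous_intros) auto
  qed auto
  from has_field_derivative_transform_within[OF this, of 1 "\<lambda>h. LINT x|lborel. \<phi> x"]
  have "((\<lambda>h. LINT x|lborel. \<phi> x) has_real_derivative
      integral (cbox (- c) c) (\<lambda>x. \<psi> x \<bullet> e)) (at 0 within {-1..1})"
    by (simp add: translated)
  then have "integral (cbox (- c) c) (\<lambda>x. \<psi> x \<bullet> e) = 0"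
    using DERIV_unique[OF _ DERIV_const] by (simp add: at_within_Icc_at)
  moreover have "integral (cbox (- c) c) (\<lambda>x. \<psi> x \<bullet> e) = (LINT x|lborel. \<psi> x \<bullet> e)"
    using in_box[of _ 0] zero(2)
    by (intro integral_cbox_compact_support[OF _ \<open>compact K\<close>] continuous_intros cont) auto
  ultimately show ?thesis by simp
qed

lemma integral_divergence_testfun:
  fixes \<psi> :: "'d::euclidean_space \<Rightarrow> 'd \<Rightarrow> 'd"
  assumes test: "\<And>b. b \<in> Basis \<Longrightarrow> testfun \<Omega> (\<phi> b) (\<psi> b)"
  shows "(LINT x|lebesgue. (\<Sum>b\<in>Basis. \<psi> b x \<bullet> b)) = 0"
proof -
  have "(LINT x|lebesgue. (\<Sum>b\<in>Basis. \<psi> b x \<bullet> b)) = (LINT x|lborel. (\<Sum>b\<in>Basis. \<psi> b x \<bullet> b))"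
    using test
    by (intro integral_completion)
       (auto simp: testfun_def intro!: borel_measurable_continuous_onI continuous_intros)
  also have "\<dots> = (\<Sum>b\<in>Basis. LINT x|lborel. \<psi> b x \<bullet> b)"
    using test by (intro Bochner_Integration.integral_sum integrable_inner_left integrable_testfun) auto
  also have "\<dots> = 0"
    by (intro sum.neutral ballI integral_grad_testfun[OF test])
  finally show ?thesis .
qed

section \<open>Extension by zero\<close>

definition zero_ext :: "'d set \<Rightarrow> ('d \<Rightarrow> 'b::zero) \<Rightarrow> 'd \<Rightarrow> 'b" where
  "zero_ext \<Omega> f = (\<lambda>x. if x \<in> \<Omega> then f x else 0)"

abbreviation square_integrable_on :: "'d::euclidean_space set \<Rightarrow> ('d \<Rightarrow> 'b::euclidean_space) \<Rightarrow> bool" where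
  "square_integrable_on \<Omega> f \<equiv> square_integrable (zero_ext \<Omega> f)"

abbreviation toL2_on :: "'d::euclidean_space set \<Rightarrow> ('d \<Rightarrow> 'b::euclidean_space) \<Rightarrow> ('d, 'b) L2" where
  "toL2_on \<Omega> f \<equiv> toL2 (zero_ext \<Omega> f)"

lemma zero_ext_diff: "zero_ext \<Omega> (\<lambda>x. f x - g x) = (\<lambda>x. zero_ext \<Omega> f x - zero_ext \<Omega> g x)"
  for f g :: "'d \<Rightarrow> 'b::group_add"
  by (auto simp: zero_ext_def)

lemma zero_ext_add: "zero_ext \<Omega> (\<lambda>x. f x + g x) = (\<lambda>x. zero_ext \<Omega> f x + zero_ext \<Omega> g x)"
  for f g :: "'d \<Rightarrow> 'b::monoid_add"
  by (auto simp: zero_ext_def)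

context
  fixes \<Omega> :: "'d::euclidean_space set"
  assumes sets_\<Omega>[measurable]: "\<Omega> \<in> sets lebesgue"
begin

lemma zero_ext_measurable_iff:
  fixes f :: "'d \<Rightarrow> 'b::euclidean_space"
  shows "zero_ext \<Omega> f \<in> borel_measurable lebesgue \<longleftrightarrow> f \<in> borel_measurable (lebesgue_on \<Omega>)"
  unfolding zero_ext_def by (rule borel_measurable_if[OF sets_\<Omega>])

lemma square_integrable_on_iff:
  fixes f :: "'d \<Rightarrow> 'b::euclidean_space"
  shows "square_integrable_on \<Omega> f \<longleftrightarrow>
    f \<in> borel_measurable (lebesgue_on \<Omega>) \<and> integrable (lebesgue_on \<Omega>) (\<lambda>x. (norm (f x))\<^sup>2)"
proof -
  have "(\<lambda>x. (norm (zero_ext \<Omega> f x))\<^sup>2) = (\<lambda>x. if x \<in> \<Omega> then (norm (f x))\<^sup>2 else 0)"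
    by (auto simp: zero_ext_def)
  then show ?thesis
    unfolding square_integrable_def zero_ext_measurable_iff
    by (simp add: Lebesgue_Measure.integrable_restrict_UNIV)
qed

lemma square_integrable_on_of_square_integrable:
  assumes f: "square_integrable f"
  shows "square_integrable_on \<Omega> f"
proof (rule square_integrable_dominated[OF _ f])
  show "zero_ext \<Omega> f \<in> borel_measurable lebesgue"
    unfolding zero_ext_def using square_integrable_measurable[OF f] by measurable
  show "norm (zero_ext \<Omega> f x) \<le> 1 * norm (f x)" for x
    by (simp add: zero_ext_def)
qed

lemma integral_zero_ext:
  fixes f :: "'d \<Rightarrow> 'b::euclidean_space"
  shows "(LINT x|lebesgue_on \<Omega>. f x) = (LINT x|lebesgue. zero_ext \<Omega> f x)"
  unfolding zero_ext_def by (rule Lebesgue_Measure.integral_restrict_UNIV[OF sets_\<Omega>, symmetric])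

lemma
  fixes f g :: "'d \<Rightarrow> 'b::euclidean_space"
  assumes f: "square_integrable_on \<Omega> f" and g: "square_integrable_on \<Omega> g"
  shows inner_toL2_on: "toL2_on \<Omega> f \<bullet> toL2_on \<Omega> g = (LINT x|lebesgue_on \<Omega>. f x \<bullet> g x)"
    and integrable_inner_on: "integrable (lebesgue_on \<Omega>) (\<lambda>x. f x \<bullet> g x)"
proof -
  have "(\<lambda>x. zero_ext \<Omega> f x \<bullet> zero_ext \<Omega> g x) = zero_ext \<Omega> (\<lambda>x. f x \<bullet> g x)"
    by (auto simp: zero_ext_def)
  then show "toL2_on \<Omega> f \<bullet> toL2_on \<Omega> g = (LINT x|lebesgue_on \<Omega>. f x \<bullet> g x)"
    "integrable (lebesgue_on \<Omega>) (\<lambda>x. f x \<bullet> g x)"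
    using inner_toL2[OF f g] square_integrable_inner[OF f g]
    unfolding integral_zero_ext Lebesgue_Measure.integrable_restrict_UNIV[OF sets_\<Omega>, symmetric]
    by (simp_all add: zero_ext_def)
qed

lemma AE_zero_ext_iff:
  "(AE x in lebesgue. zero_ext \<Omega> f x = zero_ext \<Omega> g x) \<longleftrightarrow> (AE x in lebesgue_on \<Omega>. f x = g x)"
  by (auto simp: AE_restrict_space_iff zero_ext_def intro: AE_cong)

lemma toL2_tendsto_toL2_on_iff:
  fixes f :: "'d \<Rightarrow> 'b::euclidean_space"
  assumes f: "square_integrable_on \<Omega> f" and k: "\<And>i. square_integrable (k i)" "\<And>i. zero_ext \<Omega> (k i) = k i"
  shows "((\<lambda>i. LINT x|lebesgue_on \<Omega>. (norm (k i x - f x))\<^sup>2) \<longlongrightarrow> 0) F \<longleftrightarrow>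
    ((\<lambda>i. toL2 (k i)) \<longlongrightarrow> toL2_on \<Omega> f) F"
proof -
  have "(LINT x|lebesgue_on \<Omega>. (norm (k i x - f x))\<^sup>2) = (norm (toL2 (k i) - toL2_on \<Omega> f))\<^sup>2" for i
  proof -
    have "toL2 (k i) - toL2_on \<Omega> f = toL2_on \<Omega> (\<lambda>x. k i x - f x)"
      using f k by (simp add: zero_ext_diff toL2_diff)
    moreover have "square_integrable_on \<Omega> (\<lambda>x. k i x - f x)"
      using square_integrable_diff[OF k(1) f] k(2) by (simp add: zero_ext_diff)
    ultimately show ?thesis
      by (simp add: inner_toL2_on power2_norm_eq_inner)
  qed
  then show ?thesis
    by (simp add: tendsto_norm_zero_iff LIM_zero_iff)
qed

text \<open>A class \<open>toL2 f\<close> vanishes outside \<open>\<Omega>\<close> iff it is orthogonal to every class vanishing on \<open>\<Omega>\<close>.\<close>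

lemma closed_range_toL2_on: "closed {toL2_on \<Omega> f | f :: 'd \<Rightarrow> 'b::euclidean_space. square_integrable f}"
proof -
  have orthogonal: "toL2_on \<Omega> f \<bullet> (toL2 k - toL2_on \<Omega> k) = 0"
    if f: "square_integrable f" and k: "square_integrable k" for f k :: "'d \<Rightarrow> 'b"
  proof -
    have "zero_ext \<Omega> f x \<bullet> (k x - zero_ext \<Omega> k x) = 0" for x
      by (simp add: zero_ext_def)
    then show ?thesis
      using f k by (simp add: toL2_diff[symmetric] inner_toL2 square_integrable_diff
          square_integrable_on_of_square_integrable)
  qed
  have "{toL2_on \<Omega> f | f :: 'd \<Rightarrow> 'b. square_integrable f}
      = {y. \<forall>k. square_integrable k \<longrightarrow> y \<bullet> (toL2 k - toL2_on \<Omega> k) = 0}"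
  proof (intro equalityI subsetI; clarify)
    fix y :: "('d, 'b) L2"
    assume y: "\<forall>k. square_integrable k \<longrightarrow> y \<bullet> (toL2 k - toL2_on \<Omega> k) = 0"
    obtain f where f: "square_integrable f" "y = toL2 f" by (rule toL2_cases)
    then have "(y - toL2_on \<Omega> f) \<bullet> (y - toL2_on \<Omega> f) = 0"
      using y orthogonal[OF f(1) f(1)] by (simp add: inner_diff_left)
    then show "\<exists>f. y = toL2_on \<Omega> f \<and> square_integrable f"
      using f(1) by auto
  qed (rule orthogonal)
  also have "closed \<dots>"
    by (intro closed_Collect_all closed_Collect_imp open_Collect_const closed_Collect_eq
        continuous_intros)
  finally show ?thesis .
qed

lemma
  fixes h :: "'d \<Rightarrow> 'b::euclidean_space"
  assumes "bounded \<Omega>" and h: "continuous_on UNIV h"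
  shows square_integrable_on_continuous: "square_integrable_on \<Omega> h"
    and norm_toL2_on_le: "(\<And>x. x \<in> \<Omega> \<Longrightarrow> norm (h x) \<le> c) \<Longrightarrow> 0 \<le> c \<Longrightarrow>
      norm (toL2_on \<Omega> h) \<le> c * norm (toL2_on \<Omega> (\<lambda>x. 1 :: real))"
proof -
  have "integrable (lebesgue_on \<Omega>) (\<lambda>x. 1 :: real)"
    using finite_measure_lebesgue_on[OF bounded_set_imp_lmeasurable[OF \<open>bounded \<Omega>\<close> sets_\<Omega>]]
    by (rule finite_measure.integrable_const)
  then have one: "square_integrable_on \<Omega> (\<lambda>x. 1 :: real)"
    by (simp add: square_integrable_on_iff)
  have meas: "zero_ext \<Omega> h \<in> borel_measurable lebesgue"
    unfolding zero_ext_measurable_iff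
    using continuous_imp_measurable_on_sets_lebesgue[OF continuous_on_subset[OF h] sets_\<Omega>] by simp
  have le: "norm (zero_ext \<Omega> h x) \<le> c * norm (zero_ext \<Omega> (\<lambda>x. 1 :: real) x)"
    if "\<And>x. x \<in> \<Omega> \<Longrightarrow> norm (h x) \<le> c" for c x
    using that by (simp add: zero_ext_def)
  have "compact (h ` closure \<Omega>)"
    using \<open>bounded \<Omega>\<close> h by (intro compact_continuous_image) (auto intro: continuous_on_subset)
  then have "bounded (h ` closure \<Omega>)" by (rule compact_imp_bounded)
  then obtain B where "\<And>x. x \<in> \<Omega> \<Longrightarrow> norm (h x) \<le> B"
    using closure_subset[of \<Omega>] unfolding bounded_iff by auto
  from square_integrable_dominated[OF meas one le[OF this]] show "square_integrable_on \<Omega> h" .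
  show "norm (toL2_on \<Omega> h) \<le> c * norm (toL2_on \<Omega> (\<lambda>x. 1 :: real))"
    if "\<And>x. x \<in> \<Omega> \<Longrightarrow> norm (h x) \<le> c" "0 \<le> c"
    using that by (intro norm_toL2_dominated[OF meas one le])
qed

lemma toL2_on_tendsto_of_uniform_limit:
  fixes h :: "'d \<Rightarrow> 'b::euclidean_space"
  assumes "bounded \<Omega>" and f: "\<And>n. continuous_on UNIV (f n)" and h: "continuous_on UNIV h"
    and lim: "uniform_limit \<Omega> f h sequentially"
  shows "(\<lambda>n. toL2_on \<Omega> (f n)) \<longlonglongrightarrow> toL2_on \<Omega> h"
proof -
  define m where "m = norm (toL2_on \<Omega> (\<lambda>x. 1 :: real)) + 1"
  have "0 < m" by (simp add: m_def add_nonneg_pos)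
  show ?thesis
  proof (rule tendstoI)
    fix e :: real assume "0 < e"
    then have "\<forall>\<^sub>F n in sequentially. \<forall>x\<in>\<Omega>. dist (f n x) (h x) < e / m"
      using \<open>0 < m\<close> by (intro uniform_limitD[OF lim]) simp
    then show "\<forall>\<^sub>F n in sequentially. dist (toL2_on \<Omega> (f n)) (toL2_on \<Omega> h) < e"
    proof eventually_elim
      case (elim n)
      have "norm (toL2_on \<Omega> (\<lambda>x. f n x - h x)) \<le> e / m * norm (toL2_on \<Omega> (\<lambda>x. 1 :: real))"
        using elim \<open>0 < e\<close> \<open>0 < m\<close>
        by (intro norm_toL2_on_le \<open>bounded \<Omega>\<close> continuous_intros f h) (auto simp: dist_norm less_imp_le)
      also have "\<dots> < e / m * m"
        using \<open>0 < e\<close> \<open>0 < m\<close> by (intro mult_strict_left_mono) (auto simp: m_def)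
      finally show ?case
        using \<open>0 < m\<close> by (simp add: dist_norm zero_ext_diff toL2_diff
            square_integrable_on_continuous[OF \<open>bounded \<Omega>\<close>] f h)
    qed
  qed
qed

lemma orthogonal_polynomials_imp_orthogonal_continuous:
  fixes y :: "('d, 'b::euclidean_space) L2"
  assumes "bounded \<Omega>" and h: "continuous_on UNIV h"
    and orthogonal: "\<And>p. polynomial_function p \<Longrightarrow> y \<bullet> toL2_on \<Omega> p = 0"
  shows "y \<bullet> toL2_on \<Omega> h = 0"
proof -
  obtain p where lim: "uniform_limit (closure \<Omega>) p h sequentially" and p: "\<And>n. polynomial_function (p n)"
    using Stone_Weierstrass_uniform_limit[of "closure \<Omega>" h] \<open>bounded \<Omega>\<close> h
    by (metis compact_closure continuous_on_subset subset_UNIV)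
  have "(\<lambda>n. y \<bullet> toL2_on \<Omega> (p n)) \<longlonglongrightarrow> y \<bullet> toL2_on \<Omega> h"
    using h
    by (intro tendsto_inner tendsto_const toL2_on_tendsto_of_uniform_limit \<open>bounded \<Omega>\<close>
        uniform_limit_on_subset[OF lim closure_subset] continuous_on_polymonial_function[OF p])
  then show ?thesis
    using orthogonal[OF p] by (simp add: LIMSEQ_const_iff)
qed

end

lemma zero_ext_testfun:
  assumes "testfun \<Omega> \<phi> \<psi>"
  shows "zero_ext \<Omega> \<phi> = \<phi>" "zero_ext \<Omega> \<psi> = \<psi>"
proof -
  have "x \<notin> closure {x. \<phi> x \<noteq> 0}" if "x \<notin> \<Omega>" for x
    using assms that by (auto simp: testfun_iff)
  then have "\<phi> x = 0" "\<psi> x = 0" if "x \<notin> \<Omega>" for x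
    using testfun_eq_0[OF assms] that by blast+
  then show "zero_ext \<Omega> \<phi> = \<phi>" "zero_ext \<Omega> \<psi> = \<psi>"
    by (simp_all add: zero_ext_def fun_eq_iff)
qed

lemma square_integrable_compact_support:
  fixes f :: "'d::euclidean_space \<Rightarrow> 'b::euclidean_space"
  assumes "continuous_on UNIV f" "compact K" "\<And>x. x \<notin> K \<Longrightarrow> f x = 0"
  shows "square_integrable f"
proof -
  have "zero_ext K f = f" using assms(3) by (auto simp: zero_ext_def)
  then show ?thesis
    using square_integrable_on_continuous[of K f] assms(1,2)
    by (simp add: compact_imp_bounded compact_imp_closed lmeasurable_compact fmeasurableD)
qed

lemma square_integrable_testfun:
  assumes "testfun \<Omega> \<phi> \<psi>"
  shows "square_integrable \<phi>" "square_integrable \<psi>"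
proof -
  have C1: "C1_grad \<phi> \<psi>" and K: "compact (closure {x. \<phi> x \<noteq> 0})"
    using assms by (simp_all add: testfun_iff)
  show "square_integrable \<phi>" "square_integrable \<psi>"
    by (rule square_integrable_compact_support[OF _ K], rule C1_grad_continuous[OF C1],
        erule testfun_eq_0[OF assms])+
qed

lemma testfun_integration_by_parts:
  fixes p :: "'d::euclidean_space \<Rightarrow> 'd"
  assumes \<Omega>: "open \<Omega>" "bounded \<Omega>" and \<phi>: "testfun \<Omega> \<phi> \<psi>"
    and p: "\<And>b. b \<in> Basis \<Longrightarrow> C1_grad (\<lambda>x. p x \<bullet> b) (g b)"
  shows "toL2 \<phi> \<bullet> toL2_on \<Omega> (\<lambda>x. \<Sum>b\<in>Basis. g b x \<bullet> b) + toL2 \<psi> \<bullet> toL2_on \<Omega> p = 0"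
proof -
  define \<theta> where "\<theta> b x = \<phi> x *\<^sub>R g b x + (p x \<bullet> b) *\<^sub>R \<psi> x" for b x
  have \<theta>: "testfun \<Omega> (\<lambda>x. \<phi> x * (p x \<bullet> b)) (\<theta> b)" if "b \<in> Basis" for b
    unfolding \<theta>_def by (rule testfun_mult[OF \<phi> p[OF that]])
  have p_cont: "continuous_on UNIV p"
    using C1_grad_continuous(1)[OF p] by (simp add: continuous_on_componentwise[of _ p])
  have div_cont: "continuous_on UNIV (\<lambda>x. \<Sum>b\<in>Basis. g b x \<bullet> b)"
    by (intro continuous_intros C1_grad_continuous(2)[OF p])
  have sets_\<Omega>: "\<Omega> \<in> sets lebesgue" using \<Omega>(1) by simp
  note sq = square_integrable_testfun[OF \<phi>]
    square_integrable_on_continuous[OF sets_\<Omega> \<Omega>(2) p_cont]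
    square_integrable_on_continuous[OF sets_\<Omega> \<Omega>(2) div_cont]
  have pointwise: "\<phi> x \<bullet> zero_ext \<Omega> (\<lambda>x. \<Sum>b\<in>Basis. g b x \<bullet> b) x + \<psi> x \<bullet> zero_ext \<Omega> p x
      = (\<Sum>b\<in>Basis. \<theta> b x \<bullet> b)" for x
  proof (cases "x \<in> \<Omega>")
    case True
    then show ?thesis
      by (simp add: zero_ext_def \<theta>_def inner_simps sum.distrib sum_distrib_left
          euclidean_inner[of "\<psi> x" "p x"] mult_ac)
  next
    case False
    then show ?thesis
      using fun_cong[OF zero_ext_testfun(1)[OF \<phi>], of x] fun_cong[OF zero_ext_testfun(2)[OF \<phi>], of x]
      by (simp add: zero_ext_def \<theta>_def)
  qed
  have "toL2 \<phi> \<bullet> toL2_on \<Omega> (\<lambda>x. \<Sum>b\<in>Basis. g b x \<bullet> b) + toL2 \<psi> \<bullet> toL2_on \<Omega> p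
      = (LINT x|lebesgue. (\<Sum>b\<in>Basis. \<theta> b x \<bullet> b))"
    unfolding pointwise[symmetric] using sq
    by (simp only: inner_toL2 Bochner_Integration.integral_add square_integrable_inner)
  also have "\<dots> = 0"
    by (rule integral_divergence_testfun[OF \<theta>])
  finally show ?thesis .
qed

section \<open>The Sobolev space as a closed subspace\<close>

lemma subspace_closure:
  fixes A :: "'a::real_normed_vector set"
  assumes "subspace A"
  shows "subspace (closure A)"
proof (rule subspaceI)
  show "0 \<in> closure A"
    using subspace_0[OF assms] closure_subset by blast
  show "x + y \<in> closure A" if xy: "x \<in> closure A" "y \<in> closure A" for x y
  proof -
    obtain f g where "\<forall>n. f n \<in> A" "f \<longlonglongrightarrow> x" "\<forall>n. g n \<in> A" "g \<longlonglongrightarrow> y"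
      using xy unfolding closure_sequential by blast
    then show ?thesis
      unfolding closure_sequential
      by (intro exI[of _ "\<lambda>n. f n + g n"]) (auto intro: tendsto_add subspace_add[OF assms])
  qed
  show "c *\<^sub>R x \<in> closure A" if x: "x \<in> closure A" for c x
  proof -
    obtain f where "\<forall>n. f n \<in> A" "f \<longlonglongrightarrow> x"
      using x unfolding closure_sequential by blast
    then show ?thesis
      unfolding closure_sequential
      by (intro exI[of _ "\<lambda>n. c *\<^sub>R f n"]) (auto intro: tendsto_scaleR subspace_scale[OF assms])
  qed
qed

locale bounded_open =
  fixes \<Omega> :: "'d::euclidean_space set"
  assumes open_\<Omega>: "open \<Omega>" and bounded_\<Omega>: "bounded \<Omega>"
begin

lemma sets_\<Omega>: "\<Omega> \<in> sets lebesgue"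
  using open_\<Omega> by simp

definition test_pairs :: "(('d, real) L2 \<times> ('d, 'd) L2) set" where
  "test_pairs = {(toL2 \<phi>, toL2 \<psi>) | \<phi> \<psi>. testfun \<Omega> \<phi> \<psi>}"

definition H1_space :: "(('d, real) L2 \<times> ('d, 'd) L2) set" where
  "H1_space = closure test_pairs"

lemma subspace_test_pairs: "subspace test_pairs"
proof (rule subspaceI)
  show "0 \<in> test_pairs"
    unfolding test_pairs_def mem_Collect_eq
    by (intro exI[of _ "\<lambda>x. 0"]) (simp add: testfun_zero toL2_zero zero_prod_def)
next
  fix x y assume "x \<in> test_pairs" "y \<in> test_pairs"
  then obtain \<phi> \<psi> \<phi>' \<psi>' where test: "testfun \<Omega> \<phi> \<psi>" "testfun \<Omega> \<phi>' \<psi>'"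
    and xy: "x = (toL2 \<phi>, toL2 \<psi>)" "y = (toL2 \<phi>', toL2 \<psi>')"
    by (auto simp: test_pairs_def)
  have "x + y = (toL2 (\<lambda>x. \<phi> x + \<phi>' x), toL2 (\<lambda>x. \<psi> x + \<psi>' x))"
    using test by (simp add: xy toL2_add square_integrable_testfun)
  then show "x + y \<in> test_pairs"
    unfolding test_pairs_def using testfun_add[OF test] by blast
next
  fix c :: real and x assume "x \<in> test_pairs"
  then obtain \<phi> \<psi> where test: "testfun \<Omega> \<phi> \<psi>" and x: "x = (toL2 \<phi>, toL2 \<psi>)"
    by (auto simp: test_pairs_def)
  have "c *\<^sub>R x = (toL2 (\<lambda>x. c * \<phi> x), toL2 (\<lambda>x. c *\<^sub>R \<psi> x))"
    using test toL2_scaleR[of \<phi> c] by (simp add: x toL2_scaleR square_integrable_testfun)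
  then show "c *\<^sub>R x \<in> test_pairs"
    unfolding test_pairs_def using testfun_scale[OF test] by blast
qed

lemma subspace_H1_space: "subspace H1_space"
  unfolding H1_space_def by (rule subspace_closure[OF subspace_test_pairs])

lemma closed_H1_space: "closed H1_space"
  by (simp add: H1_space_def)

lemma H1_space_sequential:
  "(x, y) \<in> H1_space \<longleftrightarrow> (\<exists>\<phi> \<psi>. (\<forall>k. testfun \<Omega> (\<phi> k) (\<psi> k)) \<and>
    (\<lambda>k. toL2 (\<phi> k)) \<longlonglongrightarrow> x \<and> (\<lambda>k. toL2 (\<psi> k)) \<longlonglongrightarrow> y)"
proof
  assume "(x, y) \<in> H1_space"
  then obtain s where s: "\<forall>k. s k \<in> test_pairs" "s \<longlonglongrightarrow> (x, y)"
    by (auto simp: H1_space_def closure_sequential)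
  have "\<forall>k. \<exists>\<phi> \<psi>. testfun \<Omega> \<phi> \<psi> \<and> s k = (toL2 \<phi>, toL2 \<psi>)"
    using s(1) unfolding test_pairs_def mem_Collect_eq by blast
  then obtain \<phi> \<psi> where "\<And>k. testfun \<Omega> (\<phi> k) (\<psi> k)" "\<And>k. s k = (toL2 (\<phi> k), toL2 (\<psi> k))"
    by metis
  then show "\<exists>\<phi> \<psi>. (\<forall>k. testfun \<Omega> (\<phi> k) (\<psi> k)) \<and>
      (\<lambda>k. toL2 (\<phi> k)) \<longlonglongrightarrow> x \<and> (\<lambda>k. toL2 (\<psi> k)) \<longlonglongrightarrow> y"
    using tendsto_fst[OF s(2)] tendsto_snd[OF s(2)] by (intro exI[of _ \<phi>] exI[of _ \<psi>]) auto
next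
  assume "\<exists>\<phi> \<psi>. (\<forall>k. testfun \<Omega> (\<phi> k) (\<psi> k)) \<and>
      (\<lambda>k. toL2 (\<phi> k)) \<longlonglongrightarrow> x \<and> (\<lambda>k. toL2 (\<psi> k)) \<longlonglongrightarrow> y"
  then obtain \<phi> \<psi> where "\<And>k. testfun \<Omega> (\<phi> k) (\<psi> k)"
    and "(\<lambda>k. (toL2 (\<phi> k), toL2 (\<psi> k))) \<longlonglongrightarrow> (x, y)"
    using tendsto_Pair by blast
  moreover from this(1) have "(toL2 (\<phi> k), toL2 (\<psi> k)) \<in> test_pairs" for k
    unfolding test_pairs_def by blast
  ultimately show "(x, y) \<in> H1_space"
    unfolding H1_space_def closure_sequential by (intro exI[of _ "\<lambda>k. (toL2 (\<phi> k), toL2 (\<psi> k))"]) simp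
qed

lemma H1_space_induct:
  assumes "closed {x. P x}" "\<And>\<phi> \<psi>. testfun \<Omega> \<phi> \<psi> \<Longrightarrow> P (toL2 \<phi>, toL2 \<psi>)" "s \<in> H1_space"
  shows "P s"
proof -
  have "test_pairs \<subseteq> {x. P x}" using assms(2) by (auto simp: test_pairs_def)
  then have "H1_space \<subseteq> {x. P x}"
    unfolding H1_space_def using assms(1) by (rule closure_minimal)
  then show ?thesis using assms(3) by blast
qed

lemma H01_pair_iff:
  "H01_pair \<Omega> u g \<longleftrightarrow>
    square_integrable_on \<Omega> u \<and> square_integrable_on \<Omega> g \<and> (toL2_on \<Omega> u, toL2_on \<Omega> g) \<in> H1_space"
proof (cases "square_integrable_on \<Omega> u \<and> square_integrable_on \<Omega> g")
  case True
  have "(\<lambda>k. LINT x|lebesgue_on \<Omega>. (\<phi> k x - u x)\<^sup>2) \<longlonglongrightarrow> 0 \<longleftrightarrow> (\<lambda>k. toL2 (\<phi> k)) \<longlonglongrightarrow> toL2_on \<Omega> u"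
    "(\<lambda>k. LINT x|lebesgue_on \<Omega>. (norm (\<psi> k x - g x))\<^sup>2) \<longlonglongrightarrow> 0 \<longleftrightarrow> (\<lambda>k. toL2 (\<psi> k)) \<longlonglongrightarrow> toL2_on \<Omega> g"
    if "\<forall>k. testfun \<Omega> (\<phi> k) (\<psi> k)" for \<phi> \<psi>
  proof -
    have "testfun \<Omega> (\<phi> k) (\<psi> k)" for k using that by blast
    note facts = square_integrable_testfun[OF this] zero_ext_testfun[OF this]
    show "(\<lambda>k. LINT x|lebesgue_on \<Omega>. (\<phi> k x - u x)\<^sup>2) \<longlonglongrightarrow> 0 \<longleftrightarrow> (\<lambda>k. toL2 (\<phi> k)) \<longlonglongrightarrow> toL2_on \<Omega> u"
      using toL2_tendsto_toL2_on_iff[OF sets_\<Omega> conjunct1[OF True] facts(1,3)] by simp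
    show "(\<lambda>k. LINT x|lebesgue_on \<Omega>. (norm (\<psi> k x - g x))\<^sup>2) \<longlonglongrightarrow> 0 \<longleftrightarrow> (\<lambda>k. toL2 (\<psi> k)) \<longlonglongrightarrow> toL2_on \<Omega> g"
      by (rule toL2_tendsto_toL2_on_iff[OF sets_\<Omega> conjunct2[OF True] facts(2,4)])
  qed
  then show ?thesis
    using True
    by (simp add: H01_pair_def H1_space_sequential square_integrable_on_iff[OF sets_\<Omega>]
        cong: conj_cong)
next
  case False
  then show ?thesis by (auto simp: H01_pair_def square_integrable_on_iff[OF sets_\<Omega>])
qed

lemma H1_space_cases:
  assumes "s \<in> H1_space"
  obtains u g where "H01_pair \<Omega> u g" "s = (toL2_on \<Omega> u, toL2_on \<Omega> g)"
proof -
  let ?A = "{toL2_on \<Omega> f | f :: 'd \<Rightarrow> real. square_integrable f}"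
  let ?B = "{toL2_on \<Omega> f | f :: 'd \<Rightarrow> 'd. square_integrable f}"
  have "(toL2 \<phi>, toL2 \<psi>) \<in> ?A \<times> ?B" if test: "testfun \<Omega> \<phi> \<psi>" for \<phi> \<psi>
  proof -
    have "toL2 \<phi> = toL2_on \<Omega> \<phi>" "toL2 \<psi> = toL2_on \<Omega> \<psi>" by (simp_all add: zero_ext_testfun[OF test])
    then show ?thesis using square_integrable_testfun[OF test] by blast
  qed
  then have "test_pairs \<subseteq> ?A \<times> ?B"
    unfolding test_pairs_def by blast
  then have "H1_space \<subseteq> ?A \<times> ?B"
    unfolding H1_space_def by (intro closure_minimal closed_Times closed_range_toL2_on[OF sets_\<Omega>])
  then have "s \<in> ?A \<times> ?B" using assms by (rule subsetD)
  then obtain u g where ug: "square_integrable u" "square_integrable g" "s = (toL2_on \<Omega> u, toL2_on \<Omega> g)"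
    by blast
  have "H01_pair \<Omega> u g"
    using assms square_integrable_on_of_square_integrable[OF sets_\<Omega> ug(1)]
      square_integrable_on_of_square_integrable[OF sets_\<Omega> ug(2)]
    by (simp add: H01_pair_iff ug(3))
  then show ?thesis using that ug(3) by blast
qed

text \<open>For a unit vector \<open>e\<close>, integrating the derivative of \<open>(x \<bullet> e) \<phi>\<^sup>2\<close> along \<open>e\<close> gives
  \<open>\<integral>\<phi>\<^sup>2 = - 2 \<integral>(x \<bullet> e) \<phi> (\<nabla>\<phi> \<bullet> e)\<close>.\<close>

lemma norm_square_testfun_eq:
  fixes e :: 'd
  assumes test: "testfun \<Omega> \<phi> \<psi>" and e: "norm e = 1"
    and sq: "square_integrable (\<lambda>x. (x \<bullet> e) * (\<psi> x \<bullet> e))"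
  shows "(norm (toL2 \<phi>))\<^sup>2 = - 2 * (toL2 \<phi> \<bullet> toL2 (\<lambda>x. (x \<bullet> e) * (\<psi> x \<bullet> e)))"
proof -
  have C1: "C1_grad \<phi> \<psi>" using test by (simp add: testfun_iff)
  note cont = C1_grad_continuous[OF C1]
  have weighted: "testfun \<Omega> (\<lambda>x. \<phi> x * (\<phi> x * (x \<bullet> e)))
      (\<lambda>x. \<phi> x *\<^sub>R (\<phi> x *\<^sub>R e + (x \<bullet> e) *\<^sub>R \<psi> x) + (\<phi> x * (x \<bullet> e)) *\<^sub>R \<psi> x)"
    by (rule testfun_mult[OF test C1_grad_mult[OF C1 C1_grad_inner]])
  have "e \<bullet> e = 1" using e by (simp add: dot_square_norm)
  then have derivative: "(\<phi> x *\<^sub>R (\<phi> x *\<^sub>R e + (x \<bullet> e) *\<^sub>R \<psi> x) + (\<phi> x * (x \<bullet> e)) *\<^sub>R \<psi> x) \<bullet> e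
      = \<phi> x \<bullet> \<phi> x + 2 * (\<phi> x \<bullet> ((x \<bullet> e) * (\<psi> x \<bullet> e)))" for x
    by (simp add: inner_simps algebra_simps)
  have "0 = (LINT x|lborel. \<phi> x \<bullet> \<phi> x + 2 * (\<phi> x \<bullet> ((x \<bullet> e) * (\<psi> x \<bullet> e))))"
    using integral_grad_testfun[OF weighted, of e] unfolding derivative by simp
  also have "\<dots> = (LINT x|lebesgue. \<phi> x \<bullet> \<phi> x + 2 * (\<phi> x \<bullet> ((x \<bullet> e) * (\<psi> x \<bullet> e))))"
    by (intro integral_completion[symmetric])
       (auto intro!: borel_measurable_continuous_onI continuous_intros cont)
  also have "\<dots> = toL2 \<phi> \<bullet> toL2 \<phi> + 2 * (toL2 \<phi> \<bullet> toL2 (\<lambda>x. (x \<bullet> e) * (\<psi> x \<bullet> e)))"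
    using square_integrable_testfun(1)[OF test] sq
    by (simp add: inner_toL2 square_integrable_inner del: inner_real_def)
  finally show ?thesis by (simp add: power2_norm_eq_inner)
qed

lemma Poincare_testfun:
  assumes R: "0 \<le> R" "\<And>x. x \<in> \<Omega> \<Longrightarrow> norm x \<le> R" and test: "testfun \<Omega> \<phi> \<psi>"
  shows "norm (toL2 \<phi>) \<le> 2 * R * norm (toL2 \<psi>)"
proof -
  obtain e :: 'd where e: "norm e = 1" using vector_choose_size[of 1] by auto
  define k where "k = (\<lambda>x. (x \<bullet> e) * (\<psi> x \<bullet> e))"
  have k_le: "norm (k x) \<le> R * norm (\<psi> x)" for x
  proof (cases "x \<in> \<Omega>")
    case True
    have "\<bar>x \<bullet> e\<bar> \<le> R" "\<bar>\<psi> x \<bullet> e\<bar> \<le> norm (\<psi> x)"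
      using R(2)[OF True] Cauchy_Schwarz_ineq2[of x e] Cauchy_Schwarz_ineq2[of "\<psi> x" e] e by auto
    then show ?thesis unfolding k_def real_norm_def abs_mult using R(1) by (intro mult_mono) auto
  next
    case False
    then have "\<psi> x = 0"
      using fun_cong[OF zero_ext_testfun(2)[OF test], of x] by (simp add: zero_ext_def)
    then show ?thesis by (simp add: k_def)
  qed
  have "k \<in> borel_measurable lebesgue"
    using test unfolding k_def testfun_def
    by (intro measurable_completion) (auto intro!: borel_measurable_continuous_onI continuous_intros)
  note k = square_integrable_dominated[OF this square_integrable_testfun(2)[OF test] k_le]
    norm_toL2_dominated[OF this square_integrable_testfun(2)[OF test] k_le R(1)]
  have "norm (toL2 \<phi>) * norm (toL2 \<phi>) = 2 * - (toL2 \<phi> \<bullet> toL2 k)"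
    using norm_square_testfun_eq[OF test e] k(1) by (simp add: k_def power2_eq_square)
  also have "\<dots> \<le> 2 * (norm (toL2 \<phi>) * norm (toL2 k))"
    using Cauchy_Schwarz_ineq2[of "toL2 \<phi>" "toL2 k"] by simp
  also have "\<dots> \<le> 2 * (norm (toL2 \<phi>) * (R * norm (toL2 \<psi>)))"
    using k(2) by (intro mult_left_mono) auto
  finally have "norm (toL2 \<phi>) * norm (toL2 \<phi>) \<le> norm (toL2 \<phi>) * (2 * R * norm (toL2 \<psi>))"
    by (simp add: mult_ac)
  then show ?thesis
    using R(1) by (cases "norm (toL2 \<phi>) = 0") (simp_all add: mult_le_cancel_left)
qed

lemma Poincare:
  obtains C where "0 \<le> C" "\<And>s. s \<in> H1_space \<Longrightarrow> norm (fst s) \<le> C * norm (snd s)"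
proof -
  obtain R where R: "0 < R" "\<And>x. x \<in> \<Omega> \<Longrightarrow> norm x \<le> R"
    using bounded_\<Omega> by (auto simp: bounded_pos)
  have "norm (fst s) \<le> 2 * R * norm (snd s)" if "s \<in> H1_space" for s
    by (rule H1_space_induct[OF _ _ that])
       (auto intro!: closed_Collect_le continuous_intros Poincare_testfun R less_imp_le[OF R(1)])
  then show ?thesis using R(1) that[of "2 * R"] by simp
qed

text \<open>If \<open>(0, g)\<close> lies in the closure, then \<open>g\<close> is orthogonal to all polynomial fields, hence to all
  gradients of test functions, hence to itself.\<close>

lemma H1_space_fst_eq_0:
  assumes s: "s \<in> H1_space" and "fst s = 0"
  shows "s = 0"
proof -
  have orthogonal_polynomials: "snd s \<bullet> toL2_on \<Omega> p = 0" if p: "polynomial_function p" for p :: "'d \<Rightarrow> 'd"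
  proof -
    have "\<exists>g. C1_grad (\<lambda>x. p x \<bullet> b) g" if "b \<in> Basis" for b
      using p that by (intro C1_grad_real_polynomial) (simp add: polynomial_function_iff_Basis_inner)
    then obtain g where g: "\<And>b. b \<in> Basis \<Longrightarrow> C1_grad (\<lambda>x. p x \<bullet> b) (g b)"
      by metis
    have "fst s \<bullet> toL2_on \<Omega> (\<lambda>x. \<Sum>b\<in>Basis. g b x \<bullet> b) + snd s \<bullet> toL2_on \<Omega> p = 0"
      by (rule H1_space_induct[OF _ _ s])
         (auto intro!: closed_Collect_eq continuous_intros
           testfun_integration_by_parts[OF open_\<Omega> bounded_\<Omega> _ g])
    with \<open>fst s = 0\<close> show ?thesis by simp
  qed
  have orthogonal_gradients: "snd s \<bullet> toL2 \<psi> = 0" if test: "testfun \<Omega> \<phi> \<psi>" for \<phi> \<psi>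
  proof -
    have "snd s \<bullet> toL2_on \<Omega> \<psi> = 0"
    proof (rule orthogonal_polynomials_imp_orthogonal_continuous[OF sets_\<Omega> bounded_\<Omega>])
      show "continuous_on UNIV \<psi>" using test by (simp add: testfun_def)
    qed (rule orthogonal_polynomials)
    then show ?thesis by (simp add: zero_ext_testfun[OF test])
  qed
  have "snd s \<bullet> snd s = 0"
    by (rule H1_space_induct[OF _ _ s])
       (auto intro!: closed_Collect_eq continuous_intros orthogonal_gradients)
  with \<open>fst s = 0\<close> show ?thesis by (simp add: prod_eq_iff)
qed

lemma H1_space_fst_inject:
  assumes "s \<in> H1_space" "s' \<in> H1_space" "fst s = fst s'"
  shows "s = s'"
  using H1_space_fst_eq_0[of "s - s'"] subspace_diff[OF subspace_H1_space assms(1,2)] assms(3) by simp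

definition embed :: "('d \<Rightarrow> real) \<Rightarrow> ('d, real) L2 \<times> ('d, 'd) L2" where
  "embed u = (toL2_on \<Omega> u, toL2_on \<Omega> (wgrad \<Omega> u))"

definition representative :: "('d, real) L2 \<times> ('d, 'd) L2 \<Rightarrow> 'd \<Rightarrow> real" where
  "representative s = (SOME u. u \<in> H01 \<Omega> \<and> embed u = s)"

lemma H01_pair_wgrad: "u \<in> H01 \<Omega> \<Longrightarrow> H01_pair \<Omega> u (wgrad \<Omega> u)"
  unfolding H01_def wgrad_def by (simp add: someI_ex[of "H01_pair \<Omega> u"])

lemma embed_in_H1_space: "u \<in> H01 \<Omega> \<Longrightarrow> embed u \<in> H1_space"
  using H01_pair_wgrad[of u] by (simp add: H01_pair_iff embed_def)

lemma square_integrable_H01: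
  assumes "u \<in> H01 \<Omega>"
  shows "square_integrable_on \<Omega> u" "square_integrable_on \<Omega> (wgrad \<Omega> u)"
  using H01_pair_wgrad[OF assms] by (auto simp: H01_pair_iff)

lemma
  assumes u: "square_integrable_on \<Omega> u" and s: "s \<in> H1_space" "fst s = toL2_on \<Omega> u"
  shows H01I: "u \<in> H01 \<Omega>" and embed_eqI: "embed u = s"
proof -
  obtain u' g where "H01_pair \<Omega> u' g" "s = (toL2_on \<Omega> u', toL2_on \<Omega> g)"
    using s(1) by (rule H1_space_cases)
  then have "H01_pair \<Omega> u g"
    using assms by (auto simp: H01_pair_iff)
  then show "u \<in> H01 \<Omega>" by (auto simp: H01_def)
  then show "embed u = s"
    using s by (intro H1_space_fst_inject embed_in_H1_space) (simp_all add: embed_def)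
qed

lemma
  assumes "s \<in> H1_space"
  shows representative_in_H01: "representative s \<in> H01 \<Omega>"
    and embed_representative: "embed (representative s) = s"
proof -
  obtain u g where "H01_pair \<Omega> u g" "s = (toL2_on \<Omega> u, toL2_on \<Omega> g)"
    using assms by (rule H1_space_cases)
  then have "u \<in> H01 \<Omega> \<and> embed u = s"
    using assms H01I[of u s] embed_eqI[of u s] by (simp add: H01_pair_iff)
  then have "representative s \<in> H01 \<Omega> \<and> embed (representative s) = s"
    unfolding representative_def by (rule someI[where P = "\<lambda>u. u \<in> H01 \<Omega> \<and> embed u = s"])
  then show "representative s \<in> H01 \<Omega>" "embed (representative s) = s" by simp_all
qed

lemma
  assumes u: "u \<in> H01 \<Omega>" and v: "v \<in> H01 \<Omega>"
  shows H01_add: "(\<lambda>x. u x + v x) \<in> H01 \<Omega>"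
    and embed_add: "embed (\<lambda>x. u x + v x) = embed u + embed v"
proof -
  have "square_integrable_on \<Omega> (\<lambda>x. u x + v x)"
    unfolding zero_ext_add by (intro square_integrable_add square_integrable_H01 u v)
  moreover have "embed u + embed v \<in> H1_space"
    by (intro subspace_add[OF subspace_H1_space] embed_in_H1_space u v)
  moreover have "fst (embed u + embed v) = toL2_on \<Omega> (\<lambda>x. u x + v x)"
    by (simp add: embed_def zero_ext_add toL2_add square_integrable_H01 u v)
  ultimately show "(\<lambda>x. u x + v x) \<in> H01 \<Omega>" "embed (\<lambda>x. u x + v x) = embed u + embed v"
    by (rule H01I, rule embed_eqI)
qed

lemma
  assumes u: "u \<in> H01 \<Omega>"
  shows H01_scale: "(\<lambda>x. c * u x) \<in> H01 \<Omega>"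
    and embed_scale: "embed (\<lambda>x. c * u x) = c *\<^sub>R embed u"
proof -
  have zero_ext_scale: "zero_ext \<Omega> (\<lambda>x. c * u x) = (\<lambda>x. c *\<^sub>R zero_ext \<Omega> u x)"
    by (auto simp: zero_ext_def)
  have "square_integrable_on \<Omega> (\<lambda>x. c * u x)"
    unfolding zero_ext_scale by (intro square_integrable_scaleR square_integrable_H01 u)
  moreover have "c *\<^sub>R embed u \<in> H1_space"
    by (intro subspace_scale[OF subspace_H1_space] embed_in_H1_space u)
  moreover have "fst (c *\<^sub>R embed u) = toL2_on \<Omega> (\<lambda>x. c * u x)"
    unfolding zero_ext_scale
    by (simp only: toL2_scaleR square_integrable_H01 u embed_def fst_scaleR fst_conv)
  ultimately show "(\<lambda>x. c * u x) \<in> H01 \<Omega>" "embed (\<lambda>x. c * u x) = c *\<^sub>R embed u"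
    by (rule H01I, rule embed_eqI)
qed

lemma
  assumes u: "u \<in> H01 \<Omega>" and v: "v \<in> H01 \<Omega>"
  shows H01_diff: "(\<lambda>x. u x - v x) \<in> H01 \<Omega>"
    and embed_diff: "embed (\<lambda>x. u x - v x) = embed u - embed v"
  using H01_add[OF u H01_scale[OF v, of "-1"]] embed_add[OF u H01_scale[OF v, of "-1"]]
    embed_scale[OF v, of "-1"] by simp_all

lemma
  assumes "finite A" "\<And>i. i \<in> A \<Longrightarrow> f i \<in> H01 \<Omega>"
  shows H01_sum: "(\<lambda>x. \<Sum>i\<in>A. f i x) \<in> H01 \<Omega>"
    and embed_sum: "embed (\<lambda>x. \<Sum>i\<in>A. f i x) = (\<Sum>i\<in>A. embed (f i))"
proof -
  have "(\<lambda>x. \<Sum>i\<in>A. f i x) \<in> H01 \<Omega> \<and> embed (\<lambda>x. \<Sum>i\<in>A. f i x) = (\<Sum>i\<in>A. embed (f i))"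
    using assms
  proof (induction A rule: finite_induct)
    case empty
    have "representative 0 \<in> H01 \<Omega>"
      by (intro representative_in_H01 subspace_0[OF subspace_H1_space])
    from H01_scale[OF this, of 0] embed_scale[OF this, of 0] show ?case by simp
  next
    case (insert i A)
    then show ?case
      using H01_add[of "f i" "\<lambda>x. \<Sum>i\<in>A. f i x"] embed_add[of "f i" "\<lambda>x. \<Sum>i\<in>A. f i x"] by simp
  qed
  then show "(\<lambda>x. \<Sum>i\<in>A. f i x) \<in> H01 \<Omega>" "embed (\<lambda>x. \<Sum>i\<in>A. f i x) = (\<Sum>i\<in>A. embed (f i))"
    by simp_all
qed

lemma L2inner_eq_inner_embed:
  assumes "u \<in> H01 \<Omega>" "v \<in> H01 \<Omega>"
  shows "L2inner \<Omega> u v = fst (embed u) \<bullet> fst (embed v)"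
  using assms by (simp add: L2inner_def embed_def inner_toL2_on[OF sets_\<Omega>] square_integrable_H01)

lemma integral_norm_wgrad:
  assumes "u \<in> H01 \<Omega>"
  shows "(LINT x|lebesgue_on \<Omega>. (norm (wgrad \<Omega> u x))\<^sup>2) = (norm (snd (embed u)))\<^sup>2"
  using assms
  by (simp add: embed_def inner_toL2_on[OF sets_\<Omega>] square_integrable_H01 power2_norm_eq_inner)

lemma embed_eq_imp_AE_eq:
  assumes "u \<in> H01 \<Omega>" "v \<in> H01 \<Omega>" "embed u = embed v"
  shows "AE x in lebesgue_on \<Omega>. u x = v x"
  using assms toL2_eq_iff[of "zero_ext \<Omega> u" "zero_ext \<Omega> v"]
  by (simp add: embed_def square_integrable_H01 AE_zero_ext_iff[OF sets_\<Omega>])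

end

section \<open>The energy form and the Green operator\<close>

locale schroedinger = bounded_open \<Omega> for \<Omega> :: "'d::euclidean_space set" +
  fixes V :: "'d \<Rightarrow> real"
  assumes admissible: "admissible_potential \<Omega> V"
begin

lemma potential_integrable:
  "u \<in> H01 \<Omega> \<Longrightarrow> v \<in> H01 \<Omega> \<Longrightarrow> integrable (lebesgue_on \<Omega>) (\<lambda>x. V x * u x * v x)"
  using admissible by (simp add: admissible_potential_def)

lemma aform_eq:
  assumes "u \<in> H01 \<Omega>" "v \<in> H01 \<Omega>"
  shows "aform \<Omega> V u v = snd (embed u) \<bullet> snd (embed v) + (LINT x|lebesgue_on \<Omega>. V x * u x * v x)"
  unfolding aform_def
  using inner_toL2_on[OF sets_\<Omega>, of "wgrad \<Omega> u" "wgrad \<Omega> v"]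
    integrable_inner_on[OF sets_\<Omega>, of "wgrad \<Omega> u" "wgrad \<Omega> v"] assms potential_integrable[OF assms]
  by (simp add: embed_def square_integrable_H01)

lemma aform_symmetric:
  "u \<in> H01 \<Omega> \<Longrightarrow> v \<in> H01 \<Omega> \<Longrightarrow> aform \<Omega> V u v = aform \<Omega> V v u"
  by (simp add: aform_eq inner_commute mult_ac)

lemma aform_add_left:
  assumes "u \<in> H01 \<Omega>" "v \<in> H01 \<Omega>" "w \<in> H01 \<Omega>"
  shows "aform \<Omega> V (\<lambda>x. u x + v x) w = aform \<Omega> V u w + aform \<Omega> V v w"
proof -
  have "(LINT x|lebesgue_on \<Omega>. V x * (u x + v x) * w x)
      = (LINT x|lebesgue_on \<Omega>. V x * u x * w x) + (LINT x|lebesgue_on \<Omega>. V x * v x * w x)"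
    unfolding distrib_left distrib_right
    by (intro Bochner_Integration.integral_add potential_integrable assms)
  then show ?thesis
    using assms by (simp add: aform_eq H01_add embed_add inner_add_left)
qed

lemma aform_scale_left:
  assumes "u \<in> H01 \<Omega>" "v \<in> H01 \<Omega>"
  shows "aform \<Omega> V (\<lambda>x. r * u x) v = r * aform \<Omega> V u v"
  using assms integral_mult_right_zero[of "lebesgue_on \<Omega>" r "\<lambda>x. V x * u x * v x"]
  by (simp add: aform_eq H01_scale embed_scale distrib_left mult_ac)

lemma aform_cong_left:
  assumes u: "u \<in> H01 \<Omega>" "u' \<in> H01 \<Omega>" "embed u = embed u'" and v: "v \<in> H01 \<Omega>"
  shows "aform \<Omega> V u v = aform \<Omega> V u' v"
proof -
  have "(LINT x|lebesgue_on \<Omega>. V x * u x * v x) = (LINT x|lebesgue_on \<Omega>. V x * u' x * v x)"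
    using embed_eq_imp_AE_eq[OF u] potential_integrable[OF u(1) v] potential_integrable[OF u(2) v]
    by (intro integral_cong_AE) (auto intro: borel_measurable_integrable)
  then show ?thesis using assms by (simp add: aform_eq)
qed

definition form :: "('d, real) L2 \<times> ('d, 'd) L2 \<Rightarrow> ('d, real) L2 \<times> ('d, 'd) L2 \<Rightarrow> real" where
  "form s s' = aform \<Omega> V (representative s) (representative s')"

lemma form_embed:
  assumes u: "u \<in> H01 \<Omega>" and v: "v \<in> H01 \<Omega>"
  shows "form (embed u) (embed v) = aform \<Omega> V u v"
proof -
  let ?u = "representative (embed u)" and ?v = "representative (embed v)"
  have u': "?u \<in> H01 \<Omega>" "embed ?u = embed u" and v': "?v \<in> H01 \<Omega>" "embed ?v = embed v"
    by (simp_all add: representative_in_H01 embed_representative embed_in_H1_space u v)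
  have "form (embed u) (embed v) = aform \<Omega> V u ?v"
    unfolding form_def by (rule aform_cong_left[OF u'(1) u u'(2) v'(1)])
  also have "\<dots> = aform \<Omega> V ?v u" by (rule aform_symmetric[OF u v'(1)])
  also have "\<dots> = aform \<Omega> V v u" by (rule aform_cong_left[OF v'(1) v v'(2) u])
  also have "\<dots> = aform \<Omega> V u v" by (rule aform_symmetric[OF v u])
  finally show ?thesis .
qed

lemma form_coercive: "\<exists>c>0. \<forall>s\<in>H1_space. c * (norm s)\<^sup>2 \<le> form s s"
proof -
  obtain P where P: "0 \<le> P" "\<And>s. s \<in> H1_space \<Longrightarrow> norm (fst s) \<le> P * norm (snd s)"
    by (rule Poincare) blast
  obtain c where c: "0 < c" "\<And>u. u \<in> H01 \<Omega> \<Longrightarrow> c * (norm (snd (embed u)))\<^sup>2 \<le> aform \<Omega> V u u"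
    using admissible unfolding admissible_potential_def by (auto simp: integral_norm_wgrad)
  have "0 < P\<^sup>2 + 1" by (simp add: add_nonneg_pos)
  have "c / (P\<^sup>2 + 1) * (norm s)\<^sup>2 \<le> form s s" if s: "s \<in> H1_space" for s
  proof -
    have "(norm (fst s))\<^sup>2 \<le> (P * norm (snd s))\<^sup>2"
      using P(2)[OF s] by (intro power_mono) auto
    then have "(norm s)\<^sup>2 \<le> (P\<^sup>2 + 1) * (norm (snd s))\<^sup>2"
      by (cases s) (simp add: norm_Pair power_mult_distrib distrib_right)
    then have "c / (P\<^sup>2 + 1) * (norm s)\<^sup>2 \<le> c / (P\<^sup>2 + 1) * ((P\<^sup>2 + 1) * (norm (snd s))\<^sup>2)"
      using c(1) \<open>0 < P\<^sup>2 + 1\<close> by (intro mult_left_mono) auto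
    also have "\<dots> = c * (norm (snd s))\<^sup>2"
      using \<open>0 < P\<^sup>2 + 1\<close> by simp
    also have "\<dots> \<le> form s s"
      using c(2)[OF representative_in_H01[OF s]] by (simp add: form_def embed_representative[OF s])
    finally show ?thesis .
  qed
  then show ?thesis using c(1) \<open>0 < P\<^sup>2 + 1\<close> by (intro exI[of _ "c / (P\<^sup>2 + 1)"]) simp
qed

lemma form_bounded: "\<exists>C. \<forall>s\<in>H1_space. form s s \<le> C * (norm s)\<^sup>2"
proof -
  obtain C where C: "0 < C" "\<And>u. u \<in> H01 \<Omega> \<Longrightarrow> aform \<Omega> V u u \<le> C * (norm (snd (embed u)))\<^sup>2"
    using admissible unfolding admissible_potential_def by (auto simp: integral_norm_wgrad)
  have "form s s \<le> C * (norm s)\<^sup>2" if s: "s \<in> H1_space" for s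
  proof -
    have "form s s \<le> C * (norm (snd s))\<^sup>2"
      using C(2)[OF representative_in_H01[OF s]] by (simp add: form_def embed_representative[OF s])
    also have "\<dots> \<le> C * (norm s)\<^sup>2"
      using C(1) by (intro mult_left_mono) (cases s, simp_all add: norm_Pair)
    finally show ?thesis .
  qed
  then show ?thesis by blast
qed

sublocale form: coercive_form H1_space form
proof (unfold_locales, rule closed_H1_space, rule subspace_H1_space)
  fix x y z assume xyz: "x \<in> H1_space" "y \<in> H1_space" "z \<in> H1_space"
  note reps = xyz[THEN representative_in_H01] xyz[THEN embed_representative]
  show "form (x + y) z = form x z + form y z"
    using form_embed[OF H01_add[OF reps(1,2)] reps(3)] aform_add_left[OF reps(1-3)]
    by (simp add: embed_add reps) (simp add: form_def)
next
  fix r x y assume xy: "x \<in> H1_space" "y \<in> H1_space"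
  note reps = xy[THEN representative_in_H01] xy[THEN embed_representative]
  show "form (r *\<^sub>R x) y = r * form x y"
    using form_embed[OF H01_scale[OF reps(1), of r] reps(2)] aform_scale_left[OF reps(1,2)]
    by (simp add: embed_scale reps) (simp add: form_def)
  show "form x y = form y x"
    unfolding form_def by (rule aform_symmetric[OF reps(1,2)])
qed (rule form_coercive form_bounded)+

definition L2_pairing :: "('d, real) L2 \<times> ('d, 'd) L2 \<Rightarrow> ('d, real) L2 \<times> ('d, 'd) L2 \<Rightarrow> real" where
  "L2_pairing s s' = fst s \<bullet> fst s'"

lemma bounded_bilinear_L2_pairing: "bounded_bilinear L2_pairing"
  unfolding L2_pairing_def
  by (rule bounded_bilinear.comp[OF bounded_bilinear_inner bounded_linear_fst bounded_linear_fst])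

definition Green :: "('d, real) L2 \<times> ('d, 'd) L2 \<Rightarrow> ('d, real) L2 \<times> ('d, 'd) L2" where
  "Green = form.solution_operator L2_pairing"

lemmas bounded_linear_Green =
  form.bounded_linear_solution_operator[OF bounded_bilinear_L2_pairing, folded Green_def]

lemmas Green_in_H1_space = form.solution_operator_in[OF bounded_bilinear_L2_pairing, folded Green_def]

lemmas form_Green = form.solution_operator_eq[OF bounded_bilinear_L2_pairing, folded Green_def]

lemma Green_nonneg: "0 \<le> L2_pairing (Green s) s"
  using form.nonneg[OF Green_in_H1_space] form_Green[OF Green_in_H1_space, of s s]
  by (metis L2_pairing_def inner_commute)

lemma
  assumes f: "f \<in> H01 \<Omega>"
  shows Gop_in_H01: "Gop \<Omega> V f \<in> H01 \<Omega>"
    and embed_Gop: "embed (Gop \<Omega> V f) = Green (embed f)"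
proof -
  let ?w = "representative (Green (embed f))"
  have w: "?w \<in> H01 \<Omega>" "embed ?w = Green (embed f)"
    by (simp_all add: representative_in_H01 embed_representative Green_in_H1_space)
  have "aform \<Omega> V ?w v = L2inner \<Omega> f v" if v: "v \<in> H01 \<Omega>" for v
    using form_embed[OF w(1) v] form_Green[OF embed_in_H1_space[OF v], of "embed f"]
    by (simp add: w(2) L2inner_eq_inner_embed[OF f v] L2_pairing_def)
  with w(1) have "?w \<in> H01 \<Omega> \<and> (\<forall>v\<in>H01 \<Omega>. aform \<Omega> V ?w v = L2inner \<Omega> f v)" by blast
  then have Gop: "Gop \<Omega> V f \<in> H01 \<Omega> \<and> (\<forall>v\<in>H01 \<Omega>. aform \<Omega> V (Gop \<Omega> V f) v = L2inner \<Omega> f v)"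
    unfolding Gop_def
    by (rule someI[where P = "\<lambda>w. w \<in> H01 \<Omega> \<and> (\<forall>v\<in>H01 \<Omega>. aform \<Omega> V w v = L2inner \<Omega> f v)"])
  then show in_H01: "Gop \<Omega> V f \<in> H01 \<Omega>" by simp
  show "embed (Gop \<Omega> V f) = Green (embed f)"
  proof (rule form.eqI[OF embed_in_H1_space[OF in_H01] Green_in_H1_space])
    fix s assume s: "s \<in> H1_space"
    have v: "representative s \<in> H01 \<Omega>" "embed (representative s) = s"
      using s by (simp_all add: representative_in_H01 embed_representative)
    show "form (embed (Gop \<Omega> V f)) s = form (Green (embed f)) s"
      using Gop v(1) form_embed[OF in_H01 v(1)] form_Green[OF s, of "embed f"]
      by (simp add: v(2) L2inner_eq_inner_embed[OF f v(1)] L2_pairing_def)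
  qed
qed

lemma Hnorm_eq: "u \<in> H01 \<Omega> \<Longrightarrow> Hnorm \<Omega> V u = sqrt (form (embed u) (embed u))"
  by (simp add: Hnorm_def form_embed)

lemma Hnorm_diff_tendsto_0_iff:
  assumes f: "\<forall>\<^sub>F x in F. f x \<in> H01 \<Omega>" and g: "g \<in> H01 \<Omega>"
  shows "((\<lambda>x. Hnorm \<Omega> V (\<lambda>y. f x y - g y)) \<longlongrightarrow> 0) F \<longleftrightarrow> ((\<lambda>x. embed (f x)) \<longlongrightarrow> embed g) F"
proof -
  have "((\<lambda>x. Hnorm \<Omega> V (\<lambda>y. f x y - g y)) \<longlongrightarrow> 0) F \<longleftrightarrow>
      ((\<lambda>x. sqrt (form (embed (f x) - embed g) (embed (f x) - embed g))) \<longlongrightarrow> 0) F"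
    by (rule tendsto_cong, use f in eventually_elim) (simp add: Hnorm_eq H01_diff embed_diff g)
  also have "\<dots> \<longleftrightarrow> ((\<lambda>x. embed (f x) - embed g) \<longlongrightarrow> 0) F"
  proof (rule form.energy_norm_tendsto_0_iff)
    show "\<forall>\<^sub>F x in F. embed (f x) - embed g \<in> H1_space"
      using f by eventually_elim (intro subspace_diff[OF subspace_H1_space] embed_in_H1_space g)
  qed
  finally show ?thesis by (simp add: LIM_zero_iff)
qed

lemma Hnorm_diff_eq_0_iff:
  assumes "u \<in> H01 \<Omega>" "v \<in> H01 \<Omega>"
  shows "Hnorm \<Omega> V (\<lambda>x. u x - v x) = 0 \<longleftrightarrow> embed u = embed v"
  using Hnorm_diff_tendsto_0_iff[of "\<lambda>_. u" sequentially v] assms by (simp add: LIMSEQ_const_iff)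

section \<open>The flow of tuples of Sobolev functions\<close>

sublocale flow: Oja_flow Green "\<lambda>s s'. L2_pairing (Green s) s'"
  by (intro Oja_flow.intro bounded_linear_Green Green_nonneg
      bounded_bilinear.comp[OF bounded_bilinear_L2_pairing bounded_linear_Green bounded_linear_ident])

definition embeds :: "('n::finite \<Rightarrow> 'd \<Rightarrow> real) \<Rightarrow> (('d, real) L2 \<times> ('d, 'd) L2) ^ 'n" where
  "embeds U = (\<chi> i. embed (U i))"

definition flow_rhs :: "('n::finite \<Rightarrow> 'd \<Rightarrow> real) \<Rightarrow> 'n \<Rightarrow> 'd \<Rightarrow> real" where
  "flow_rhs U i = (\<lambda>x. GT \<Omega> V U i x - tmul U (gram \<Omega> (GT \<Omega> V U) U) i x)"

lemma
  fixes U :: "'n::finite \<Rightarrow> 'd \<Rightarrow> real"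
  assumes U: "\<And>i. U i \<in> H01 \<Omega>"
  shows flow_rhs_in_H01: "flow_rhs U i \<in> H01 \<Omega>"
    and embeds_flow_rhs: "embeds (flow_rhs U) = flow.oja_field (embeds U)"
proof -
  define A where "A = gram \<Omega> (GT \<Omega> V U) U"
  have A: "A j i = L2_pairing (Green (embed (U j))) (embed (U i))" for i j
    by (simp add: A_def gram_def GT_def L2inner_eq_inner_embed Gop_in_H01 embed_Gop U L2_pairing_def)
  have summand: "(\<lambda>x. U j x * A j i) \<in> H01 \<Omega>" "embed (\<lambda>x. U j x * A j i) = A j i *\<^sub>R embed (U j)" for i j
    using H01_scale[OF U, of "A j i" j] embed_scale[OF U, of "A j i" j] by (simp_all add: mult.commute)
  have tmul: "tmul U A i \<in> H01 \<Omega>" "embed (tmul U A i) = (\<Sum>j\<in>UNIV. A j i *\<^sub>R embed (U j))" for i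
    using H01_sum[of UNIV "\<lambda>j x. U j x * A j i"] embed_sum[of UNIV "\<lambda>j x. U j x * A j i"]
    by (simp_all add: tmul_def summand)
  have rhs: "flow_rhs U i = (\<lambda>x. Gop \<Omega> V (U i) x - tmul U A i x)" for i
    by (simp add: flow_rhs_def A_def GT_def)
  show "flow_rhs U i \<in> H01 \<Omega>"
    unfolding rhs by (intro H01_diff Gop_in_H01 U tmul)
  show "embeds (flow_rhs U) = flow.oja_field (embeds U)"
    by (simp add: vec_eq_iff embeds_def flow.oja_field_def rhs embed_diff Gop_in_H01 embed_Gop U tmul A)
qed

lemma embeds_eq_iff:
  assumes "\<And>i. U i \<in> H01 \<Omega>" "\<And>i. W i \<in> H01 \<Omega>"
  shows "embeds U = embeds W \<longleftrightarrow> (\<forall>i. Hnorm \<Omega> V (\<lambda>x. U i x - W i x) = 0)"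
  using assms by (simp add: embeds_def vec_eq_iff Hnorm_diff_eq_0_iff)

lemma embeds_tendsto_iff:
  fixes f :: "'b \<Rightarrow> 'n::finite \<Rightarrow> 'd \<Rightarrow> real"
  assumes f: "\<And>i. \<forall>\<^sub>F x in F. f x i \<in> H01 \<Omega>" and g: "\<And>i. g i \<in> H01 \<Omega>"
  shows "((\<lambda>x. embeds (f x)) \<longlongrightarrow> embeds g) F \<longleftrightarrow>
    (\<forall>i. ((\<lambda>x. Hnorm \<Omega> V (\<lambda>y. f x i y - g i y)) \<longlongrightarrow> 0) F)"
proof -
  have "((\<lambda>x. embeds (f x)) \<longlongrightarrow> embeds g) F \<longleftrightarrow> (\<forall>i. ((\<lambda>x. embed (f x i)) \<longlongrightarrow> embed (g i)) F)"
  proof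
    assume "((\<lambda>x. embeds (f x)) \<longlongrightarrow> embeds g) F"
    from tendsto_vec_nth[OF this] show "\<forall>i. ((\<lambda>x. embed (f x i)) \<longlongrightarrow> embed (g i)) F"
      by (simp add: embeds_def)
  qed (auto intro!: vec_tendstoI simp: embeds_def)
  then show ?thesis by (simp add: Hnorm_diff_tendsto_0_iff f g)
qed

lemma embeds_difference_quotient:
  assumes U: "\<And>i. U i \<in> H01 \<Omega>" and W: "\<And>i. W i \<in> H01 \<Omega>"
  shows "embeds (\<lambda>i x. (U i x - W i x) / h) = (embeds U - embeds W) /\<^sub>R h"
    and "(\<lambda>x. (U i x - W i x) / h) \<in> H01 \<Omega>"
  using H01_scale[OF H01_diff[OF U W], of "inverse h"] embed_scale[OF H01_diff[OF U W], of "inverse h"]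
  by (simp_all add: embeds_def vec_eq_iff embed_diff U W divide_inverse mult.commute)

lemma embeds_has_vector_derivative_iff:
  fixes U :: "real \<Rightarrow> 'n::finite \<Rightarrow> 'd \<Rightarrow> real"
  assumes U: "\<And>t i. 0 \<le> t \<Longrightarrow> U t i \<in> H01 \<Omega>" and D: "\<And>i. D i \<in> H01 \<Omega>" and "0 \<le> t"
  shows "((\<lambda>t. embeds (U t)) has_vector_derivative embeds D) (at t within {0..}) \<longleftrightarrow>
    (\<forall>i. ((\<lambda>h. Hnorm \<Omega> V (\<lambda>x. (U (t + h) i x - U t i x) / h - D i x)) \<longlongrightarrow> 0) (at 0 within {-t..}))"
proof -
  have nonneg: "\<forall>\<^sub>F h in at 0 within {-t..}. 0 \<le> t + h"
    by (auto simp: eventually_at_filter)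
  then have "\<forall>\<^sub>F h in at 0 within {-t..}. (\<lambda>x. (U (t + h) i x - U t i x) / h) \<in> H01 \<Omega>" for i
    by eventually_elim (intro embeds_difference_quotient U \<open>0 \<le> t\<close>)
  then have "((\<lambda>h. embeds (\<lambda>i x. (U (t + h) i x - U t i x) / h)) \<longlongrightarrow> embeds D) (at 0 within {-t..})
      \<longleftrightarrow> (\<forall>i. ((\<lambda>h. Hnorm \<Omega> V (\<lambda>x. (U (t + h) i x - U t i x) / h - D i x)) \<longlongrightarrow> 0) (at 0 within {-t..}))"
    by (rule embeds_tendsto_iff) (rule D)
  moreover have "((\<lambda>h. embeds (\<lambda>i x. (U (t + h) i x - U t i x) / h)) \<longlongrightarrow> embeds D) (at 0 within {-t..})
      \<longleftrightarrow> ((\<lambda>h. (embeds (U (t + h)) - embeds (U t)) /\<^sub>R h) \<longlongrightarrow> embeds D) (at 0 within {-t..})"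
    by (rule tendsto_cong, use nonneg in eventually_elim)
       (simp add: embeds_difference_quotient U \<open>0 \<le> t\<close>)
  ultimately show ?thesis
    by (simp add: has_vector_derivative_atLeast_iff)
qed

lemma is_solution_imp_integral_curve:
  fixes U :: "real \<Rightarrow> 'n::finite \<Rightarrow> 'd \<Rightarrow> real"
  assumes U0: "\<And>i. U0 i \<in> H01 \<Omega>" and sol: "is_solution \<Omega> V U0 U"
  shows "embeds (U 0) = embeds U0" and "integral_curve flow.oja_field {0..} (\<lambda>t. embeds (U t))"
proof -
  have U: "U t i \<in> H01 \<Omega>" if "0 \<le> t" for t i
    using sol that by (simp add: is_solution_def)
  show "embeds (U 0) = embeds U0"
    using sol U0 U by (simp add: embeds_eq_iff is_solution_def)
  obtain U' where U': "\<forall>t\<ge>0. \<forall>i. U' t i \<in> H01 \<Omega>"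
    and quotient: "\<forall>t\<ge>0. \<forall>i.
      ((\<lambda>h. Hnorm \<Omega> V (\<lambda>x. (U (t + h) i x - U t i x) / h - U' t i x)) \<longlongrightarrow> 0) (at 0 within {-t..})"
    and rhs: "\<forall>t\<ge>0. \<forall>i. Hnorm \<Omega> V (\<lambda>x. U' t i x - flow_rhs (U t) i x) = 0"
    using sol unfolding is_solution_def flow_rhs_def by (elim conjE exE)
  have "((\<lambda>t. embeds (U t)) has_vector_derivative flow.oja_field (embeds (U t))) (at t within {0..})"
    if t: "0 \<le> t" for t
  proof -
    have U't: "U' t i \<in> H01 \<Omega>" for i using U' t by blast
    have "embeds (U' t) = embeds (flow_rhs (U t))"
      using rhs t U't flow_rhs_in_H01[of "U t", OF U[OF t]] by (simp add: embeds_eq_iff)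
    also have "\<dots> = flow.oja_field (embeds (U t))"
      by (rule embeds_flow_rhs[OF U[OF t]])
    finally show ?thesis
      using embeds_has_vector_derivative_iff[of U "U' t", OF U U't t] quotient t by simp
  qed
  then show "integral_curve flow.oja_field {0..} (\<lambda>t. embeds (U t))"
    by (simp add: integral_curve_def)
qed

lemma integral_curve_imp_is_solution:
  fixes U :: "real \<Rightarrow> 'n::finite \<Rightarrow> 'd \<Rightarrow> real"
  assumes U0: "\<And>i. U0 i \<in> H01 \<Omega>" and U: "\<And>t i. 0 \<le> t \<Longrightarrow> U t i \<in> H01 \<Omega>"
    and init: "embeds (U 0) = embeds U0"
    and curve: "integral_curve flow.oja_field {0..} (\<lambda>t. embeds (U t))"
  shows "is_solution \<Omega> V U0 U"
proof -
  have rhs: "flow_rhs (U t) i \<in> H01 \<Omega>" "embeds (flow_rhs (U t)) = flow.oja_field (embeds (U t))"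
    if "0 \<le> t" for t i
    by (rule flow_rhs_in_H01[OF U[OF that]], rule embeds_flow_rhs[OF U[OF that]])
  have "\<forall>i. ((\<lambda>h. Hnorm \<Omega> V (\<lambda>x. (U (t + h) i x - U t i x) / h - flow_rhs (U t) i x)) \<longlongrightarrow> 0)
      (at 0 within {-t..})"
    if t: "0 \<le> t" for t
    using curve t embeds_has_vector_derivative_iff[of U "flow_rhs (U t)", OF U rhs(1)[OF t] t]
    by (simp add: integral_curve_def rhs(2))
  moreover have "\<forall>i. ((\<lambda>s. Hnorm \<Omega> V (\<lambda>x. flow_rhs (U s) i x - flow_rhs (U t) i x)) \<longlongrightarrow> 0)
      (at t within {0..})"
    if t: "0 \<le> t" for t
  proof -
    have nonneg: "\<forall>\<^sub>F s in at t within {0..}. 0 \<le> s"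
      by (simp add: eventually_at_filter)
    have "continuous_on {0..} (\<lambda>t. flow.oja_field (embeds (U t)))"
      by (intro continuous_on_compose2[OF lipschitz_on_balls_continuous_on[OF flow.lipschitz_on_balls_oja_field]]
          integral_curve_continuous_on[OF curve]) auto
    then have "((\<lambda>s. flow.oja_field (embeds (U s))) \<longlongrightarrow> embeds (flow_rhs (U t))) (at t within {0..})"
      using t by (simp add: continuous_on_def rhs(2))
    then have "((\<lambda>s. embeds (flow_rhs (U s))) \<longlongrightarrow> embeds (flow_rhs (U t))) (at t within {0..})"
      by (rule Lim_transform_eventually) (use nonneg in eventually_elim, simp add: rhs(2))
    moreover have "\<forall>\<^sub>F s in at t within {0..}. flow_rhs (U s) i \<in> H01 \<Omega>" for i
      using nonneg by eventually_elim (rule rhs(1))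
    ultimately show ?thesis
      by (subst (asm) embeds_tendsto_iff) (auto intro: rhs(1)[OF t])
  qed
  moreover have "Hnorm \<Omega> V (\<lambda>x. flow_rhs (U t) i x - flow_rhs (U t) i x) = 0" if "0 \<le> t" for t i
    by (rule iffD2[OF Hnorm_diff_eq_0_iff refl]) (rule rhs(1)[OF that])+
  moreover have "\<forall>i. Hnorm \<Omega> V (\<lambda>x. U 0 i x - U0 i x) = 0"
    using init by (simp add: embeds_eq_iff U U0)
  ultimately show ?thesis
    unfolding is_solution_def using U rhs(1)
    by (intro conjI exI[of _ "\<lambda>t. flow_rhs (U t)"]) (auto simp: flow_rhs_def)
qed

lemma solution_exists:
  fixes U0 :: "'n::finite \<Rightarrow> 'd \<Rightarrow> real"
  assumes U0: "\<And>i. U0 i \<in> H01 \<Omega>"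
  shows "\<exists>U. is_solution \<Omega> V U0 U"
proof -
  obtain X where X: "X 0 = embeds U0" "\<And>t i. 0 \<le> t \<Longrightarrow> X t $ i \<in> H1_space"
    "integral_curve flow.oja_field {0..} X"
    by (rule flow.oja_flow_exists[OF closed_H1_space subspace_H1_space Green_in_H1_space,
          of "embeds U0"])
       (auto simp: embeds_def embed_in_H1_space U0)
  define U where "U t i = representative (X t $ i)" for t i
  have U: "U t i \<in> H01 \<Omega>" "embeds (U t) = X t" if "0 \<le> t" for t i
    using X(2)[OF that]
    by (simp_all add: U_def embeds_def vec_eq_iff representative_in_H01 embed_representative)
  have "integral_curve flow.oja_field {0..} (\<lambda>t. embeds (U t))"
    using X(3) U(2) integral_curve_cong[of "{0..}" "\<lambda>t. embeds (U t)" X flow.oja_field flow.oja_field]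
    by auto
  then have "is_solution \<Omega> V U0 U"
    by (intro integral_curve_imp_is_solution U0 U(1)) (simp_all add: U(2) X(1))
  then show ?thesis by blast
qed

lemma solution_unique:
  fixes U W :: "real \<Rightarrow> 'n::finite \<Rightarrow> 'd \<Rightarrow> real"
  assumes U0: "\<And>i. U0 i \<in> H01 \<Omega>"
    and U: "is_solution \<Omega> V U0 U" and W: "is_solution \<Omega> V U0 W" and "0 \<le> t"
  shows "Hnorm \<Omega> V (\<lambda>x. U t i x - W t i x) = 0"
proof -
  note curve = is_solution_imp_integral_curve[OF U0]
  have "embeds (U t) = embeds (W t)"
  proof (rule integral_curve_unique[OF flow.lipschitz_on_balls_oja_field])
    show "integral_curve flow.oja_field {0..t} (\<lambda>t. embeds (U t))"
      "integral_curve flow.oja_field {0..t} (\<lambda>t. embeds (W t))"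
      using curve(2)[OF U] curve(2)[OF W] by (auto intro: integral_curve_subset)
    show "embeds (U 0) = embeds (W 0)"
      using curve(1)[OF U] curve(1)[OF W] by simp
  qed (rule \<open>0 \<le> t\<close>)
  moreover have "U t i \<in> H01 \<Omega>" "W t i \<in> H01 \<Omega>" for i
    using U W \<open>0 \<le> t\<close> by (simp_all add: is_solution_def)
  ultimately show ?thesis by (simp add: embeds_eq_iff)
qed

end

theorem theorem3p6:
  fixes \<Omega> :: "'d::euclidean_space set" and V :: "'d \<Rightarrow> real"
    and U0 :: "'n::finite \<Rightarrow> 'd \<Rightarrow> real"
  assumes "bdomain \<Omega>" and "admissible_potential \<Omega> V"
    and "U0 \<in> quasi_stiefel \<Omega>"
  shows "(\<exists>U. is_solution \<Omega> V U0 U) \<and>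
         (\<forall>U W. is_solution \<Omega> V U0 U \<longrightarrow> is_solution \<Omega> V U0 W \<longrightarrow>
            (\<forall>t\<ge>0. \<forall>i. Hnorm \<Omega> V (\<lambda>x. U t i x - W t i x) = 0))"
proof -
  interpret schroedinger \<Omega> V
    using assms by unfold_locales (auto simp: bdomain_def)
  have U0: "U0 i \<in> H01 \<Omega>" for i
    using assms(3) by (simp add: quasi_stiefel_def)
  show ?thesis
    using solution_exists[of U0, OF U0] solution_unique[of U0, OF U0] by blast
qed

end
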